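(* Let $n\geq m\geq 1$ be integers and let $J_{n,m}\subset S=K[x_1,\ldots,x_n]$ be the ideal generated by all squarefree monomials of degree $m$. Then $$\operatorname{hdepth}(J_{n,m})=m+\left\lfloor \frac{n-m}{m+1}\right\rfloor.$$
   Context: $K$ is a field and $S=K[x_1,\ldots,x_n]$ carries the standard grading. For a finitely generated graded $S$-module $M$ with Hilbert series $H_M(t)$, the Hilbert depth $\operatorname{hdepth}(M)$ is the maximal depth of a finitely generated graded $S$-module $N$ with $H_N(t)=H_M(t)$; equivalently (a theorem of Uliczka), $\operatorname{hdepth}(M)=\max\{r\ge 0:(1-t)^rH_M(t)\text{ has only non-negative coefficients}\}$. *)

theory Defs
  imports
    "HOL-Algebra.Module"
    "HOL-Algebra.Algebraic_Closure_Type"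
    "HOL-Library.Poly_Mapping"
    "HOL-Library.Cardinality"
    "HOL-Library.Extended_Nat"
    "HOL-Computational_Algebra.Formal_Laurent_Series"
begin

section \<open>The standard graded polynomial ring\<close>

text \<open>The type \<open>('n, 'k) mpoly\<close> is the ring \<open>S = K[x\<^sub>1, \<dots>, x\<^sub>n]\<close>, where the variables are
  indexed by the finite type \<open>'n\<close>, so that \<open>n = CARD('n)\<close>. An exponent vector is an element of
  \<open>'n \<Rightarrow>\<^sub>0 nat\<close>.\<close>

type_synonym ('n, 'k) mpoly = "('n \<Rightarrow>\<^sub>0 nat) \<Rightarrow>\<^sub>0 'k"

abbreviation poly_ring :: "('n::finite, 'k::field) mpoly ring" where
  "poly_ring \<equiv> ring_of_type_algebra"

definition const :: "'k::field \<Rightarrow> ('n::finite, 'k) mpoly" where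
  "const a = Poly_Mapping.single 0 a"

definition var :: "'n \<Rightarrow> ('n::finite, 'k::field) mpoly" where
  "var i = Poly_Mapping.single (Poly_Mapping.single i 1) 1"

definition monom_degree :: "('n::finite \<Rightarrow>\<^sub>0 nat) \<Rightarrow> nat" where
  "monom_degree e = (\<Sum>i\<in>UNIV. Poly_Mapping.lookup e i)"

text \<open>The graded component \<open>S\<^sub>k\<close>; it is zero for negative \<open>k\<close>.\<close>

definition homogeneous_part :: "int \<Rightarrow> ('n::finite, 'k::field) mpoly set" where
  "homogeneous_part k = {f. \<forall>e\<in>Poly_Mapping.keys f. int (monom_degree e) = k}"

definition irrelevant_ideal :: "('n::finite, 'k::field) mpoly set" where
  "irrelevant_ideal = Idl\<^bsub>poly_ring\<^esub> (range var)"


section \<open>Finitely generated graded modules\<close>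

text \<open>The multiplication and unit that module records inherit from rings play no
  role for modules.\<close>

record ('a, 'b) graded_module = "('a, 'b) module" +
  component :: "int \<Rightarrow> 'b set"

locale fg_graded_module = module poly_ring M
  for M :: "(('n::finite, 'k::field) mpoly, 'b) graded_module" (structure) +
  assumes component_subgroup: "\<And>k. additive_subgroup (component M k) M"
    and direct_sum:
      "\<And>x. x \<in> carrier M \<Longrightarrow>
        \<exists>!c. (\<forall>k. c k \<in> component M k) \<and> finite {k. c k \<noteq> \<zero>\<^bsub>M\<^esub>} \<and>
             x = (\<Oplus>\<^bsub>M\<^esub>k\<in>{k. c k \<noteq> \<zero>\<^bsub>M\<^esub>}. c k)"
    and smult_component:
      "\<And>i j f x. f \<in> homogeneous_part i \<Longrightarrow> x \<in> component M j \<Longrightarrow>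
        f \<odot>\<^bsub>M\<^esub> x \<in> component M (i + j)"
    and finitely_generated:
      "\<exists>A. finite A \<and> A \<subseteq> carrier M \<and>
        (\<forall>x\<in>carrier M. \<exists>f. x = (\<Oplus>\<^bsub>M\<^esub>a\<in>A. f a \<odot>\<^bsub>M\<^esub> a))"

text \<open>The field \<open>K\<close> acts on each component through the constant polynomials.\<close>

definition component_basis ::
    "(('n::finite, 'k::field) mpoly, 'b) graded_module \<Rightarrow> int \<Rightarrow> 'b set \<Rightarrow> bool" where
  "component_basis M k B \<longleftrightarrow> finite B \<and> B \<subseteq> component M k \<and>
     (\<forall>x\<in>component M k. \<exists>!a. a \<in> B \<rightarrow>\<^sub>E UNIV \<and> x = (\<Oplus>\<^bsub>M\<^esub>b\<in>B. const (a b) \<odot>\<^bsub>M\<^esub> b))"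

definition hilbert_function ::
    "(('n::finite, 'k::field) mpoly, 'b) graded_module \<Rightarrow> int \<Rightarrow> nat" where
  "hilbert_function M k = (THE d. \<exists>B. component_basis M k B \<and> card B = d)"

text \<open>The components of a finitely generated graded module vanish in all sufficiently negative
  degrees, so \<^const>\<open>Abs_fls\<close> is applied to an admissible coefficient function.\<close>

definition hilbert_series ::
    "(('n::finite, 'k::field) mpoly, 'b) graded_module \<Rightarrow> int fls" where
  "hilbert_series M = Abs_fls (\<lambda>k. int (hilbert_function M k))"


section \<open>Depth and Hilbert depth\<close>

text \<open>The submodule \<open>(f\<^sub>1, \<dots>, f\<^sub>r) M\<close>.\<close>

definition seq_times ::
    "('n::finite, 'k::field) mpoly list \<Rightarrow> (('n, 'k) mpoly, 'b) graded_module \<Rightarrow> 'b set" where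
  "seq_times fs M =
     {(\<Oplus>\<^bsub>M\<^esub>i\<in>{..<length fs}. (fs ! i) \<odot>\<^bsub>M\<^esub> y i) | y. y \<in> {..<length fs} \<rightarrow> carrier M}"

text \<open>The first condition says that each \<open>f\<^sub>i\<^sub>+\<^sub>1\<close> is a non-zero-divisor on
  \<open>M / (f\<^sub>1, \<dots>, f\<^sub>i) M\<close>.\<close>

definition regular_sequence ::
    "('n::finite, 'k::field) mpoly list \<Rightarrow> (('n, 'k) mpoly, 'b) graded_module \<Rightarrow> bool" where
  "regular_sequence fs M \<longleftrightarrow>
     (\<forall>i<length fs. \<forall>x\<in>carrier M.
        (fs ! i) \<odot>\<^bsub>M\<^esub> x \<in> seq_times (take i fs) M \<longrightarrow> x \<in> seq_times (take i fs) M) \<and>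
     seq_times fs M \<noteq> carrier M"

definition depth :: "(('n::finite, 'k::field) mpoly, 'b) graded_module \<Rightarrow> enat" where
  "depth M = (SUP fs\<in>{fs. set fs \<subseteq> irrelevant_ideal \<and> regular_sequence fs M}. enat (length fs))"

text \<open>The competing modules \<open>N\<close> are those whose elements have type \<open>(nat \<Rightarrow> S) set\<close>. Up to graded
  isomorphism these are all finitely generated graded modules: if \<open>g\<^sub>0, \<dots>, g\<^sub>r\<^sub>-\<^sub>1\<close> generate a module
  of any type, then sending \<open>x\<close> to the set of all \<open>v\<close> with \<open>x = v\<^sub>0 g\<^sub>0 + \<dots> + v\<^sub>r\<^sub>-\<^sub>1 g\<^sub>r\<^sub>-\<^sub>1\<close> is
  injective, and the whole structure can be transported along this map. A finite supremum of a
  nonempty set in \<^typ>\<open>enat\<close> is a maximum.\<close>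

definition hdepth :: "(('n::finite, 'k::field) mpoly, 'b) graded_module \<Rightarrow> enat" where
  "hdepth M =
     (SUP N\<in>{N :: (('n, 'k) mpoly, (nat \<Rightarrow> ('n, 'k) mpoly) set) graded_module.
              fg_graded_module N \<and> hilbert_series N = hilbert_series M}. depth N)"


section \<open>Squarefree Veronese ideals\<close>

definition ideal_module ::
    "('n::finite, 'k::field) mpoly set \<Rightarrow> (('n, 'k) mpoly, ('n, 'k) mpoly) graded_module" where
  "ideal_module I = \<lparr>carrier = I, monoid.mult = (*), one = 1, zero = 0, add = (+), module.smult = (*),
     component = (\<lambda>k. I \<inter> homogeneous_part k)\<rparr>"

definition squarefree_veronese :: "nat \<Rightarrow> ('n::finite, 'k::field) mpoly set" where
  "squarefree_veronese m = Idl\<^bsub>poly_ring\<^esub> {\<Prod>i\<in>A. var i | A :: 'n set. card A = m}"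

end

theory Submission
  imports Defs "HOL-Library.Function_Algebras"
begin

text \<open>Write \<open>n = CARD('n)\<close>, \<open>s = (n - m) div (m + 1)\<close> and \<open>r = m + s\<close>.

  Upper bound. Let \<open>N\<close> have the Hilbert series of \<open>J\<^bsub>n,m\<^esub>\<close> and let \<open>f\<^sub>1, \<dots>, f\<^sub>l\<close> be a regular sequence
  on \<open>N\<close>. After adjoining indeterminates \<open>u\<^sub>0, u\<^sub>1, \<dots>\<close>, the linear forms \<open>\<Sum>\<^sub>i u\<^sub>k\<^sup>i x\<^sub>i\<close> (\<open>k < l\<close>) form a
  regular sequence on \<open>N[u]\<close>: by McCoy's argument such a form is a nonzerodivisor as soon as no
  nonzero element is killed by all \<open>x\<^sub>i\<close>, and the \<open>f\<^sub>i\<close> are exchanged for these forms one at a time.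
  Since \<open>N\<close> vanishes below degree \<open>m\<close>, the forms define an injection \<open>N\<^sub>m[u]\<^sup>l \<rightarrow> N\<^sub>m\<^sub>+\<^sub>1[u]\<close>, so comparing
  dimensions of the pieces of bounded degree in \<open>u\<close> gives
  \<open>l (n choose m) \<le> dim N\<^sub>m\<^sub>+\<^sub>1 = m (n choose m) + (n choose (m + 1))\<close>.

  Lower bound. With \<open>y = t / (1 - t)\<close> the Hilbert series is \<open>\<Sum>\<^sub>j\<^sub>\<ge>\<^sub>m (n choose j) y\<^sup>j\<close>, whose part with
  \<open>j \<le> r\<close> equals \<open>\<Sum>\<^sub>k\<^sub>\<le>\<^sub>s a\<^sub>k y\<^bsup>m+k\<^esup> (1 + y)\<^bsup>s-k\<^esup> = \<Sum>\<^sub>k\<^sub>\<le>\<^sub>s a\<^sub>k t\<^bsup>m+k\<^esup> / (1 - t)\<^sup>r\<close>. A two-term recurrence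
  shows \<open>a\<^sub>k \<ge> 0\<close>, so this is the Hilbert series of a direct sum of shifted polynomial rings in at
  least \<open>r\<close> variables, which has depth at least \<open>r\<close>.\<close>

section \<open>Binomial identities\<close>

text \<open>The overview does not say why indeterminates are adjoined. A Hilbert series controls
  maps that raise degrees by exactly one, whereas the members of a regular sequence need not be
  linear or even homogeneous; and over a finite field there may be no regular linear form with
  coefficients in \<open>K\<close>. One indeterminate per form is enough: its powers act as
  \<open>n\<close> generic coefficients, and McCoy's argument runs in that indeterminate alone. The
  exponents then fill boxes of \<open>D ^ l\<close> and \<open>(D + n) ^ l\<close> points, whose
  ratio tends to 1.

  Quotients are never formed. A quotient is represented by the submodule \<open>Q\<close> that is
  divided out, and the module itself by the kernel of a map from a free module.

  Both bounds meet because \<open>(m + 1) * (n choose (m + 1)) = (n - m) * (n choose m)\<close>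
  turns the dimension inequality into \<open>l \<le> m + (n - m) / (m + 1)\<close>, while the proof
  of \<open>0 \<le> a_k\<close> uses \<open>s * (m + 1) \<le> n - m\<close>. The terms with
  \<open>j > r\<close> call for no rearrangement: \<open>t^j / (1 - t)^j\<close> already belongs to
  a polynomial ring in \<open>j\<close> variables generated in degree \<open>j\<close>.\<close>

text \<open>The coefficient of \<open>t\<^bsup>m+k\<^esup>\<close> in \<open>(1 - t)\<^bsup>m+s\<^esup> H(t)\<close>, where \<open>H(t) = \<Sum>\<^sub>j\<^sub>\<ge>\<^sub>m (n choose j) (t / (1 - t))\<^sup>j\<close>
  and \<open>k \<le> s\<close>.\<close>

definition trunc_coeff :: "nat \<Rightarrow> nat \<Rightarrow> nat \<Rightarrow> nat \<Rightarrow> int" where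
  "trunc_coeff n m s k =
     (\<Sum>i\<le>k. (-1) ^ (k - i) * int ((s - i) choose (k - i)) * int (n choose (m + i)))"

lemma choose_Suc_times:
  "(int j + 1) * int (n choose Suc j) = (int n - int j) * int (n choose j)"
proof (cases "j \<le> n")
  case True
  have "Suc j * (n choose Suc j) = (n - j) * (n choose j)"
    by (metis binomial_absorb_comp binomial_absorption)
  then have "int (Suc j) * int (n choose Suc j) = int (n - j) * int (n choose j)"
    by (simp only: flip: of_nat_mult)
  then show ?thesis using True by (simp add: of_nat_diff add.commute)
qed (simp add: binomial_eq_0)

text \<open>Telescoping certificate for \<open>trunc_coeff_rec\<close>: the right side is
  \<open>F i - F (Suc i)\<close> for the \<open>F\<close> defined there. Pascal's rule and the
  absorption identity, applied once in each of the two binomials, reduce the claim to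
  \<open>pq\<close> and \<open>aa\<close>.\<close>

lemma trunc_coeff_step_term:
  assumes "i \<le> k" "k < s" 
  shows "int (k + 1 + m) * ((-1) ^ (k + 1 - i) * int ((s - i) choose (k + 1 - i)) * int (n choose (m + i)))
    - (int n - int s + int k) * ((-1) ^ (k - i) * int ((s - i) choose (k - i)) * int (n choose (m + i)))
    = (-1) ^ (k + 1 - i) * int (m + i) * int (n choose (m + i)) * int ((s + 1 - i) choose (k + 1 - i))
    - (-1) ^ (k - i) * int (m + i + 1) * int (n choose (m + i + 1)) * int ((s - i) choose (k - i))"
proof -
  define p where "p = int ((s - i) choose (k - i))"
  define q where "q = int ((s - i) choose (k + 1 - i))"
  define a where "a = int (n choose (m + i))"
  define a' where "a' = int (n choose (m + i + 1))"
  define sg where "sg = (- 1 :: int) ^ (k - i)"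
  have sg: "(- 1) ^ (k + 1 - i) = - sg"
    using assms by (simp add: sg_def Suc_diff_le)
  have pascal: "int ((s + 1 - i) choose (k + 1 - i)) = p + q"
    using assms by (simp add: p_def q_def Suc_diff_le)
  have pq: "(int k + 1 - int i) * q = (int s - int k) * p"
    using choose_Suc_times[of "k - i" "s - i"] assms
    by (simp add: p_def q_def Suc_diff_le of_nat_diff algebra_simps)
  have aa: "(int m + int i + 1) * a' = (int n - int m - int i) * a"
    using choose_Suc_times[of "m + i" n] by (simp add: a_def a'_def algebra_simps)
  have "int (k + 1 + m) * (- sg * q * a) - (int n - int s + int k) * (sg * p * a)
     - (- sg * int (m + i) * a * (p + q) - sg * ((int m + int i + 1) * a') * p)
     = - sg * a * ((int k + 1 - int i) * q - (int s - int k) * p)"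
    unfolding aa by (simp add: algebra_simps)
  also have "\<dots> = 0" unfolding pq by simp
  finally show ?thesis
    unfolding sg pascal p_def[symmetric] q_def[symmetric] a_def[symmetric] a'_def[symmetric] sg_def[symmetric]
    by (simp add: algebra_simps)
qed

lemma trunc_coeff_0: "trunc_coeff n m s 0 = int (n choose m)"
  by (simp add: trunc_coeff_def)

lemma trunc_coeff_rec:
  assumes "k < s"
  shows "int (k + 1 + m) * trunc_coeff n m s (k + 1) =
     (int n - int s + int k) * trunc_coeff n m s k
     + (-1) ^ (k + 1) * int m * int (n choose m) * int ((s + 1) choose (k + 1))"
proof -
  define T where "T j i = (- 1) ^ (j - i) * int ((s - i) choose (j - i)) * int (n choose (m + i))" for j i
  define F where "F i = (- 1) ^ (k + 1 - i) * int (m + i) * int (n choose (m + i))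
    * int ((s + 1 - i) choose (k + 1 - i))" for i
  have A: "trunc_coeff n m s j = (\<Sum>i\<le>j. T j i)" for j
    by (simp add: trunc_coeff_def T_def)
  have "int (k + 1 + m) * trunc_coeff n m s (k + 1) - (int n - int s + int k) * trunc_coeff n m s k
    = (\<Sum>i\<le>k. int (k + 1 + m) * T (k + 1) i - (int n - int s + int k) * T k i)
      + int (k + 1 + m) * T (k + 1) (k + 1)"
    unfolding A by (simp add: sum_subtractf sum_distrib_left distrib_left)
  also have "(\<Sum>i\<le>k. int (k + 1 + m) * T (k + 1) i - (int n - int s + int k) * T k i) = (\<Sum>i\<le>k. F i - F (Suc i))"
  proof (rule sum.cong)
    fix i assume "i \<in> {..k}"
    then show "int (k + 1 + m) * T (k + 1) i - (int n - int s + int k) * T k i = F i - F (Suc i)"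
      using trunc_coeff_step_term[of i k s m n] assms by (simp add: T_def F_def)
  qed simp
  \<comment> \<open>The upper boundary term cancels the summand \<open>i = k + 1\<close>, which only
    the longer sum has; the lower one, \<open>F 0\<close>, is the inhomogeneous term of the
    recurrence.\<close>
  also have "\<dots> = F 0 - F (Suc k)" by (rule sum_telescope)
  also have "F (Suc k) = int (k + 1 + m) * T (k + 1) (k + 1)"
    by (simp add: F_def T_def algebra_simps)
  finally show ?thesis by (simp add: F_def)
qed

text \<open>Only the inhomogeneous term of the recurrence can be negative, and only for odd
  \<open>k\<close>. The hypothesis on \<open>n\<close> enters as
  \<open>n - s \<ge> m * (s + 1)\<close>, which makes the coefficient of the preceding value large
  enough to compensate.\<close>

lemma trunc_coeff_nonneg:
  assumes "1 \<le> m" "m + s * (m + 1) \<le> n" "k \<le> s"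
  shows "0 \<le> trunc_coeff n m s k"
  using assms(3)
proof (induction k rule: less_induct)
  case (less k)
  show ?case
  proof (cases "k = 0")
    case False
    then obtain l where k: "k = l + 1" by (metis Suc_eq_plus1 not0_implies_Suc)
    have "l < s" using less.prems k by simp
    have ns: "int m + int s * int m \<le> int n - int s"
      using assms(2) by (simp add: algebra_simps flip: of_nat_add of_nat_mult)
    have ns0: "0 \<le> int n - int s + int j" for j
      using ns by (smt (verit) of_nat_0_le_iff mult_nonneg_nonneg)
    define e where "e = int m * int (n choose m)"
    have rec: "int (k + m) * trunc_coeff n m s k = (int n - int s + int l) * trunc_coeff n m s l
        + (- 1) ^ k * e * int ((s + 1) choose k)"
      using trunc_coeff_rec[OF \<open>l < s\<close>, of m n] by (simp add: k e_def mult.assoc)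
    have "0 \<le> int (k + m) * trunc_coeff n m s k"
    proof (cases "even k")
      case True
      then show ?thesis unfolding rec using less.IH[of l] k \<open>l < s\<close> ns0 by (simp add: e_def)
    next
      case odd: False
      \<comment> \<open>For odd \<open>k\<close> the negative term is absorbed by the positive one contributed in the step
        from \<open>k - 2\<close> to \<open>k - 1\<close>.\<close>
      have lower: "e * int ((s + 1) choose l) \<le> int (l + m) * trunc_coeff n m s l"
      proof (cases "l = 0")
        case True
        then show ?thesis by (simp add: e_def trunc_coeff_0)
      next
        case False
        then obtain j where l: "l = j + 1" by (metis Suc_eq_plus1 not0_implies_Suc)
        have "int (l + m) * trunc_coeff n m s l = (int n - int s + int j) * trunc_coeff n m s j
            + e * int ((s + 1) choose l)"
          using trunc_coeff_rec[of j s m n] \<open>l < s\<close> odd l k by (simp add: e_def)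
        moreover have "0 \<le> (int n - int s + int j) * trunc_coeff n m s j"
          using less.IH[of j] k l \<open>l < s\<close> ns0[of j]
          by (intro mult_nonneg_nonneg) auto
        ultimately show ?thesis by simp
      qed
      have absorb: "int k * int ((s + 1) choose k) = (int s + 1 - int l) * int ((s + 1) choose l)"
        using choose_Suc_times[of l "s + 1"] by (simp add: k algebra_simps del: binomial_Suc_Suc)
      \<comment> \<open>Compares the growth of the two terms. The middle estimate is
        \<open>l + m \<le> m * (l + 1)\<close>, which rests on \<open>1 \<le> m\<close>; the last
        one is the bound on \<open>n\<close>.\<close>
      have coef: "int (l + m) * (int s + 1 - int l) \<le> (int n - int s + int l) * int k"
      proof -
        have "int (l + m) * (int s + 1 - int l) \<le> int (l + m) * (int s + 1)"
          by (intro mult_left_mono) auto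
        also have "\<dots> \<le> (int m * int k) * (int s + 1)"
        proof (intro mult_right_mono)
          have "0 \<le> (int m - 1) * int l" using assms(1) by simp
          then show "int (l + m) \<le> int m * int k" by (simp add: k algebra_simps)
        qed simp
        also have "\<dots> = (int m + int s * int m) * int k" by (simp add: algebra_simps)
        also have "\<dots> \<le> (int n - int s + int l) * int k"
          using ns by (intro mult_right_mono) auto
        finally show ?thesis .
      qed
      define Z where "Z = int ((s + 1) choose l)"
      \<comment> \<open>The target is scaled by \<open>k\<close>, so that \<open>absorb\<close>
        replaces \<open>(s + 1) choose k\<close> by \<open>(s + 1) choose l\<close>, and by
        \<open>l + m\<close>, so that \<open>lower\<close> applies.\<close>
      have "int k * int (l + m) * (e * int ((s + 1) choose k))
          = int (l + m) * e * (int k * int ((s + 1) choose k))"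
        by (simp only: mult_ac)
      also have "\<dots> = int (l + m) * (int s + 1 - int l) * (e * Z)"
        unfolding absorb Z_def by (simp only: mult_ac)
      also have "\<dots> \<le> (int n - int s + int l) * int k * (e * Z)"
        using coef by (intro mult_right_mono) (auto simp: e_def Z_def)
      also have "\<dots> \<le> (int n - int s + int l) * int k * (int (l + m) * trunc_coeff n m s l)"
        using lower ns0 unfolding Z_def by (intro mult_left_mono) auto
      finally have "int k * int (l + m) * (e * int ((s + 1) choose k))
          \<le> int k * int (l + m) * ((int n - int s + int l) * trunc_coeff n m s l)"
        by (simp add: mult_ac)
      moreover have "0 < int k * int (l + m)" using k assms(1) by simp
      ultimately have "e * int ((s + 1) choose k) \<le> (int n - int s + int l) * trunc_coeff n m s l"
        using mult_le_cancel_left_pos by blast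
      then show ?thesis unfolding rec using odd by simp
    qed
    moreover have "0 < int (k + m)" using assms(1) by simp
    ultimately show ?thesis by (simp add: zero_le_mult_iff)
  qed (simp add: trunc_coeff_0)
qed

text \<open>The triangular matrices \<open>(-1)^(k-i) * ((s-i) choose (k-i))\<close> and
  \<open>(s-k) choose (q-k)\<close> are inverse to each other, because they describe the mutually
  inverse substitutions \<open>y = t / (1 - t)\<close> and \<open>t = y / (1 + y)\<close>.\<close>

lemma trunc_coeff_inversion:
  assumes "q \<le> s"
  shows "int (n choose (m + q)) = (\<Sum>k\<le>q. trunc_coeff n m s k * int ((s - k) choose (q - k)))"
proof -
  have alt: "(\<Sum>k\<in>{i..q}. (- 1) ^ (k - i) * int ((s - i) choose (k - i)) * int ((s - k) choose (q - k)))
      = (if i = q then 1 else 0)" if "i \<le> q" for i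
  proof -
    have "(\<Sum>k\<in>{i..q}. (- 1) ^ (k - i) * int ((s - i) choose (k - i)) * int ((s - k) choose (q - k)))
       = (\<Sum>k\<in>{i..q}. int ((s - i) choose (q - i)) * ((- 1) ^ (k - i) * int ((q - i) choose (k - i))))"
    proof (rule sum.cong)
      fix k assume k: "k \<in> {i..q}"
      then have "k - i \<le> q - i" "q - i \<le> s - i" "s - i - (k - i) = s - k" "q - i - (k - i) = q - k"
        using assms by auto
      then have "((s - i) choose (q - i)) * ((q - i) choose (k - i))
          = ((s - i) choose (k - i)) * ((s - k) choose (q - k))"
        using choose_mult[of "k - i" "q - i" "s - i"] by simp
      then show "(- 1) ^ (k - i) * int ((s - i) choose (k - i)) * int ((s - k) choose (q - k))
          = int ((s - i) choose (q - i)) * ((- 1) ^ (k - i) * int ((q - i) choose (k - i)))"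
        by (metis (mono_tags, lifting) mult.assoc mult.left_commute of_nat_mult)
    qed simp
    also have "\<dots> = int ((s - i) choose (q - i)) * (\<Sum>k\<le>q - i. (- 1) ^ k * int ((q - i) choose k))"
      unfolding sum_distrib_left[symmetric]
      by (rule arg_cong[where f = "(*) _"], rule sum.reindex_bij_witness[of _ "\<lambda>k. k + i" "\<lambda>k. k - i"])
        (use that in auto)
    also have "\<dots> = (if i = q then 1 else 0)"
      using that choose_alternating_sum[of "q - i", where ?'a = int] by auto
    finally show ?thesis .
  qed
  have "(\<Sum>k\<le>q. trunc_coeff n m s k * int ((s - k) choose (q - k)))
    = (\<Sum>k\<le>q. \<Sum>i\<le>k. (- 1) ^ (k - i) * int ((s - i) choose (k - i)) * int ((s - k) choose (q - k)) * int (n choose (m + i)))"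
    unfolding trunc_coeff_def sum_distrib_right by (intro sum.cong refl) (simp add: mult_ac)
  also have "\<dots> = (\<Sum>i\<le>q. \<Sum>k\<in>{i..q}. (- 1) ^ (k - i) * int ((s - i) choose (k - i)) * int ((s - k) choose (q - k)) * int (n choose (m + i)))"
    unfolding sum.Sigma[OF finite_atMost ballI[OF finite_atMost]]
      sum.Sigma[OF finite_atMost ballI[OF finite_atLeastAtMost]]
    by (rule sum.reindex_bij_witness[of _ prod.swap prod.swap]) auto
  also have "\<dots> = (\<Sum>i\<le>q. (if i = q then 1 else 0) * int (n choose (m + i)))"
    by (intro sum.cong refl) (simp only: alt[symmetric] atMost_iff sum_distrib_right)
  also have "\<dots> = int (n choose (m + q))" by (simp add: if_distrib[where f = "\<lambda>z. z * _"] cong: if_cong)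
  finally show ?thesis by simp
qed

text \<open>Being natural numbers, the \<open>A k\<close> can serve as multiplicities:
  \<open>A k\<close> copies of a polynomial ring in \<open>m + s\<close> variables, generated in
  degree \<open>m + k\<close>.\<close>

lemma binomial_decomposition:
  assumes "1 \<le> m" "m + s * (m + 1) \<le> n"
  obtains A :: "nat \<Rightarrow> nat"
    where "\<And>q. q \<le> s \<Longrightarrow> n choose (m + q) = (\<Sum>k\<le>q. A k * ((s - k) choose (q - k)))"
proof
  fix q assume q: "q \<le> s"
  have "int (n choose (m + q)) = int (\<Sum>k\<le>q. nat (trunc_coeff n m s k) * ((s - k) choose (q - k)))"
    unfolding trunc_coeff_inversion[OF q] of_nat_sum
    by (intro sum.cong refl) (use q trunc_coeff_nonneg[OF assms] in auto)
  then show "n choose (m + q) = (\<Sum>k\<le>q. nat (trunc_coeff n m s k) * ((s - k) choose (q - k)))"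
    by (simp only: of_nat_eq_iff)
qed

section \<open>A limit argument and homogeneous linear systems\<close>

text \<open>Dividing by \<open>D ^ r\<close> and letting \<open>D\<close> tend to infinity removes
  the shift by \<open>n\<close>, which stems from the exponents that the generic forms add.\<close>

lemma mult_power_bound:
  fixes r n a b :: nat
  assumes "\<And>D. a * D ^ r \<le> b * (D + n) ^ r"
  shows "a \<le> b"
proof -
  have lim: "(\<lambda>D. real b * (1 + real n / real (Suc D)) ^ r) \<longlonglongrightarrow> real b * (1 + 0) ^ r"
    by (intro tendsto_intros LIMSEQ_Suc[OF lim_const_over_n])
  have "real a \<le> real b * (1 + real n / real (Suc D)) ^ r" for D
  proof -
    have "real a * real (Suc D) ^ r \<le> real b * (real (Suc D) + real n) ^ r"
      using assms[of "Suc D"] unfolding of_nat_add[symmetric] of_nat_power[symmetric] of_nat_mult[symmetric]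
      by (simp only: of_nat_le_iff)
    then have "real a \<le> real b * (real (Suc D) + real n) ^ r / real (Suc D) ^ r"
      by (subst pos_le_divide_eq) auto
    also have "\<dots> = real b * ((real (Suc D) + real n) / real (Suc D)) ^ r"
      by (simp add: power_divide)
    also have "(real (Suc D) + real n) / real (Suc D) = 1 + real n / real (Suc D)"
      by (simp add: add_divide_distrib)
    finally show ?thesis .
  qed
  then have "real a \<le> real b * (1 + 0) ^ r"
    by (intro tendsto_le[OF _ lim tendsto_const]) auto
  then show ?thesis by simp
qed

text \<open>Gaussian elimination: a pivot \<open>p\<close> in equation \<open>j\<close> is
  eliminated from the remaining equations, which leaves one equation and one unknown fewer;
  \<open>y\<close> is the value of the pivot unknown recovered by back substitution.\<close>

lemma underdetermined_system:
  fixes a :: "'j \<Rightarrow> 'i \<Rightarrow> 'k::field"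
  assumes "finite I" "finite J" "card J < card I"
  shows "\<exists>c. (\<exists>i\<in>I. c i \<noteq> 0) \<and> (\<forall>i. i \<notin> I \<longrightarrow> c i = 0) \<and> (\<forall>j\<in>J. (\<Sum>i\<in>I. a j i * c i) = 0)"
  using assms(2,1,3)
proof (induction J arbitrary: I a rule: finite_induct)
  case empty
  then obtain i where "i \<in> I" by fastforce
  then show ?case by (intro exI[of _ "\<lambda>x. if x = i then 1 else 0"]) auto
next
  case (insert j J)
  show ?case
  proof (cases "\<exists>p\<in>I. a j p \<noteq> 0")
    case False
    then show ?thesis using insert.IH[of I a] insert by auto
  next
    case True
    then obtain p where p: "p \<in> I" "a j p \<noteq> 0" by auto
    let ?I = "I - {p}"
    define b where "b l i = a l i - a l p * a j i / a j p" for l i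
    have "card J < card ?I" using insert p by simp
    then obtain c where c: "\<exists>i\<in>?I. c i \<noteq> 0" "\<forall>i. i \<notin> ?I \<longrightarrow> c i = 0"
        "\<forall>l\<in>J. (\<Sum>i\<in>?I. b l i * c i) = 0"
      using insert.IH[of ?I b] insert.prems by auto
    define y where "y = - (\<Sum>i\<in>?I. a j i * c i) / a j p"
    have split: "(\<Sum>i\<in>I. a l i * (c(p := y)) i) = a l p * y + (\<Sum>i\<in>?I. a l i * c i)" for l
      using p insert.prems by (subst sum.remove[of _ p]) (auto intro!: sum.cong)
    have "(\<Sum>i\<in>I. a l i * (c(p := y)) i) = 0" if "l \<in> insert j J" for l
    proof (cases "l = j")
      case True
      then show ?thesis using p unfolding split by (simp add: y_def)
    next
      case False
      then have "0 = (\<Sum>i\<in>?I. b l i * c i)" using that c by auto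
      also have "\<dots> = (\<Sum>i\<in>?I. a l i * c i) - (\<Sum>i\<in>?I. a l p * (a j i * c i) / a j p)"
        by (simp add: b_def left_diff_distrib sum_subtractf mult.assoc)
      also have "(\<Sum>i\<in>?I. a l p * (a j i * c i) / a j p) = - (a l p * y)"
        by (simp add: y_def sum_distrib_left sum_divide_distrib)
      finally show ?thesis unfolding split by (simp add: add.commute)
    qed
    then show ?thesis using c p by (intro exI[of _ "c(p := y)"]) auto
  qed
qed

section \<open>Generic linear forms\<close>

lemma sum_fun_apply: "(\<Sum>i\<in>A. f i) x = (\<Sum>i\<in>A. f i x)"
  by (induction A rule: infinite_finite_induct) auto

text \<open>If \<open>Q\<close> stands for the quotient by \<open>Q\<close>, then
  \<open>adjoin M f Q\<close>, which is \<open>Q + f M\<close>, stands for the further quotient by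
  the image of \<open>f\<close>.\<close>

definition adjoin :: "'a::plus set \<Rightarrow> ('a \<Rightarrow> 'a) \<Rightarrow> 'a set \<Rightarrow> 'a set" where
  "adjoin M f Q = {q + f w | q w. q \<in> Q \<and> w \<in> M}"

lemma adjoinI: "q \<in> Q \<Longrightarrow> w \<in> M \<Longrightarrow> q + f w \<in> adjoin M f Q"
  by (auto simp: adjoin_def)

lemma adjoin_commute:
  fixes f g :: "'a::ab_semigroup_add \<Rightarrow> 'a"
  shows "adjoin M f (adjoin M g Q) = adjoin M g (adjoin M f Q)"
proof -
  have sub: "adjoin M f (adjoin M g Q) \<subseteq> adjoin M g (adjoin M f Q)" for f g :: "'a \<Rightarrow> 'a"
  proof
    fix z assume "z \<in> adjoin M f (adjoin M g Q)"
    then obtain q v w where z: "z = (q + g v) + f w" "q \<in> Q" "v \<in> M" "w \<in> M"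
      by (auto simp: adjoin_def)
    have "q + f w \<in> adjoin M f Q" using z by (auto simp: adjoin_def)
    then have "(q + f w) + g v \<in> adjoin M g (adjoin M f Q)" using z(3) unfolding adjoin_def by blast
    then show "z \<in> adjoin M g (adjoin M f Q)" by (simp add: z(1) add_ac)
  qed
  then show ?thesis by blast
qed

text \<open>"Weakly", since the last quotient may vanish. The list holds maps rather than ring
  elements, so that multiplications by ring elements and by generic forms can be treated alike and
  exchanged.\<close>

primrec weakly_regular :: "'a::plus set \<Rightarrow> ('a \<Rightarrow> 'a) list \<Rightarrow> 'a set \<Rightarrow> bool" where
  "weakly_regular M [] Q \<longleftrightarrow> True"
| "weakly_regular M (f # fs) Q \<longleftrightarrow> (\<forall>w\<in>M. f w \<in> Q \<longrightarrow> w \<in> Q) \<and> weakly_regular M fs (adjoin M f Q)"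

lemma weakly_regular_append:
  "weakly_regular M (fs @ gs) Q \<longleftrightarrow> weakly_regular M fs Q \<and> weakly_regular M gs (fold (adjoin M) fs Q)"
  by (induction fs arbitrary: Q) auto

text \<open>A function \<open>w\<close> on exponents \<open>e :: nat \<Rightarrow> nat\<close> encodes \<open>\<Sum>\<^sub>e w(e) u\<^sup>e\<close>, a polynomial in
  auxiliary indeterminates \<open>u\<^sub>0, u\<^sub>1, \<dots>\<close> with coefficients in a module. Infinite support is allowed,
  as long as the exponents of all indeterminates have a common bound.\<close>

definition bounded_degree :: "((nat \<Rightarrow> nat) \<Rightarrow> 'a::zero) set" where
  "bounded_degree = {w. \<exists>d. \<forall>e k. d \<le> e k \<longrightarrow> w e = 0}"

definition coeffs_in :: "'a::zero set \<Rightarrow> ((nat \<Rightarrow> nat) \<Rightarrow> 'a) set" where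
  "coeffs_in U = {w \<in> bounded_degree. \<forall>e. w e \<in> U}"

text \<open>Extracts the coefficient of \<open>u\<^sub>k\<^sup>i\<close> and multiplies it by \<open>u\<^sub>k\<^sup>j\<close>.\<close>

definition move :: "nat \<Rightarrow> nat \<Rightarrow> nat \<Rightarrow> ((nat \<Rightarrow> nat) \<Rightarrow> 'a::zero) \<Rightarrow> (nat \<Rightarrow> nat) \<Rightarrow> 'a" where
  "move k i j w = (\<lambda>e. if e k = j then w (e(k := i)) else 0)"

lemma bounded_degree_0: "0 \<in> bounded_degree"
  by (auto simp: bounded_degree_def)

lemma bounded_degree_add:
  fixes v w :: "(nat \<Rightarrow> nat) \<Rightarrow> 'a::monoid_add"
  assumes "v \<in> bounded_degree" "w \<in> bounded_degree"
  shows "v + w \<in> bounded_degree"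
proof -
  obtain c where "\<And>e k. c \<le> e k \<Longrightarrow> v e = 0" using assms(1) by (auto simp: bounded_degree_def)
  moreover obtain d where "\<And>e k. d \<le> e k \<Longrightarrow> w e = 0" using assms(2) by (auto simp: bounded_degree_def)
  ultimately have "\<forall>e k. max c d \<le> e k \<longrightarrow> (v + w) e = 0"
    by (metis add.right_neutral max.boundedE plus_fun_apply)
  then show ?thesis unfolding bounded_degree_def by blast
qed

lemma bounded_degree_sum:
  fixes w :: "'i \<Rightarrow> (nat \<Rightarrow> nat) \<Rightarrow> 'a::comm_monoid_add"
  assumes "\<And>i. i \<in> A \<Longrightarrow> w i \<in> bounded_degree"
  shows "(\<Sum>i\<in>A. w i) \<in> bounded_degree"
  using assms by (induction A rule: infinite_finite_induct) (auto intro: bounded_degree_add bounded_degree_0)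

lemma bounded_degree_move:
  assumes "w \<in> bounded_degree"
  shows "move k i j w \<in> bounded_degree"
proof -
  obtain d where d: "\<And>e l. d \<le> e l \<Longrightarrow> w e = 0" using assms by (auto simp: bounded_degree_def)
  have "move k i j w e = 0" if "max d (Suc j) \<le> e l" for e l
    using d[of "e(k := i)" l] that by (cases "l = k") (auto simp: move_def)
  then show ?thesis unfolding bounded_degree_def by blast
qed

locale generic_forms = Modules.module scale
  for scale :: "'s::comm_ring_1 \<Rightarrow> 'a::ab_group_add \<Rightarrow> 'a" (infixr "*s" 75) +
  fixes x :: "nat \<Rightarrow> 's" and n :: nat
begin

definition smul :: "'s \<Rightarrow> ((nat \<Rightarrow> nat) \<Rightarrow> 'a) \<Rightarrow> (nat \<Rightarrow> nat) \<Rightarrow> 'a" where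
  "smul f w = (\<lambda>e. f *s w e)"

text \<open>Multiplication by the linear form \<open>\<Sum>\<^sub>i u\<^sub>k\<^sup>i x\<^sub>i\<close>.\<close>

definition gen :: "nat \<Rightarrow> ((nat \<Rightarrow> nat) \<Rightarrow> 'a) \<Rightarrow> (nat \<Rightarrow> nat) \<Rightarrow> 'a" where
  "gen k w = (\<lambda>e. \<Sum>i<n. if i \<le> e k then x i *s w (e(k := e k - i)) else 0)"

text \<open>Closure under \<^const>\<open>move\<close> expresses that \<open>Q\<close> is extended from a module not involving \<open>u\<^sub>l\<close>
  for \<open>l \<ge> k\<close>.\<close>

definition submod :: "nat \<Rightarrow> ((nat \<Rightarrow> nat) \<Rightarrow> 'a) set \<Rightarrow> bool" where
  "submod k Q \<longleftrightarrow> Q \<subseteq> bounded_degree \<and> 0 \<in> Q \<and> (\<forall>v\<in>Q. \<forall>w\<in>Q. v + w \<in> Q) \<and>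
     (\<forall>f. \<forall>w\<in>Q. smul f w \<in> Q) \<and> (\<forall>l\<ge>k. \<forall>i j. \<forall>w\<in>Q. move l i j w \<in> Q)"

lemma submodD:
  assumes "submod k Q"
  shows "w \<in> Q \<Longrightarrow> w \<in> bounded_degree" "0 \<in> Q" "v \<in> Q \<Longrightarrow> w \<in> Q \<Longrightarrow> v + w \<in> Q"
    "w \<in> Q \<Longrightarrow> smul f w \<in> Q" "k \<le> l \<Longrightarrow> w \<in> Q \<Longrightarrow> move l i j w \<in> Q"
  using assms by (auto simp: submod_def)

lemma submod_diff: "submod k Q \<Longrightarrow> v \<in> Q \<Longrightarrow> w \<in> Q \<Longrightarrow> v - w \<in> Q"
  using submodD(3)[of k Q v "smul (-1) w"] submodD(4)[of k Q w "-1"]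
  by (simp add: smul_def fun_diff_def plus_fun_def)

lemma submod_sum:
  "submod k Q \<Longrightarrow> (\<And>i. i \<in> A \<Longrightarrow> w i \<in> Q) \<Longrightarrow> (\<Sum>i\<in>A. w i) \<in> Q"
  by (induction A rule: infinite_finite_induct) (auto intro: submodD)

lemma smul_add: "smul f (v + w) = smul f v + smul f w"
  by (auto simp: smul_def scale_right_distrib)

lemma smul_0: "smul f 0 = 0"
  by (intro ext) (simp add: smul_def)

lemma smul_smul: "smul f (smul g w) = smul g (smul f w)"
  by (auto simp: smul_def mult.commute)

lemma bounded_degree_smul: "w \<in> bounded_degree \<Longrightarrow> smul f w \<in> bounded_degree"
  by (fastforce simp: bounded_degree_def smul_def)

lemma gen_add: "gen k (v + w) = gen k v + gen k w"
  by (intro ext) (auto simp: gen_def scale_right_distrib sum.distrib[symmetric] intro!: sum.cong)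

lemma gen_diff: "gen k (v - w) = gen k v - gen k w"
  by (intro ext) (auto simp: gen_def scale_right_diff_distrib sum_subtractf[symmetric] intro!: sum.cong)

lemma gen_0: "gen k 0 = 0"
  by (intro ext) (auto simp: gen_def intro!: sum.neutral)

lemma gen_sum: "gen k (\<Sum>i\<in>A. w i) = (\<Sum>i\<in>A. gen k (w i))"
  by (induction A rule: infinite_finite_induct) (simp_all only: sum.infinite sum.empty sum.insert gen_0 gen_add not_False_eq_True)

lemma gen_smul: "gen k (smul f w) = smul f (gen k w)"
  by (intro ext) (auto simp: gen_def smul_def scale_sum_right mult.commute intro!: sum.cong)

lemma bounded_degree_gen:
  assumes "w \<in> bounded_degree"
  shows "gen k w \<in> bounded_degree"
proof -
  obtain d where d: "\<And>e l. d \<le> e l \<Longrightarrow> w e = 0" using assms by (auto simp: bounded_degree_def)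
  have "gen k w e = 0" if "d + n \<le> e l" for e l
    unfolding gen_def
  proof (intro sum.neutral ballI)
    fix i assume "i \<in> {..<n}"
    then have "w (e(k := e k - i)) = 0" using d[of "e(k := e k - i)" l] that by (cases "l = k") auto
    then show "(if i \<le> e k then x i *s w (e(k := e k - i)) else 0) = 0" by simp
  qed
  then show ?thesis unfolding bounded_degree_def by blast
qed

lemma move_gen: "l \<noteq> k \<Longrightarrow> move l i j (gen k w) = gen k (move l i j w)"
  by (intro ext) (auto simp: gen_def move_def fun_upd_twist intro!: sum.cong sum.neutral)

lemma move_add: "move l i j (v + w) = move l i j v + move l i j w" for v w :: "(nat \<Rightarrow> nat) \<Rightarrow> 'a"
  by (auto simp: move_def)

lemma move_smul: "move l i j (smul f w) = smul f (move l i j w)"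
  by (auto simp: move_def smul_def)

lemma submod_adjoin_smul:
  assumes "submod k Q"
  shows "submod k (adjoin bounded_degree (smul f) Q)"
proof -
  note Q = submodD[OF assms]
  let ?A = "adjoin bounded_degree (smul f) Q"
  have I: "q + smul f w \<in> ?A" if "q \<in> Q" "w \<in> bounded_degree" for q w
    using that by (auto simp: adjoin_def)
  have "0 \<in> ?A" using I[OF Q(2) bounded_degree_0] by (simp add: smul_0)
  moreover have "(q + smul f v) + (q' + smul f v') \<in> ?A"
    if "q \<in> Q" "q' \<in> Q" "v \<in> bounded_degree" "v' \<in> bounded_degree" for q q' v v'
    using I[OF Q(3)[OF that(1,2)] bounded_degree_add[OF that(3,4)]] by (simp add: smul_add add_ac)
  moreover have "smul g (q + smul f v) \<in> ?A" if "q \<in> Q" "v \<in> bounded_degree" for g q v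
    using I[OF Q(4)[OF that(1)] bounded_degree_smul[OF that(2)], of g g] by (simp add: smul_add smul_smul[of g])
  moreover have "move l i j (q + smul f v) \<in> ?A" if "q \<in> Q" "v \<in> bounded_degree" "k \<le> l" for l i j q v
    using I[OF Q(5)[OF that(3,1)] bounded_degree_move[OF that(2)]] by (simp add: move_add move_smul)
  ultimately show ?thesis unfolding submod_def
    by (auto simp: adjoin_def intro: bounded_degree_add bounded_degree_smul Q(1))
qed

text \<open>\<open>gen k\<close> involves the indeterminate of index \<open>k\<close>, so closure
  under \<open>move k\<close> may be lost, while \<open>move l\<close> for \<open>l > k\<close>
  commutes with \<open>gen k\<close>. Hence the index grows by one and every new form receives a
  fresh indeterminate.\<close>

lemma submod_adjoin_gen:
  assumes "submod k Q"
  shows "submod (Suc k) (adjoin bounded_degree (gen k) Q)"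
proof -
  note Q = submodD[OF assms]
  let ?A = "adjoin bounded_degree (gen k) Q"
  have I: "q + gen k w \<in> ?A" if "q \<in> Q" "w \<in> bounded_degree" for q w
    using that by (auto simp: adjoin_def)
  have "0 \<in> ?A" using I[OF Q(2) bounded_degree_0] by (simp add: gen_0)
  moreover have "(q + gen k v) + (q' + gen k v') \<in> ?A"
    if "q \<in> Q" "q' \<in> Q" "v \<in> bounded_degree" "v' \<in> bounded_degree" for q q' v v'
    using I[OF Q(3)[OF that(1,2)] bounded_degree_add[OF that(3,4)]] by (simp add: gen_add add_ac)
  moreover have "smul g (q + gen k v) \<in> ?A" if "q \<in> Q" "v \<in> bounded_degree" for g q v
    using I[OF Q(4)[OF that(1)] bounded_degree_smul[OF that(2)], of g g] by (simp add: smul_add gen_smul)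
  moreover have "move l i j (q + gen k v) \<in> ?A" if "q \<in> Q" "v \<in> bounded_degree" "Suc k \<le> l" for l i j q v
    using I[OF Q(5)[of l q i j] bounded_degree_move[OF that(2), of l i j]] that by (simp add: move_add move_gen)
  ultimately show ?thesis unfolding submod_def
    by (auto simp: adjoin_def intro: bounded_degree_add bounded_degree_gen Q(1))
qed

section \<open>McCoy's argument and the exchange of regular elements\<close>

text \<open>In degree \<open>d + i\<close>, the summands of \<open>gen k w\<close> with
  \<open>q < i\<close> would require coefficients of \<open>w\<close> beyond its top degree
  \<open>d\<close>. So \<open>x i\<close> meets the leading coefficient, and the other contributions
  have \<open>q > i\<close>, the indices that McCoy's descending induction has already
  treated.\<close>

lemma move_gen_self:
  assumes "\<And>e. d < e k \<Longrightarrow> w e = 0" "i < n"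
  shows "move k (d + i) d (gen k w) =
    smul (x i) (move k d d w) + (\<Sum>q\<in>{i<..<n}. if q \<le> d + i then smul (x q) (move k (d + i - q) d w) else 0)"
proof
  fix e
  show "move k (d + i) d (gen k w) e = (smul (x i) (move k d d w) +
    (\<Sum>q\<in>{i<..<n}. if q \<le> d + i then smul (x q) (move k (d + i - q) d w) else 0)) e"
  proof (cases "e k = d")
    case True
    define t where "t q = (if q \<le> d + i then x q *s w (e(k := d + i - q)) else 0)" for q
    have "move k (d + i) d (gen k w) e = (\<Sum>q<n. t q)"
      using True by (auto simp: move_def gen_def t_def intro!: sum.cong)
    also have "\<dots> = (\<Sum>q\<in>insert i {i<..<n}. t q)"
      by (rule sum.mono_neutral_right) (use assms in \<open>auto simp: t_def\<close>)
    also have "\<dots> = t i + (\<Sum>q\<in>{i<..<n}. t q)" by simp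
    also have "t i = smul (x i) (move k d d w) e"
      using True by (simp add: t_def smul_def move_def)
    also have "(\<Sum>q\<in>{i<..<n}. t q) =
        (\<Sum>q\<in>{i<..<n}. if q \<le> d + i then smul (x q) (move k (d + i - q) d w) else 0) e"
      unfolding sum_fun_apply by (intro sum.cong) (auto simp: t_def smul_def move_def True)
    finally show ?thesis by simp
  next
    case False
    then show ?thesis by (auto simp: move_def smul_def sum_fun_apply intro!: sum.neutral)
  qed
qed

lemma gen_slice: "gen k (move k d d w) = (\<Sum>q<n. move k d (d + q) (smul (x q) w))"
proof
  fix e
  show "gen k (move k d d w) e = (\<Sum>q<n. move k d (d + q) (smul (x q) w)) e"
    unfolding gen_def sum_fun_apply by (intro sum.cong) (auto simp: move_def smul_def)
qed

text \<open>Multiplication by an indeterminate is available only through \<open>move\<close>, one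
  power at a time. As \<open>w\<close> has bounded degree, it is a finite sum of slices, and on each
  slice \<open>gen k\<close> is a sum of such moves.\<close>

lemma gen_in_submod:
  assumes "submod k Q" "w \<in> Q"
  shows "gen k w \<in> Q"
proof -
  obtain d where d: "\<And>e l. d \<le> e l \<Longrightarrow> w e = 0"
    using submodD(1)[OF assms] by (auto simp: bounded_degree_def)
  have "w = (\<Sum>p<d. move k p p w)"
  proof
    fix e
    have "(\<Sum>p<d. move k p p w) e = (\<Sum>p<d. if p = e k then w e else 0)"
      unfolding sum_fun_apply by (intro sum.cong) (auto simp: move_def)
    then show "w e = (\<Sum>p<d. move k p p w) e" using d[of e k] by auto
  qed
  then have "gen k w = (\<Sum>p<d. \<Sum>i<n. move k p (p + i) (smul (x i) w))"
    by (metis (no_types, lifting) gen_slice gen_sum sum.cong)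
  then show ?thesis using assms
    by (auto intro!: submod_sum[OF assms(1)] submodD(4,5)[OF assms(1)])
qed

text \<open>McCoy's argument: if \<open>\<Sum>\<^sub>i u\<^sub>k\<^sup>i x\<^sub>i\<close> kills a class of \<open>u\<^sub>k\<close>-degree \<open>d\<close> modulo \<open>Q\<close>, then it also
  kills \<open>x\<^sub>i\<close> times that class with its leading coefficient removed, for \<open>i = n - 1, n - 2, \<dots>\<close>.\<close>

lemma gen_nonzerodivisor:
  assumes Q: "submod k Q"
    and socle: "\<And>w. w \<in> bounded_degree \<Longrightarrow> (\<And>i. i < n \<Longrightarrow> smul (x i) w \<in> Q) \<Longrightarrow> w \<in> Q"
    and w: "w \<in> bounded_degree" "gen k w \<in> Q"
  shows "w \<in> Q"
proof -
  have main: "w \<in> Q" if "w \<in> bounded_degree" "gen k w \<in> Q" "\<And>e. d \<le> e k \<Longrightarrow> w e = 0" for d w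
    using that
  proof (induction d arbitrary: w)
    case 0
    then have "w = 0" by (intro ext) auto
    then show ?case using submodD(2)[OF Q] by (simp only:)
  next
    case (Suc d)
    have "smul (x (n - Suc p)) w \<in> Q" if "p < n" for p
      using that
    proof (induction p rule: less_induct)
      case (less p)
      define i where "i = n - Suc p"
      have i: "i < n" using less.prems by (auto simp: i_def)
      have above: "smul (x q) w \<in> Q" if "q \<in> {i<..<n}" for q
        using less.IH[of "n - Suc q"] that less.prems by (auto simp: i_def)
      have top: "smul (x i) (move k d d w) \<in> Q"
      proof -
        have "smul (x i) (move k d d w) = move k (d + i) d (gen k w)
          - (\<Sum>q\<in>{i<..<n}. if q \<le> d + i then smul (x q) (move k (d + i - q) d w) else 0)"
          using move_gen_self[of d k w i] Suc.prems(3) i by simp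
        also have "\<dots> \<in> Q"
          using Suc.prems above
          by (intro submod_diff[OF Q] submodD(5)[OF Q] submod_sum[OF Q])
            (auto simp: move_smul[symmetric] intro: submodD(2,5)[OF Q])
        finally show ?thesis .
      qed
      define b where "b = smul (x i) w - smul (x i) (move k d d w)"
      have "b \<in> Q"
      proof (rule Suc.IH)
        have "b = smul (x i) w + smul (- x i) (move k d d w)"
          by (simp add: b_def smul_def fun_diff_def plus_fun_def)
        then show "b \<in> bounded_degree"
          using Suc.prems(1) by (simp add: bounded_degree_add bounded_degree_smul bounded_degree_move)
        have "gen k (smul (x i) (move k d d w)) = (\<Sum>q<n. move k d (d + q) (smul (x q) (smul (x i) (move k d d w))))"
          unfolding move_smul[symmetric] gen_slice
          by (intro sum.cong refl) (auto simp: move_def smul_def)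
        also have "\<dots> \<in> Q" by (intro submod_sum[OF Q] submodD(5)[OF Q _ submodD(4)[OF Q top]]) simp
        finally show "gen k b \<in> Q"
          using Suc.prems(2) unfolding b_def gen_diff gen_smul[of k "x i" w]
          by (intro submod_diff[OF Q] submodD(4)[OF Q])
        show "b e = 0" if "d \<le> e k" for e
          using that Suc.prems(3)[of e] by (cases "e k = d") (auto simp: b_def smul_def move_def)
      qed
      then have "b + smul (x i) (move k d d w) \<in> Q" using top by (rule submodD(3)[OF Q])
      then show ?case by (simp add: b_def i_def)
    qed
    then have "smul (x i) w \<in> Q" if "i < n" for i
      using that by (metis Suc_diff_Suc diff_Suc_less diff_diff_cancel less_imp_le_nat
          zero_less_iff_neq_zero not_less_zero Suc_leI)
    then show ?case using socle Suc.prems(1) by blast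
  qed
  obtain d where "\<And>e l. d \<le> e l \<Longrightarrow> w e = 0" using w(1) by (auto simp: bounded_degree_def)
  then show ?thesis using main w by blast
qed

text \<open>An element that every \<open>x i\<close> sends into \<open>Q\<close> is also sent there
  by any combination \<open>f\<close> of the \<open>x i\<close>. Thus a regular \<open>f\<close>,
  linear or not, supplies the socle hypothesis of \<open>gen_nonzerodivisor\<close>.\<close>

lemma nonzerodivisor_imp_socle:
  assumes Q: "submod k Q" and f: "f = (\<Sum>i<n. g i * x i)"
    and nzd: "\<And>w. w \<in> bounded_degree \<Longrightarrow> smul f w \<in> Q \<Longrightarrow> w \<in> Q"
    and w: "w \<in> bounded_degree" "\<And>i. i < n \<Longrightarrow> smul (x i) w \<in> Q"
  shows "w \<in> Q"
proof (rule nzd)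
  have "smul f w = (\<Sum>i<n. smul (g i) (smul (x i) w))"
    by (auto simp: f smul_def sum_fun_apply scale_sum_left)
  also have "\<dots> \<in> Q" using w(2) by (auto intro!: submod_sum[OF Q] intro: submodD(4)[OF Q])
  finally show "smul f w \<in> Q" .
qed (fact w(1))

text \<open>Since \<open>gen k\<close> is a nonzerodivisor modulo \<open>Q\<close> and modulo \<open>f\<close>, the two may be swapped.\<close>

lemma weakly_regular_gen_step:
  assumes "submod k Q" "f = (\<Sum>i<n. g i * x i)"
    and "\<And>w. w \<in> bounded_degree \<Longrightarrow> smul f w \<in> Q \<Longrightarrow> w \<in> Q"
    and "weakly_regular bounded_degree (map gen [k..<k + r]) (adjoin bounded_degree (smul f) Q)"
  shows "weakly_regular bounded_degree (map gen [k..<k + Suc r]) Q"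
  using assms
proof (induction r arbitrary: k Q)
  case 0
  have "w \<in> Q" if "w \<in> bounded_degree" "gen k w \<in> Q" for w
    using gen_nonzerodivisor[OF 0(1) nonzerodivisor_imp_socle[OF 0(1,2,3)]] that by blast
  then show ?case by simp
next
  case (Suc r)
  let ?G = "adjoin bounded_degree (gen k) Q"
  note Q = submodD[OF Suc.prems(1)]
  have split: "[k..<k + Suc j] = k # [Suc k..<Suc k + j]" for j by (simp add: upt_rec)
  have gen: "w \<in> Q" if "w \<in> bounded_degree" "gen k w \<in> Q" for w
    using gen_nonzerodivisor[OF Suc.prems(1) nonzerodivisor_imp_socle[OF Suc.prems(1,2,3)]] that by blast
  have genf: "w \<in> adjoin bounded_degree (smul f) Q"
    if "w \<in> bounded_degree" "gen k w \<in> adjoin bounded_degree (smul f) Q" for w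
    using Suc.prems(4) that unfolding split by simp
  have "weakly_regular bounded_degree (map gen [Suc k..<Suc k + Suc r]) ?G"
  proof (rule Suc.IH[OF submod_adjoin_gen[OF Suc.prems(1)] Suc.prems(2)])
    show "weakly_regular bounded_degree (map gen [Suc k..<Suc k + r]) (adjoin bounded_degree (smul f) ?G)"
      using Suc.prems(4) unfolding split list.map weakly_regular.simps adjoin_commute[of _ "gen k" "smul f"]
      by blast
    \<comment> \<open>The permutation argument for a regular pair: in
      \<open>f w = q + gen k b\<close>, the form \<open>gen k\<close> is cancelled modulo
      \<open>f\<close>, which gives \<open>b = q' + f c\<close>; then \<open>f\<close> is cancelled
      modulo \<open>Q\<close> in \<open>f (w - gen k c)\<close>.\<close>
    fix w assume w: "w \<in> bounded_degree" "smul f w \<in> ?G"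
    then obtain q b where qb: "smul f w = q + gen k b" "q \<in> Q" "b \<in> bounded_degree"
      by (auto simp: adjoin_def)
    have "gen k b = smul (-1) q + smul f w" unfolding qb(1) by (auto simp: smul_def)
    then have "gen k b \<in> adjoin bounded_degree (smul f) Q"
      using w(1) Q(4)[OF qb(2)] unfolding adjoin_def by blast
    then obtain q' c where c: "b = q' + smul f c" "q' \<in> Q" "c \<in> bounded_degree"
      using genf[OF qb(3)] by (auto simp: adjoin_def)
    have "smul f (w - gen k c) = q + gen k q'"
    proof -
      have "smul f (w - gen k c) = smul f w - smul f (gen k c)"
        by (auto simp: smul_def scale_right_diff_distrib)
      then show ?thesis unfolding qb(1) c(1) by (simp add: gen_add gen_smul)
    qed
    moreover have "gen k q' \<in> Q"
      using gen_in_submod[OF Suc.prems(1) c(2)] .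
    ultimately have "smul f (w - gen k c) \<in> Q" using Q(3)[OF qb(2)] by simp
    moreover have "w - gen k c \<in> bounded_degree"
      using bounded_degree_add[OF w(1) bounded_degree_smul[where f = "- 1", OF bounded_degree_gen[OF c(3), of k]]]
      by (simp add: smul_def fun_diff_def plus_fun_def)
    ultimately have "w - gen k c \<in> Q" using Suc.prems(3) by blast
    then have "(w - gen k c) + gen k c \<in> ?G" using c(3) unfolding adjoin_def by blast
    then show "w \<in> ?G" by simp
  qed
  then show ?case using gen unfolding split by simp
qed

text \<open>Induction from the front: modulo the first \<open>f\<close>, the remaining elements are
  already traded for forms, and the exchange step then trades \<open>f\<close> for one more.\<close>

theorem weakly_regular_gen:
  assumes "submod k Q" "\<And>f. f \<in> set fs \<Longrightarrow> \<exists>g. f = (\<Sum>i<n. g i * x i)"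
    and "weakly_regular bounded_degree (map smul fs) Q"
  shows "weakly_regular bounded_degree (map gen [k..<k + length fs]) Q"
  using assms
proof (induction fs arbitrary: Q)
  case (Cons f fs)
  obtain g where g: "f = (\<Sum>i<n. g i * x i)" using Cons.prems(2)[of f] by auto
  show ?case
    using weakly_regular_gen_step[OF Cons.prems(1) g] Cons.IH[OF submod_adjoin_smul[OF Cons.prems(1)]] Cons.prems
    by simp
qed simp

text \<open>\<open>P\<close> plays the role of the lowest nonzero graded component and \<open>U\<close> of the zero submodule:
  no nonzero element of that component lies in \<open>(x\<^sub>0, \<dots>, x\<^sub>n\<^sub>-\<^sub>1)\<close> times the module.\<close>

lemma weakly_regular_gen_independent:
  assumes Q: "submod 0 (coeffs_in U)"
    and reg: "weakly_regular bounded_degree (map gen [0..<r]) (coeffs_in U)"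
    and P: "\<And>p u y. p \<in> P \<Longrightarrow> u \<in> U \<Longrightarrow> p = u + (\<Sum>i<n. x i *s y i) \<Longrightarrow> p \<in> U"
    and a: "\<And>j. j < r \<Longrightarrow> a j \<in> bounded_degree" "\<And>j e. j < r \<Longrightarrow> a j e \<in> P"
    and zero: "(\<Sum>j<r. gen j (a j)) \<in> coeffs_in U"
    and "j < r"
  shows "a j \<in> coeffs_in U"
  using reg a zero \<open>j < r\<close>
proof (induction r)
  case (Suc r)
  define A where "A s = fold (adjoin bounded_degree) (map gen [0..<s]) (coeffs_in U)" for s
  have A_Suc: "A (Suc s) = adjoin bounded_degree (gen s) (A s)" for s
    by (simp add: A_def)
  have in_A: "q + (\<Sum>j<s. gen j (b j)) \<in> A s"
    if "q \<in> coeffs_in U" "\<And>j. j < s \<Longrightarrow> b j \<in> bounded_degree" for q b s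
    using that
  proof (induction s)
    case (Suc s)
    have "(q + (\<Sum>j<s. gen j (b j))) + gen s (b s) \<in> A (Suc s)"
      unfolding A_Suc using Suc by (intro adjoinI Suc.IH) auto
    then show ?case by (simp only: add.assoc sum.lessThan_Suc)
  qed (simp add: A_def)
  have A_coeffs: "\<exists>u\<in>U. \<exists>y. w e = u + (\<Sum>i<n. x i *s y i)" if "w \<in> A s" for w s e
    using that
  proof (induction s arbitrary: w)
    case 0
    then have "w e = w e + (\<Sum>i<n. x i *s 0)" "w e \<in> U" by (auto simp: A_def coeffs_in_def)
    then show ?case by (intro bexI[of _ "w e"] exI[of _ "\<lambda>_. 0"])
  next
    case (Suc s)
    then obtain q v where w: "w = q + gen s v" "q \<in> A s" unfolding A_Suc adjoin_def by auto
    obtain u y where u: "u \<in> U" "q e = u + (\<Sum>i<n. x i *s y i)" using Suc.IH[OF w(2)] by auto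
    have "w e = u + (\<Sum>i<n. x i *s (y i + (if i \<le> e s then v (e(s := e s - i)) else 0)))"
      unfolding w(1) plus_fun_apply u(2) add.assoc
      by (auto simp: gen_def scale_right_distrib sum.distrib[symmetric] intro!: sum.cong)
    then show ?case using u(1) by (intro bexI[of _ u] exI)
  qed
  have wr: "weakly_regular bounded_degree (map gen [0..<r]) (coeffs_in U)"
    and last: "\<And>w. w \<in> bounded_degree \<Longrightarrow> gen r w \<in> A r \<Longrightarrow> w \<in> A r"
    using Suc.prems(1) by (auto simp: weakly_regular_append A_def)
  \<comment> \<open>Solving the relation for its last term exhibits \<open>gen r (a r)\<close> as
    zero modulo the earlier forms, so regularity puts \<open>a r\<close> into \<open>A r\<close>.
    All coefficients there lie in \<open>U\<close> plus multiples of the \<open>x i\<close>, and the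
    hypothesis on \<open>P\<close> forces those of \<open>a r\<close> into \<open>U\<close>.\<close>
  have "gen r (a r) = (\<Sum>j<Suc r. gen j (a j)) + (\<Sum>j<r. gen j (- a j))"
    using gen_diff[of _ 0] by (simp add: gen_0 sum_negf)
  also have "\<dots> \<in> A r"
  proof (rule in_A[OF Suc.prems(4)])
    fix j assume "j < r"
    then show "- a j \<in> bounded_degree"
      using bounded_degree_smul[of "a j" "- 1"] Suc.prems(2)[of j] by (simp add: smul_def fun_Compl_def)
  qed
  finally have ar: "a r \<in> A r" using last Suc.prems(2) by simp
  have "a r e \<in> U" for e
  proof -
    obtain u y where "u \<in> U" "a r e = u + (\<Sum>i<n. x i *s y i)" using A_coeffs[OF ar] by blast
    then show ?thesis using P Suc.prems(3)[of r e] by blast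
  qed
  then have r: "a r \<in> coeffs_in U" using Suc.prems(2) by (simp add: coeffs_in_def)
  have "(\<Sum>j<r. gen j (a j)) = (\<Sum>j<Suc r. gen j (a j)) - gen r (a r)" by simp
  also have "\<dots> \<in> coeffs_in U"
    by (rule submod_diff[OF Q Suc.prems(4) gen_in_submod[OF _ r]])
      (use Q in \<open>auto simp: submod_def\<close>)
  finally show ?case using Suc.IH[OF wr Suc.prems(2,3)] r Suc.prems(5) by (cases "j = r") auto
qed simp

section \<open>Extension of scalars to the auxiliary indeterminates\<close>

lemma weakly_regular_coeffs_in:
  assumes "0 \<in> U" "weakly_regular UNIV (map scale fs) U"
  shows "weakly_regular bounded_degree (map smul fs) (coeffs_in U)"
  using assms
proof (induction fs arbitrary: U)
  case (Cons f fs)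
  have "adjoin bounded_degree (smul f) (coeffs_in U) = coeffs_in (adjoin UNIV (scale f) U)"
  proof (intro equalityI subsetI)
    fix w assume "w \<in> adjoin bounded_degree (smul f) (coeffs_in U)"
    then show "w \<in> coeffs_in (adjoin UNIV (scale f) U)"
      by (auto simp: adjoin_def coeffs_in_def smul_def[symmetric] bounded_degree_add bounded_degree_smul)
        (auto simp: smul_def)
  next
    fix w assume w: "w \<in> coeffs_in (adjoin UNIV (scale f) U)"
    then have "\<forall>e. \<exists>q v. w e = q + f *s v \<and> q \<in> U" by (auto simp: coeffs_in_def adjoin_def)
    then obtain q v where qv: "\<And>e. w e = q e + f *s v e" "\<And>e. q e \<in> U" by metis
    \<comment> \<open>The pointwise choices are reset to zero wherever \<open>w\<close> vanishes, so
      that they inherit its bound on exponents.\<close>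
    let ?q = "\<lambda>e. if w e = 0 then 0 else q e" and ?v = "\<lambda>e. if w e = 0 then 0 else v e"
    have "w = ?q + smul f ?v" by (intro ext) (use qv in \<open>auto simp: smul_def\<close>)
    moreover obtain d where "\<And>e k. d \<le> e k \<Longrightarrow> w e = 0"
      using w by (auto simp: coeffs_in_def bounded_degree_def)
    then have "?q \<in> bounded_degree" "?v \<in> bounded_degree"
      unfolding bounded_degree_def by (intro CollectI exI[of _ d]; auto)+
    moreover from this have "?q \<in> coeffs_in U"
      using qv(2) Cons.prems(1) unfolding coeffs_in_def by auto
    ultimately show "w \<in> adjoin bounded_degree (smul f) (coeffs_in U)"
      unfolding adjoin_def by blast
  qed
  moreover have "0 \<in> adjoin UNIV (scale f) U"
    using Cons.prems(1) by (auto simp: adjoin_def intro!: exI[of _ 0])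
  moreover have "w \<in> coeffs_in U" if "w \<in> bounded_degree" "smul f w \<in> coeffs_in U" for w
    using that Cons.prems(2) by (auto simp: coeffs_in_def smul_def)
  ultimately show ?case using Cons by simp
qed simp

lemma submod_coeffs_in:
  assumes "0 \<in> U" "\<And>u v. u \<in> U \<Longrightarrow> v \<in> U \<Longrightarrow> u + v \<in> U" "\<And>f u. u \<in> U \<Longrightarrow> f *s u \<in> U"
  shows "submod k (coeffs_in U)"
  using assms unfolding submod_def coeffs_in_def
  by (auto simp: bounded_degree_0 bounded_degree_add bounded_degree_smul bounded_degree_move)
    (auto simp: smul_def move_def)

end

section \<open>Comparison of dimensions in boxes of exponents\<close>

definition box :: "nat \<Rightarrow> nat \<Rightarrow> (nat \<Rightarrow> nat) set" where
  "box r D = {e. (\<forall>k<r. e k < D) \<and> (\<forall>k\<ge>r. e k = 0)}"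

lemma finite_box: "finite (box r D)" and card_box: "card (box r D) = D ^ r"
proof -
  have "finite (box r D) \<and> card (box r D) = D ^ r"
  proof (induction r)
    case 0
    have "box 0 D = {\<lambda>_. 0}" by (auto simp: box_def)
    then show ?case by simp
  next
    case (Suc r)
    have img: "box (Suc r) D = (\<lambda>(e, i). e(r := i)) ` (box r D \<times> {..<D})"
    proof (intro equalityI subsetI)
      fix e assume "e \<in> box (Suc r) D"
      then have "(e(r := 0), e r) \<in> box r D \<times> {..<D}" by (auto simp: box_def)
      then show "e \<in> (\<lambda>(e, i). e(r := i)) ` (box r D \<times> {..<D})" by (rule rev_image_eqI) simp
    qed (auto simp: box_def)
    have "inj_on (\<lambda>(e, i). e(r := i)) (box r D \<times> {..<D})"
    proof (rule inj_onI; clarsimp)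
      fix e i e' i' assume H: "e \<in> box r D" "e' \<in> box r D" "e(r := i) = e'(r := i')"
      then have "e k = e' k" for k
        using H(1,2) fun_upd_other[of k r e i] fun_upd_other[of k r e' i'] unfolding H(3)
        by (cases "k = r") (auto simp: box_def)
      then show "e = e' \<and> i = i'" using fun_cong[OF H(3), of r] by auto
    qed
    then show ?case unfolding img using Suc by (auto simp: card_image card_cartesian_product)
  qed
  then show "finite (box r D)" "card (box r D) = D ^ r" by auto
qed

text \<open>\<open>U\<close> is the zero submodule of the presented module, \<open>v\<close> a basis
  of the lowest component, and \<open>w\<close> spans the next one. The forms map tuples of
  polynomials over the first component injectively into polynomials over the second. If the
  inequality failed, a large box would contain more unknown coefficients than there are equations
  for a zero image.\<close>

lemma (in generic_forms) dimension_growth: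
  fixes const :: "'k::field \<Rightarrow> 's" and B :: "'i set" and C :: "'j set"
  assumes const: "const 0 = 0" "\<And>a b. const (a + b) = const a + const b" "\<And>a b. const (a * b) = const a * const b"
    and U: "0 \<in> U" "\<And>u v. u \<in> U \<Longrightarrow> v \<in> U \<Longrightarrow> u + v \<in> U" "\<And>f u. u \<in> U \<Longrightarrow> f *s u \<in> U"
    and fs: "\<And>f. f \<in> set fs \<Longrightarrow> \<exists>g. f = (\<Sum>i<n. g i * x i)" "weakly_regular UNIV (map scale fs) U"
    and fin: "finite B" "finite C"
    and indep: "\<And>c u y b. (\<Sum>b\<in>B. const (c b) *s v b) = u + (\<Sum>i<n. x i *s y i) \<Longrightarrow> u \<in> U \<Longrightarrow> b \<in> B \<Longrightarrow> c b = 0"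
    and span: "\<And>i b. i < n \<Longrightarrow> b \<in> B \<Longrightarrow> \<exists>c. x i *s v b - (\<Sum>j\<in>C. const (c j) *s w j) \<in> U"
  shows "length fs * card B \<le> card C"
proof (rule ccontr)
  let ?r = "length fs"
  assume "\<not> ?r * card B \<le> card C"
  then obtain D where D: "\<not> ?r * card B * D ^ ?r \<le> card C * (D + n) ^ ?r"
    using mult_power_bound by blast
  obtain t where t: "\<And>i b. i < n \<Longrightarrow> b \<in> B \<Longrightarrow> x i *s v b - (\<Sum>j\<in>C. const (t i b j) *s w j) \<in> U"
    using span by metis
  define I where "I = {..<?r} \<times> box ?r D \<times> B"
  define J where "J = box ?r (D + n) \<times> C"
  \<comment> \<open>The coefficient of the unknown \<open>c (k, e, b)\<close> in the equation at
    exponent \<open>e'\<close> and index \<open>l\<close>: form \<open>k\<close> reaches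
    \<open>e'\<close> from \<open>e\<close> by adding some \<open>i < n\<close> to the exponent at
    \<open>k\<close>, with factor \<open>x i\<close>.\<close>
  define m where "m = (\<lambda>(e' :: nat \<Rightarrow> nat, l) (k, e, b).
    \<Sum>i<n. if i \<le> e' k \<and> e = e'(k := e' k - i) then t i b l else 0)"
  have "card J < card I" using D by (simp add: I_def J_def card_cartesian_product card_box mult_ac)
  moreover have "finite I" "finite J" using fin finite_box by (auto simp: I_def J_def)
  ultimately have "\<exists>c. (\<exists>p\<in>I. c p \<noteq> 0) \<and> (\<forall>p. p \<notin> I \<longrightarrow> c p = 0) \<and> (\<forall>q\<in>J. (\<Sum>p\<in>I. m q p * c p) = 0)"
    by (intro underdetermined_system)
  then obtain c where c: "\<exists>p\<in>I. c p \<noteq> 0" "\<forall>p. p \<notin> I \<longrightarrow> c p = 0"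
    and eqs: "\<forall>q\<in>J. (\<Sum>p\<in>I. m q p * c p) = 0"
    by (elim exE conjE)
  have sys: "(\<Sum>k<?r. \<Sum>i<n. \<Sum>b\<in>B. if i \<le> e k then t i b l * c (k, e(k := e k - i), b) else 0) = 0"
    if l: "l \<in> C" for e l
  proof (cases "e \<in> box ?r (D + n)")
    case True
    have "(\<Sum>p\<in>I. m (e, l) p * c p) = (\<Sum>k<?r. \<Sum>e'\<in>box ?r D. \<Sum>b\<in>B. m (e, l) (k, e', b) * c (k, e', b))"
      unfolding I_def sum.cartesian_product by (intro sum.cong) auto
    also have "\<dots> = (\<Sum>k<?r. \<Sum>b\<in>B. \<Sum>e'\<in>box ?r D. \<Sum>i<n.
        if e(k := e k - i) = e' then (if i \<le> e k then t i b l * c (k, e', b) else 0) else 0)"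
      by (subst sum.swap[of _ B]) (auto simp: m_def sum_distrib_right intro!: sum.cong)
    also have "\<dots> = (\<Sum>k<?r. \<Sum>b\<in>B. \<Sum>i<n. if i \<le> e k then t i b l * c (k, e(k := e k - i), b) else 0)"
      by (subst sum.swap[of _ "{..<n}" "box ?r D"])
        (auto simp: sum.delta'[OF finite_box] c(2) I_def intro!: sum.cong)
    also have "\<dots> = (\<Sum>k<?r. \<Sum>i<n. \<Sum>b\<in>B. if i \<le> e k then t i b l * c (k, e(k := e k - i), b) else 0)"
      by (subst sum.swap) simp
    finally show ?thesis using bspec[OF eqs, of "(e, l)"] True l by (simp add: J_def)
  next
    case False
    \<comment> \<open>Raising one exponent by \<open>i < n\<close> leads from the box of side
      \<open>D\<close> into the box of side \<open>D + n\<close>; outside the latter the equations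
      contain no unknowns.\<close>
    have "e(k := e k - i) \<notin> box ?r D" if "k < ?r" "i < n" for k i
    proof
      assume H: "e(k := e k - i) \<in> box ?r D"
      have "e \<in> box ?r (D + n)" unfolding box_def
      proof (intro CollectI conjI allI impI)
        fix j
        show "e j < D + n" if "j < ?r"
          using H that \<open>i < n\<close> by (cases "j = k") (auto simp: box_def dest: spec[of _ j])
        show "e j = 0" if "j \<ge> ?r"
          using H that \<open>k < ?r\<close> by (auto simp: box_def split: if_splits)
      qed
      with False show False ..
    qed
    then show ?thesis by (auto simp: c(2) I_def intro!: sum.neutral)
  qed
  define a where "a k e = (\<Sum>b\<in>B. const (c (k, e, b)) *s v b)" for k e
  have const_sum: "const (\<Sum>i\<in>A. f i) = (\<Sum>i\<in>A. const (f i))" for f :: "'z \<Rightarrow> 'k" and A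
    by (induction A rule: infinite_finite_induct) (auto simp: const)
  note sub = submod_coeffs_in[OF U]
  have usum: "(\<Sum>i\<in>A. u i) \<in> U" if "\<And>i. i \<in> A \<Longrightarrow> u i \<in> U" for u :: "'z \<Rightarrow> 'a" and A
    using that by (induction A rule: infinite_finite_induct) (auto intro: U)
  have a_bounded: "a k \<in> bounded_degree" for k
  proof -
    have "a k e = 0" if "Suc D \<le> e l" for e l
    proof -
      have "e \<notin> box ?r D" using that by (cases "l < ?r") (auto simp: box_def)
      then show ?thesis by (simp add: a_def c(2) I_def const)
    qed
    then show ?thesis unfolding bounded_degree_def by blast
  qed
  have "(\<Sum>k<?r. gen k (a k)) e \<in> U" for e
  proof -
    define s where "s k i b = (if i \<le> e k then const (c (k, e(k := e k - i), b)) else 0)" for k i b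
    have "(\<Sum>k<?r. gen k (a k)) e = (\<Sum>k<?r. \<Sum>i<n. \<Sum>b\<in>B. s k i b *s (x i *s v b))"
      unfolding sum_fun_apply gen_def a_def s_def
      by (intro sum.cong refl) (auto simp: scale_sum_right mult.commute)
    \<comment> \<open>Expanding each \<open>x i *s v b\<close> over the \<open>w j\<close> costs
      only an element of \<open>U\<close>; the coefficient of each \<open>w j\<close> that remains
      vanishes by \<open>sys\<close>.\<close>
    also have "\<dots> = (\<Sum>k<?r. \<Sum>i<n. \<Sum>b\<in>B. s k i b *s (x i *s v b - (\<Sum>j\<in>C. const (t i b j) *s w j)))
       + (\<Sum>k<?r. \<Sum>i<n. \<Sum>b\<in>B. \<Sum>j\<in>C. s k i b *s const (t i b j) *s w j)"
      by (simp add: scale_right_diff_distrib sum_subtractf scale_sum_right)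
    also have "(\<Sum>k<?r. \<Sum>i<n. \<Sum>b\<in>B. \<Sum>j\<in>C. s k i b *s const (t i b j) *s w j) =
       (\<Sum>j\<in>C. \<Sum>k<?r. \<Sum>i<n. \<Sum>b\<in>B. (s k i b * const (t i b j)) *s w j)"
      by (simp add: sum.swap[of _ C] mult.commute)
    also have "\<dots> = (\<Sum>j\<in>C. const (\<Sum>k<?r. \<Sum>i<n. \<Sum>b\<in>B.
        if i \<le> e k then t i b j * c (k, e(k := e k - i), b) else 0) *s w j)"
      unfolding const_sum scale_sum_left s_def
      by (intro sum.cong refl arg_cong2[where f = scale]) (auto simp: const mult.commute)
    also have "\<dots> = 0" by (simp add: sys const)
    finally show ?thesis using t by (auto intro!: usum U(3))
  qed
  then have zero: "(\<Sum>k<?r. gen k (a k)) \<in> coeffs_in U"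
    using a_bounded by (auto simp: coeffs_in_def intro!: bounded_degree_sum bounded_degree_gen)
  have reg: "weakly_regular bounded_degree (map gen [0..<?r]) (coeffs_in U)"
    using weakly_regular_gen[OF sub fs(1) weakly_regular_coeffs_in[OF U(1) fs(2)], where k = 0] by simp
  have indep0: "c' b = 0" if "(\<Sum>b\<in>B. const (c' b) *s v b) \<in> U" "b \<in> B" for c' b
    using indep[of c' _ "\<lambda>_. 0" b] that by simp
  obtain k e b where keb: "(k, e, b) \<in> I" "c (k, e, b) \<noteq> 0" using c(1) by (metis prod_cases3)
  have "a k \<in> coeffs_in U"
  proof (rule weakly_regular_gen_independent[OF sub reg _ a_bounded _ zero])
    show "k < ?r" using keb by (simp add: I_def)
    show "a j e \<in> Collect (\<lambda>p. \<exists>c. p = (\<Sum>b\<in>B. const (c b) *s v b))" for j e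
      unfolding a_def by (intro CollectI exI[of _ "\<lambda>b. c (j, e, b)"] refl)
    show "p \<in> U" if "p \<in> Collect (\<lambda>p. \<exists>c. p = (\<Sum>b\<in>B. const (c b) *s v b))" "u \<in> U"
      "p = u + (\<Sum>i<n. x i *s y i)" for p u y
    proof -
      from that(1) have "\<exists>c. p = (\<Sum>b\<in>B. const (c b) *s v b)" by simp
      then obtain c where c: "p = (\<Sum>b\<in>B. const (c b) *s v b)" ..
      then have "c b = 0" if "b \<in> B" for b
        using indep[of c u y b] \<open>u \<in> U\<close> \<open>p = u + (\<Sum>i<n. x i *s y i)\<close> that by simp
      then show ?thesis using c U(1) by (simp add: const)
    qed
  qed
  then have "a k e \<in> U" by (simp add: coeffs_in_def)
  then show False using indep0[of "\<lambda>b. c (k, e, b)" b] keb by (simp add: a_def I_def)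
qed

section \<open>Graded modules over the polynomial ring\<close>

lemma poly_ring_simps [simp]:
  "carrier poly_ring = UNIV" "x \<oplus>\<^bsub>poly_ring\<^esub> y = x + y" "x \<otimes>\<^bsub>poly_ring\<^esub> y = x * y"
  "\<zero>\<^bsub>poly_ring\<^esub> = 0" "\<one>\<^bsub>poly_ring\<^esub> = 1"
  by (simp_all add: ring_of_type_algebra_def)

lemma const_simps: "const 0 = 0" "const 1 = 1" "const (a + b) = const a + const b"
  "const (a * b) = const a * const b" "const (a - b) = const a - const b"
  by (simp_all add: const_def single_add mult_single single_diff)

lemma const_sum: "const (\<Sum>i\<in>A. f i) = (\<Sum>i\<in>A. const (f i))"
  by (induction A rule: infinite_finite_induct) (auto simp: const_simps)

lemma monom_degree_add: "monom_degree (e + e') = monom_degree e + monom_degree e'"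
  by (simp add: monom_degree_def lookup_add sum.distrib)

lemma monom_degree_single: "monom_degree (Poly_Mapping.single i d) = d"
  by (simp add: monom_degree_def lookup_single when_def)

lemma const_homogeneous: "const a \<in> homogeneous_part 0"
  by (auto simp: const_def homogeneous_part_def monom_degree_def)

lemma var_homogeneous: "var i \<in> homogeneous_part 1"
  by (auto simp: var_def homogeneous_part_def monom_degree_single)

lemma poly_mapping_sum_single: "f = (\<Sum>e\<in>Poly_Mapping.keys f. Poly_Mapping.single e (Poly_Mapping.lookup f e))"
proof (rule poly_mapping_eqI)
  fix e
  show "Poly_Mapping.lookup f e =
    Poly_Mapping.lookup (\<Sum>e\<in>Poly_Mapping.keys f. Poly_Mapping.single e (Poly_Mapping.lookup f e)) e"
    by (simp add: lookup_sum lookup_single when_def in_keys_iff)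
qed

lemma lookup_le_monom_degree: "Poly_Mapping.lookup e i \<le> monom_degree e"
  unfolding monom_degree_def by (rule member_le_sum) auto

lemma finite_monom_degree: "finite {e :: 'n::finite \<Rightarrow>\<^sub>0 nat. monom_degree e = d}"
proof (rule finite_imageD)
  have "Poly_Mapping.lookup ` {e :: 'n \<Rightarrow>\<^sub>0 nat. monom_degree e = d} \<subseteq> UNIV \<rightarrow>\<^sub>E {..d}"
    by (simp add: image_subset_iff PiE_def extensional_def lookup_le_monom_degree[THEN order_trans])
  then show "finite (Poly_Mapping.lookup ` {e :: 'n \<Rightarrow>\<^sub>0 nat. monom_degree e = d})"
    by (rule finite_subset[OF _ finite_PiE]) simp_all
  show "inj_on Poly_Mapping.lookup {e :: 'n \<Rightarrow>\<^sub>0 nat. monom_degree e = d}"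
    by (rule inj_onI) (simp add: lookup_inject)
qed

section \<open>Linear algebra over the ground field in a single degree\<close>

text \<open>Isolates the structure that a Hilbert function sees, so that one development serves
  \<open>ideal_module\<close>, the competing modules and the explicit direct sum.\<close>

locale poly_module = module poly_ring M
  for M :: "(('n::finite, 'k::field) mpoly, 'b) graded_module" (structure) +
  assumes component_subgroup: "\<And>k. additive_subgroup (component M k) M"
    and const_component: "\<And>k a x. x \<in> component M k \<Longrightarrow> const a \<odot>\<^bsub>M\<^esub> x \<in> component M k"
begin

definition comb :: "'b set \<Rightarrow> ('b \<Rightarrow> ('n, 'k) mpoly) \<Rightarrow> 'b" where
  "comb A f = (\<Oplus>\<^bsub>M\<^esub>a\<in>A. f a \<odot>\<^bsub>M\<^esub> a)"

lemma component_simps: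
  "x \<in> component M k \<Longrightarrow> x \<in> carrier M"
  "x \<in> component M k \<Longrightarrow> y \<in> component M k \<Longrightarrow> x \<oplus>\<^bsub>M\<^esub> y \<in> component M k"
  "\<zero>\<^bsub>M\<^esub> \<in> component M k"
  using additive_subgroup.a_subset[OF component_subgroup[of k]]
    additive_subgroup.a_closed[OF component_subgroup[of k]]
    additive_subgroup.zero_closed[OF component_subgroup[of k]] by auto

lemma smult_simps [simp]:
  "x \<in> carrier M \<Longrightarrow> f \<odot>\<^bsub>M\<^esub> x \<in> carrier M"
  "x \<in> carrier M \<Longrightarrow> 0 \<odot>\<^bsub>M\<^esub> x = \<zero>\<^bsub>M\<^esub>"
  "f \<odot>\<^bsub>M\<^esub> \<zero>\<^bsub>M\<^esub> = \<zero>\<^bsub>M\<^esub>"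
  "x \<in> carrier M \<Longrightarrow> 1 \<odot>\<^bsub>M\<^esub> x = x"
  using smult_closed[of f x] smult_l_null[of x] smult_r_null[of f] smult_one[of x] by auto

lemma smult_distrib:
  "x \<in> carrier M \<Longrightarrow> (f + g) \<odot>\<^bsub>M\<^esub> x = f \<odot>\<^bsub>M\<^esub> x \<oplus>\<^bsub>M\<^esub> g \<odot>\<^bsub>M\<^esub> x"
  "x \<in> carrier M \<Longrightarrow> y \<in> carrier M \<Longrightarrow> f \<odot>\<^bsub>M\<^esub> (x \<oplus>\<^bsub>M\<^esub> y) = f \<odot>\<^bsub>M\<^esub> x \<oplus>\<^bsub>M\<^esub> f \<odot>\<^bsub>M\<^esub> y"
  "x \<in> carrier M \<Longrightarrow> (f * g) \<odot>\<^bsub>M\<^esub> x = f \<odot>\<^bsub>M\<^esub> (g \<odot>\<^bsub>M\<^esub> x)"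
  using smult_l_distr[of f g x] smult_r_distr[of f x y] smult_assoc1[of f g x] by auto

lemma finsum_component: "(\<And>i. i \<in> I \<Longrightarrow> f i \<in> component M k) \<Longrightarrow> (\<Oplus>\<^bsub>M\<^esub>i\<in>I. f i) \<in> component M k"
proof (induction I rule: infinite_finite_induct)
  case (insert i I)
  then have "(\<Oplus>\<^bsub>M\<^esub>i\<in>insert i I. f i) = f i \<oplus>\<^bsub>M\<^esub> (\<Oplus>\<^bsub>M\<^esub>i\<in>I. f i)"
    by (intro M.finsum_insert) (auto dest: component_simps(1))
  also have "\<dots> \<in> component M k" using insert by (intro component_simps(2)) auto
  finally show ?case .
qed (auto simp: component_simps)

lemma smult_sum:
  "x \<in> carrier M \<Longrightarrow> (\<Sum>i\<in>I. f i) \<odot>\<^bsub>M\<^esub> x = (\<Oplus>\<^bsub>M\<^esub>i\<in>I. f i \<odot>\<^bsub>M\<^esub> x)"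
  by (induction I rule: infinite_finite_induct) (auto simp: smult_distrib)

lemma smult_finsum:
  assumes "\<And>i. i \<in> I \<Longrightarrow> g i \<in> carrier M"
  shows "f \<odot>\<^bsub>M\<^esub> (\<Oplus>\<^bsub>M\<^esub>i\<in>I. g i) = (\<Oplus>\<^bsub>M\<^esub>i\<in>I. f \<odot>\<^bsub>M\<^esub> g i)"
  using assms
proof (induction I rule: infinite_finite_induct)
  case (insert i I)
  then have "(\<Oplus>\<^bsub>M\<^esub>i\<in>insert i I. g i) = g i \<oplus>\<^bsub>M\<^esub> (\<Oplus>\<^bsub>M\<^esub>i\<in>I. g i)"
    "(\<Oplus>\<^bsub>M\<^esub>i\<in>insert i I. f \<odot>\<^bsub>M\<^esub> g i) = f \<odot>\<^bsub>M\<^esub> g i \<oplus>\<^bsub>M\<^esub> (\<Oplus>\<^bsub>M\<^esub>i\<in>I. f \<odot>\<^bsub>M\<^esub> g i)"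
    by (auto intro!: M.finsum_insert)
  then show ?case using insert by (simp add: smult_distrib)
qed auto

lemma comb_closed: "A \<subseteq> carrier M \<Longrightarrow> comb A f \<in> carrier M"
  unfolding comb_def by (intro M.finsum_closed) auto

lemma comb_cong:
  "A \<subseteq> carrier M \<Longrightarrow> (\<And>a. a \<in> A \<Longrightarrow> f a = g a) \<Longrightarrow> comb A f = comb A g"
  unfolding comb_def by (intro M.finsum_cong') auto

lemma comb_add: "A \<subseteq> carrier M \<Longrightarrow> comb A (\<lambda>a. f a + g a) = comb A f \<oplus>\<^bsub>M\<^esub> comb A g"
  using M.finsum_addf[of "\<lambda>a. f a \<odot>\<^bsub>M\<^esub> a" A "\<lambda>a. g a \<odot>\<^bsub>M\<^esub> a"] unfolding comb_def
  by (auto simp: smult_distrib subset_iff Pi_def cong: M.finsum_cong)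

lemma comb_smult: "A \<subseteq> carrier M \<Longrightarrow> comb A (\<lambda>a. h * f a) = h \<odot>\<^bsub>M\<^esub> comb A f"
  unfolding comb_def
  by (subst smult_finsum) (auto simp: smult_distrib subset_iff intro!: M.finsum_cong')

lemma comb_zero: "A \<subseteq> carrier M \<Longrightarrow> comb A (\<lambda>a. 0) = \<zero>\<^bsub>M\<^esub>"
  unfolding comb_def by (intro M.add.finprod_one_eqI) auto

lemma comb_diff:
  assumes "A \<subseteq> carrier M"
  shows "comb A (\<lambda>a. f a - g a) = comb A f \<ominus>\<^bsub>M\<^esub> comb A g"
proof -
  have "comb A (\<lambda>a. f a - g a) \<oplus>\<^bsub>M\<^esub> comb A g = comb A f"
    using comb_add[OF assms, of "\<lambda>a. f a - g a" g] by simp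
  then show ?thesis using comb_closed[OF assms] by (simp add: M.add.inv_solve_right a_minus_def)
qed

lemma comb_sum:
  "A \<subseteq> carrier M \<Longrightarrow> comb A (\<lambda>a. \<Sum>i\<in>I. f i a) = (\<Oplus>\<^bsub>M\<^esub>i\<in>I. comb A (f i))"
  by (induction I rule: infinite_finite_induct) (simp_all add: comb_zero comb_add comb_closed)

lemma comb_single:
  assumes "finite A" "A \<subseteq> carrier M" "a \<in> A"
  shows "comb A (\<lambda>x. if x = a then f else 0) = f \<odot>\<^bsub>M\<^esub> a"
proof -
  have "comb A (\<lambda>x. if x = a then f else 0) = (\<Oplus>\<^bsub>M\<^esub>x\<in>A. if a = x then f \<odot>\<^bsub>M\<^esub> x else \<zero>\<^bsub>M\<^esub>)"
    unfolding comb_def using assms by (intro M.finsum_cong') (auto simp: subset_iff)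
  also have "\<dots> = f \<odot>\<^bsub>M\<^esub> a"
    using assms by (intro M.add.finprod_singleton) (auto simp: subset_iff)
  finally show ?thesis .
qed

lemma comb_remove:
  assumes "finite A" "A \<subseteq> carrier M" "a \<in> A" "f a = 0"
  shows "comb A f = comb (A - {a}) f"
proof -
  have "comb (insert a (A - {a})) f = f a \<odot>\<^bsub>M\<^esub> a \<oplus>\<^bsub>M\<^esub> comb (A - {a}) f"
    unfolding comb_def using assms by (intro M.finsum_insert) (auto simp: subset_iff)
  then show ?thesis using assms comb_closed[of "A - {a}" f] by (auto simp: insert_absorb subset_iff)
qed

lemma component_basis_iff:
  "component_basis M k B \<longleftrightarrow> finite B \<and> B \<subseteq> component M k \<and>
    (\<forall>x\<in>component M k. \<exists>!a. a \<in> B \<rightarrow>\<^sub>E UNIV \<and> x = comb B (\<lambda>b. const (a b)))"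
  by (simp add: component_basis_def comb_def)

lemma component_basisD:
  assumes "component_basis M k B"
  shows "finite B" "B \<subseteq> carrier M" "x \<in> component M k \<Longrightarrow> \<exists>a. x = comb B (\<lambda>b. const (a b))"
    "comb B (\<lambda>b. const (c b)) = \<zero>\<^bsub>M\<^esub> \<Longrightarrow> b \<in> B \<Longrightarrow> c b = 0"
proof -
  show fin: "finite B" and sub: "B \<subseteq> carrier M"
    using assms component_simps(1) by (auto simp: component_basis_iff)
  show "\<exists>a. x = comb B (\<lambda>b. const (a b))" if "x \<in> component M k"
    using assms that by (auto simp: component_basis_iff)
  show "c b = 0" if "comb B (\<lambda>b. const (c b)) = \<zero>\<^bsub>M\<^esub>" "b \<in> B"
  proof -
    have cong: "comb B (\<lambda>b. const (restrict c B b)) = comb B (\<lambda>b. const (c b))" for c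
      using sub by (intro comb_cong) auto
    have unique: "u = v" if "\<exists>!x. P x" "P u" "P v" for P and u v :: "'b \<Rightarrow> 'k"
    proof -
      from that(1) obtain x where "\<forall>y. P y \<longrightarrow> y = x" by (rule ex1E)
      then have "P u \<longrightarrow> u = x" "P v \<longrightarrow> v = x" by blast+
      then show ?thesis using that(2,3) by metis
    qed
    have ex: "\<exists>!a. a \<in> B \<rightarrow>\<^sub>E UNIV \<and> \<zero>\<^bsub>M\<^esub> = comb B (\<lambda>b. const (a b))"
      using assms component_simps(3) by (auto simp: component_basis_iff)
    have r1: "\<zero>\<^bsub>M\<^esub> = comb B (\<lambda>b. const (restrict c B b))" using that(1) cong by simp
    have r2: "\<zero>\<^bsub>M\<^esub> = comb B (\<lambda>b. const (restrict (\<lambda>_. 0) B b))"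
      unfolding cong using comb_zero[OF sub] by (simp add: const_simps)
    have "restrict c B = restrict (\<lambda>_. 0) B"
      by (rule unique[OF ex conjI[OF _ r1] conjI[OF _ r2]]) (auto simp only: restrict_PiE_iff)
    then have "restrict c B b = restrict (\<lambda>_. 0) B b" by (rule fun_cong)
    then show ?thesis using that(2) by simp
  qed
qed

text \<open>Expanding \<open>B\<close> in terms of \<open>C\<close> turns the search for a
  dependence of \<open>B\<close> into \<open>card C\<close> equations in \<open>card B\<close>
  unknowns. The resulting invariance of dimension makes the \<open>THE\<close> in
  \<open>hilbert_function\<close> well defined.\<close>

lemma component_basis_card_le:
  assumes B: "component_basis M k B" and C: "component_basis M k C"
  shows "card B \<le> card C"
proof (rule ccontr)
  assume "\<not> card B \<le> card C"
  then have less: "card C < card B" by simp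
  note B' = component_basisD[OF B] and C' = component_basisD[OF C]
  have "\<exists>a. b = comb C (\<lambda>c. const (a c))" if "b \<in> B" for b
    using C'(3)[of b] B that by (auto simp: component_basis_iff)
  then have "\<forall>b\<in>B. \<exists>a. b = comb C (\<lambda>c. const (a c))" ..
  from bchoice[OF this] obtain t where t: "\<forall>b\<in>B. b = comb C (\<lambda>c. const (t b c))" ..
  from underdetermined_system[OF B'(1) C'(1) less, where a = "\<lambda>c b. t b c"]
  obtain z where z: "\<exists>b\<in>B. z b \<noteq> 0" "\<forall>c\<in>C. (\<Sum>b\<in>B. t b c * z b) = 0"
    by (elim exE conjE)
  have "comb B (\<lambda>b. const (z b)) = (\<Oplus>\<^bsub>M\<^esub>b\<in>B. const (z b) \<odot>\<^bsub>M\<^esub> comb C (\<lambda>c. const (t b c)))"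
    unfolding comb_def[of B] using bspec[OF t, symmetric] C'(2)
    by (intro M.finsum_cong') (auto intro!: comb_closed)
  also have "\<dots> = (\<Oplus>\<^bsub>M\<^esub>b\<in>B. comb C (\<lambda>c. const (t b c * z b)))"
    using C'(2) by (intro M.finsum_cong') (auto simp: comb_smult[symmetric] const_simps mult.commute intro!: comb_closed)
  also have "\<dots> = comb C (\<lambda>c. \<Sum>b\<in>B. const (t b c * z b))"
    using C'(2) by (simp add: comb_sum)
  also have "\<dots> = comb C (\<lambda>c. 0)"
    using z(2) by (intro comb_cong[OF C'(2)]) (simp add: const_sum[symmetric] const_simps(1))
  finally show False using z(1) B'(4) comb_zero[OF C'(2)] by auto
qed

lemma hilbert_function_eq:
  assumes "component_basis M k B"
  shows "hilbert_function M k = card B"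
  unfolding hilbert_function_def
  by (rule the_equality) (use assms component_basis_card_le in \<open>auto intro: le_antisym\<close>)

text \<open>A spanning set of least cardinality is a basis: two expansions of one element that
  differ at \<open>b\<close> would make \<open>b\<close> dispensable.\<close>

lemma component_basis_exists:
  assumes "finite S" "S \<subseteq> component M k"
    and "\<And>x. x \<in> component M k \<Longrightarrow> \<exists>h. x = comb S (\<lambda>b. const (h b))"
  obtains B where "component_basis M k B"
proof -
  define spans where "spans B \<longleftrightarrow> finite B \<and> B \<subseteq> component M k \<and>
    (\<forall>x\<in>component M k. \<exists>h. x = comb B (\<lambda>b. const (h b)))" for B
  have "spans S" using assms by (auto simp: spans_def)
  then obtain B where B: "spans B" "\<And>C. spans C \<Longrightarrow> card B \<le> card C"
    using ex_has_least_nat[of spans S card] by blast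
  have fin: "finite B" and sub: "B \<subseteq> carrier M" using B(1) component_simps(1) by (auto simp: spans_def)
  have cong: "comb B (\<lambda>b. const (restrict c B b)) = comb B (\<lambda>b. const (c b))" for c
    using sub by (intro comb_cong) auto
  have eq: "f b = g b" if fg: "comb B (\<lambda>b. const (f b)) = comb B (\<lambda>b. const (g b))" and b: "b \<in> B" for f g b
  proof (rule ccontr)
    assume ne: "f b \<noteq> g b"
    have "spans (B - {b})" unfolding spans_def
    proof (intro conjI ballI)
      fix x assume "x \<in> component M k"
      then obtain h where h: "x = comb B (\<lambda>b. const (h b))" using B(1) by (auto simp: spans_def)
      \<comment> \<open>Chosen so that \<open>h' b = 0\<close>.\<close>
      define q where "q = - h b / (f b - g b)"
      define h' where "h' a = h a + q * (f a - g a)" for a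
      have "comb B (\<lambda>a. const (h' a)) = comb B (\<lambda>a. const (h a) + const q * (const (f a) - const (g a)))"
        by (simp add: h'_def const_simps)
      also have "\<dots> = x \<oplus>\<^bsub>M\<^esub> const q \<odot>\<^bsub>M\<^esub> (comb B (\<lambda>b. const (f b)) \<ominus>\<^bsub>M\<^esub> comb B (\<lambda>b. const (g b)))"
        by (simp add: comb_add[OF sub] comb_smult[OF sub] comb_diff[OF sub] h)
      also have "\<dots> = x"
      proof -
        have "comb B (\<lambda>b. const (g b)) \<ominus>\<^bsub>M\<^esub> comb B (\<lambda>b. const (g b)) = \<zero>\<^bsub>M\<^esub>"
          unfolding a_minus_def by (rule M.r_neg[OF comb_closed[OF sub]])
        moreover have "x \<in> carrier M" unfolding h by (rule comb_closed[OF sub])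
        ultimately show ?thesis unfolding fg by simp
      qed
      finally have "x = comb (B - {b}) (\<lambda>a. const (h' a))"
        using comb_remove[OF fin sub b, of "\<lambda>a. const (h' a)"] ne by (simp add: h'_def q_def const_simps(1))
      then show "\<exists>h. x = comb (B - {b}) (\<lambda>b. const (h b))" by blast
    qed (use B(1) in \<open>auto simp: spans_def\<close>)
    then have "card B \<le> card (B - {b})" by (rule B(2))
    then show False using b fin by (metis card_Diff1_less linorder_not_less)
  qed
  have "component_basis M k B" unfolding component_basis_iff
  proof (intro conjI ballI)
    fix x assume "x \<in> component M k"
    then obtain h where h: "x = comb B (\<lambda>b. const (h b))" using B(1) by (auto simp: spans_def)
    show "\<exists>!a. a \<in> B \<rightarrow>\<^sub>E UNIV \<and> x = comb B (\<lambda>b. const (a b))"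
    proof (rule ex1I[of _ "restrict h B"])
      show "restrict h B \<in> B \<rightarrow>\<^sub>E UNIV \<and> x = comb B (\<lambda>b. const (restrict h B b))"
        using h cong by simp
      fix a assume a: "a \<in> B \<rightarrow>\<^sub>E UNIV \<and> x = comb B (\<lambda>b. const (a b))"
      then have "a b = h b" if "b \<in> B" for b using eq[of a h b] h that by auto
      then show "a = restrict h B" using a by (intro ext) (auto simp: PiE_def extensional_def restrict_def)
    qed
  qed (use B(1) in \<open>auto simp: spans_def\<close>)
  then show ?thesis by (rule that)
qed

end

section \<open>Ideals of the polynomial ring\<close>

lemma cring_poly_ring: "cring poly_ring"
  by (rule cring_from_type_algebra)

lemma poly_ring_a_inv: "\<ominus>\<^bsub>poly_ring\<^esub> f = - f"
proof -
  interpret cring poly_ring by (rule cring_poly_ring)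
  show ?thesis by (rule minus_equality) simp_all
qed

lemma ideal_poly_ringI:
  assumes "0 \<in> I" "\<And>f g. f \<in> I \<Longrightarrow> g \<in> I \<Longrightarrow> f + g \<in> I" "\<And>h f. f \<in> I \<Longrightarrow> h * f \<in> I"
  shows "ideal I poly_ring"
proof (rule idealI)
  show "ring poly_ring" by (rule ring_from_type_algebra)
  show "subgroup I (add_monoid poly_ring)"
  proof (rule subgroup.intro)
    fix f assume "f \<in> I"
    then have "(- 1) * f \<in> I" by (rule assms(3))
    then show "inv\<^bsub>add_monoid poly_ring\<^esub> f \<in> I" using poly_ring_a_inv[of f] by (simp add: a_inv_def)
  qed (use assms in auto)
qed (use assms in \<open>auto simp: mult.commute\<close>)

text \<open>The enumeration \<open>x\<close> is there because \<open>generic_forms\<close> numbers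
  the variables: the \<open>i\<close>-th one is paired with the \<open>i\<close>-th power of an
  indeterminate.\<close>

lemma irrelevant_ideal_combination:
  fixes f :: "('n::finite, 'k::field) mpoly" and N :: nat
  assumes "f \<in> irrelevant_ideal" and x: "bij_betw x {..<N} (UNIV :: 'n set)"
  shows "\<exists>g. f = (\<Sum>i<N. g i * var (x i))"
proof -
  interpret cring "poly_ring :: ('n, 'k) mpoly ring" by (rule cring_poly_ring)
  let ?I = "{f :: ('n, 'k) mpoly. \<exists>g. f = (\<Sum>i<N. g i * var (x i))}"
  have "ideal ?I poly_ring"
  proof (rule ideal_poly_ringI)
    show "0 \<in> ?I" by (intro CollectI exI[of _ "\<lambda>_. 0"]) simp
  next
    fix f g assume "f \<in> ?I" "g \<in> ?I"
    then obtain a b where "f = (\<Sum>i<N. a i * var (x i))" "g = (\<Sum>i<N. b i * var (x i))" by blast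
    then show "f + g \<in> ?I"
      by (intro CollectI exI[of _ "\<lambda>i. a i + b i"]) (simp add: distrib_right sum.distrib)
  next
    fix h f assume "f \<in> ?I"
    then obtain a where "f = (\<Sum>i<N. a i * var (x i))" by blast
    then show "h * f \<in> ?I"
      by (intro CollectI exI[of _ "\<lambda>i. h * a i"]) (simp add: sum_distrib_left mult.assoc)
  qed
  moreover have "range var \<subseteq> ?I"
  proof clarify
    fix j
    have "j \<in> x ` {..<N}" using x by (simp add: bij_betw_def)
    then obtain i where i: "i < N" "x i = j" by auto
    have "(\<Sum>l<N. (if l = i then 1 else 0) * (var (x l) :: ('n, 'k) mpoly))
        = (\<Sum>l<N. if l = i then var (x l) else 0)"
      by (rule sum.cong) simp_all
    also have "\<dots> = (if i \<in> {..<N} then var (x i) else 0)" by (rule sum.delta) simp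
    also have "\<dots> = var j" using i by simp
    finally have "var j = (\<Sum>l<N. (if l = i then 1 else 0) * (var (x l) :: ('n, 'k) mpoly))" by (rule sym)
    then show "\<exists>g. (var j :: ('n, 'k) mpoly) = (\<Sum>i<N. g i * var (x i))"
      by (intro exI[of _ "\<lambda>l. if l = i then 1 else 0"])
  qed
  ultimately have "Idl\<^bsub>poly_ring\<^esub> (range var) \<subseteq> ?I" by (rule genideal_minimal)
  then show ?thesis using assms(1) by (auto simp: irrelevant_ideal_def)
qed

sublocale fg_graded_module \<subseteq> poly_module M
proof (rule poly_module.intro[OF module_axioms], rule poly_module_axioms.intro)
  show "const a \<odot>\<^bsub>M\<^esub> x \<in> component M k" if "x \<in> component M k" for k a x
    using smult_component[OF const_homogeneous that] by simp
qed (rule component_subgroup)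

section \<open>Homogeneous components and finiteness of the graded pieces\<close>

context fg_graded_module
begin

definition homog :: "'b \<Rightarrow> int \<Rightarrow> 'b" where
  "homog x = (THE c. (\<forall>k. c k \<in> component M k) \<and> finite {k. c k \<noteq> \<zero>\<^bsub>M\<^esub>} \<and>
             x = (\<Oplus>\<^bsub>M\<^esub>k\<in>{k. c k \<noteq> \<zero>\<^bsub>M\<^esub>}. c k))"

lemma homogD:
  assumes "x \<in> carrier M"
  shows "homog x k \<in> component M k" "finite {k. homog x k \<noteq> \<zero>\<^bsub>M\<^esub>}"
    "x = (\<Oplus>\<^bsub>M\<^esub>k\<in>{k. homog x k \<noteq> \<zero>\<^bsub>M\<^esub>}. homog x k)"
  using theI'[OF direct_sum[OF assms], folded homog_def] by simp_all

lemma homog_closed: "x \<in> carrier M \<Longrightarrow> homog x k \<in> carrier M"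
  using homogD(1) component_simps(1) by blast

lemma finsum_superset:
  assumes "finite S" "{k. c k \<noteq> \<zero>\<^bsub>M\<^esub>} \<subseteq> S" "\<And>k. c k \<in> carrier M"
  shows "(\<Oplus>\<^bsub>M\<^esub>k\<in>{k. c k \<noteq> \<zero>\<^bsub>M\<^esub>}. c k) = (\<Oplus>\<^bsub>M\<^esub>k\<in>S. c k)"
  using assms by (intro M.add.finprod_mono_neutral_cong_left) auto

lemma homog_unique:
  assumes "\<And>k. c k \<in> component M k" "finite S" "\<And>k. k \<notin> S \<Longrightarrow> c k = \<zero>\<^bsub>M\<^esub>" "x = (\<Oplus>\<^bsub>M\<^esub>k\<in>S. c k)"
  shows "homog x = c"
proof -
  have sub: "{k. c k \<noteq> \<zero>\<^bsub>M\<^esub>} \<subseteq> S" using assms(3) by blast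
  have cl: "c k \<in> carrier M" for k using assms(1) component_simps(1) by blast
  then have "x \<in> carrier M" unfolding assms(4) by (intro M.finsum_closed) auto
  moreover have "x = (\<Oplus>\<^bsub>M\<^esub>k\<in>{k. c k \<noteq> \<zero>\<^bsub>M\<^esub>}. c k)"
    unfolding assms(4) by (rule finsum_superset[OF assms(2) sub cl, symmetric])
  ultimately show ?thesis unfolding homog_def
    using assms(1) finite_subset[OF sub assms(2)] by (intro the1_equality direct_sum) auto
qed

lemma homog_component:
  assumes "x \<in> component M j"
  shows "homog x k = (if k = j then x else \<zero>\<^bsub>M\<^esub>)"
proof -
  have x: "x \<in> carrier M" using assms component_simps(1) by blast
  have "homog x = (\<lambda>k. if k = j then x else \<zero>\<^bsub>M\<^esub>)"
  proof (rule homog_unique)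
    show "x = (\<Oplus>\<^bsub>M\<^esub>k\<in>{j}. if k = j then x else \<zero>\<^bsub>M\<^esub>)" using x by simp
  qed (use assms component_simps(3) in auto)
  then show ?thesis by simp
qed

lemma homog_zero: "homog \<zero>\<^bsub>M\<^esub> k = \<zero>\<^bsub>M\<^esub>"
  using homog_component[OF component_simps(3)] by simp

lemma homog_add:
  assumes "x \<in> carrier M" "y \<in> carrier M"
  shows "homog (x \<oplus>\<^bsub>M\<^esub> y) k = homog x k \<oplus>\<^bsub>M\<^esub> homog y k"
proof -
  let ?S = "{k. homog x k \<noteq> \<zero>\<^bsub>M\<^esub>} \<union> {k. homog y k \<noteq> \<zero>\<^bsub>M\<^esub>}"
  have fin: "finite ?S" using homogD(2) assms by auto
  have cl: "homog x k \<in> carrier M" "homog y k \<in> carrier M" for k using homog_closed assms by auto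
  have "homog (x \<oplus>\<^bsub>M\<^esub> y) = (\<lambda>k. homog x k \<oplus>\<^bsub>M\<^esub> homog y k)"
  proof (rule homog_unique)
    show "homog x k \<oplus>\<^bsub>M\<^esub> homog y k \<in> component M k" for k
      using homogD(1) assms by (intro component_simps(2)) auto
    show "finite ?S" by (rule fin)
    show "homog x k \<oplus>\<^bsub>M\<^esub> homog y k = \<zero>\<^bsub>M\<^esub>" if "k \<notin> ?S" for k using that by simp
    have X0: "x = (\<Oplus>\<^bsub>M\<^esub>k\<in>?S. homog x k)"
      by (rule trans[OF homogD(3)[OF assms(1)] finsum_superset[OF fin _ cl(1)]]) blast
    have Y0: "y = (\<Oplus>\<^bsub>M\<^esub>k\<in>?S. homog y k)"
      by (rule trans[OF homogD(3)[OF assms(2)] finsum_superset[OF fin _ cl(2)]]) blast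
    have XY: "(\<Oplus>\<^bsub>M\<^esub>k\<in>?S. homog x k \<oplus>\<^bsub>M\<^esub> homog y k) = (\<Oplus>\<^bsub>M\<^esub>k\<in>?S. homog x k) \<oplus>\<^bsub>M\<^esub> (\<Oplus>\<^bsub>M\<^esub>k\<in>?S. homog y k)"
      using cl by (intro M.finsum_addf) auto
    show "x \<oplus>\<^bsub>M\<^esub> y = (\<Oplus>\<^bsub>M\<^esub>k\<in>?S. homog x k \<oplus>\<^bsub>M\<^esub> homog y k)"
      by (simp only: XY X0[symmetric] Y0[symmetric])
  qed
  then show ?thesis by simp
qed

lemma homog_smult:
  assumes "f \<in> homogeneous_part i" "x \<in> carrier M"
  shows "homog (f \<odot>\<^bsub>M\<^esub> x) k = f \<odot>\<^bsub>M\<^esub> homog x (k - i)"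
proof -
  let ?S = "{k. homog x k \<noteq> \<zero>\<^bsub>M\<^esub>}"
  have cl: "homog x k \<in> carrier M" for k using homog_closed assms by auto
  have "homog (f \<odot>\<^bsub>M\<^esub> x) = (\<lambda>k. f \<odot>\<^bsub>M\<^esub> homog x (k - i))"
  proof (rule homog_unique)
    show "f \<odot>\<^bsub>M\<^esub> homog x (k - i) \<in> component M k" for k
      using smult_component[OF assms(1) homogD(1)[OF assms(2), of "k - i"]] by simp
    show "finite ((\<lambda>k. k + i) ` ?S)" using homogD(2)[OF assms(2)] by simp
    show "f \<odot>\<^bsub>M\<^esub> homog x (k - i) = \<zero>\<^bsub>M\<^esub>" if "k \<notin> (\<lambda>k. k + i) ` ?S" for k
    proof -
      have "homog x (k - i) = \<zero>\<^bsub>M\<^esub>" using that by (auto simp: image_iff dest: spec[of _ "k - i"])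
      then show ?thesis by simp
    qed
    have "(\<Oplus>\<^bsub>M\<^esub>k\<in>(\<lambda>k. k + i) ` ?S. f \<odot>\<^bsub>M\<^esub> homog x (k - i)) = (\<Oplus>\<^bsub>M\<^esub>k\<in>?S. f \<odot>\<^bsub>M\<^esub> homog x (k + i - i))"
      using cl by (intro M.finsum_reindex) (auto simp: inj_on_def)
    also have "\<dots> = f \<odot>\<^bsub>M\<^esub> (\<Oplus>\<^bsub>M\<^esub>k\<in>?S. homog x k)" using cl by (simp add: smult_finsum)
    finally show "f \<odot>\<^bsub>M\<^esub> x = (\<Oplus>\<^bsub>M\<^esub>k\<in>(\<lambda>k. k + i) ` ?S. f \<odot>\<^bsub>M\<^esub> homog x (k - i))"
      by (simp only: homogD(3)[OF assms(2), symmetric])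
  qed
  then show ?thesis by simp
qed

lemma homog_finsum:
  "(\<And>i. i \<in> I \<Longrightarrow> g i \<in> carrier M) \<Longrightarrow> homog (\<Oplus>\<^bsub>M\<^esub>i\<in>I. g i) k = (\<Oplus>\<^bsub>M\<^esub>i\<in>I. homog (g i) k)"
proof (induction I rule: infinite_finite_induct)
  case (insert i I)
  have "homog (\<Oplus>\<^bsub>M\<^esub>i\<in>insert i I. g i) k = homog (g i \<oplus>\<^bsub>M\<^esub> (\<Oplus>\<^bsub>M\<^esub>i\<in>I. g i)) k"
    using insert by (subst M.finsum_insert) auto
  also have "\<dots> = homog (g i) k \<oplus>\<^bsub>M\<^esub> (\<Oplus>\<^bsub>M\<^esub>i\<in>I. homog (g i) k)"
    using insert by (subst homog_add) auto
  also have "\<dots> = (\<Oplus>\<^bsub>M\<^esub>i\<in>insert i I. homog (g i) k)"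
    using insert by (intro M.finsum_insert[symmetric]) (auto intro: homog_closed)
  finally show ?case .
qed (auto simp: homog_zero)

definition kspan :: "'b set \<Rightarrow> 'b set" where
  "kspan S = {comb S (\<lambda>b. const (h b)) | h. True}"

lemma kspan_simps:
  assumes "finite S" "S \<subseteq> carrier M"
  shows "\<zero>\<^bsub>M\<^esub> \<in> kspan S" "x \<in> kspan S \<Longrightarrow> x \<in> carrier M"
    "x \<in> kspan S \<Longrightarrow> y \<in> kspan S \<Longrightarrow> x \<oplus>\<^bsub>M\<^esub> y \<in> kspan S"
    "b \<in> S \<Longrightarrow> const a \<odot>\<^bsub>M\<^esub> b \<in> kspan S"
proof -
  have I: "comb S (\<lambda>b. const (h b)) \<in> kspan S" for h by (auto simp: kspan_def)
  show "\<zero>\<^bsub>M\<^esub> \<in> kspan S" using I[of "\<lambda>_. 0"] comb_zero[OF assms(2)] by (simp add: const_simps)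
  show "x \<in> carrier M" if "x \<in> kspan S" using that comb_closed[OF assms(2)] by (auto simp: kspan_def)
  show "x \<oplus>\<^bsub>M\<^esub> y \<in> kspan S" if xy: "x \<in> kspan S" "y \<in> kspan S"
  proof -
    obtain g h where "x = comb S (\<lambda>b. const (g b))" "y = comb S (\<lambda>b. const (h b))"
      using xy by (auto simp: kspan_def)
    then have "x \<oplus>\<^bsub>M\<^esub> y = comb S (\<lambda>b. const (g b + h b))"
      using comb_add[OF assms(2)] by (simp add: const_simps)
    then show ?thesis using I by simp
  qed
  show "const a \<odot>\<^bsub>M\<^esub> b \<in> kspan S" if b: "b \<in> S"
  proof -
    have "comb S (\<lambda>x. const (if x = b then a else 0)) = comb S (\<lambda>x. if x = b then const a else 0)"
      by (intro comb_cong[OF assms(2)]) (simp add: const_simps)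
    then show ?thesis using I[of "\<lambda>x. if x = b then a else 0"] comb_single[OF assms b, of "const a"] by simp
  qed
qed

lemma kspan_finsum:
  assumes "finite S" "S \<subseteq> carrier M" "\<And>i. i \<in> I \<Longrightarrow> g i \<in> kspan S"
  shows "(\<Oplus>\<^bsub>M\<^esub>i\<in>I. g i) \<in> kspan S"
  using assms(3)
proof (induction I rule: infinite_finite_induct)
  case (insert i I)
  note K = kspan_simps[OF assms(1,2)]
  have "(\<Oplus>\<^bsub>M\<^esub>i\<in>insert i I. g i) = g i \<oplus>\<^bsub>M\<^esub> (\<Oplus>\<^bsub>M\<^esub>i\<in>I. g i)"
    using insert K(2) by (intro M.finsum_insert) auto
  also have "\<dots> \<in> kspan S" using insert by (intro K(3)) auto
  finally show ?case .
qed (auto simp: kspan_simps[OF assms(1,2)])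

text \<open>Degree \<open>k\<close> is spanned by the products of monomials with homogeneous
  components of the generators. There are finitely many of them, and none below the lowest degree of
  such a component.\<close>

lemma component_finite_span:
  obtains k0 S where "\<And>k. finite (S k)" "\<And>k. S k \<subseteq> component M k" "\<And>k. component M k \<subseteq> kspan (S k)"
    "\<And>k. k < k0 \<Longrightarrow> S k = {}"
proof -
  obtain A where A: "finite A" "A \<subseteq> carrier M"
    "\<And>x. x \<in> carrier M \<Longrightarrow> \<exists>f. x = (\<Oplus>\<^bsub>M\<^esub>a\<in>A. f a \<odot>\<^bsub>M\<^esub> a)"
    using finitely_generated by blast
  define T where "T = (\<Union>a\<in>A. {j. homog a j \<noteq> \<zero>\<^bsub>M\<^esub>})"
  have fT: "finite T" unfolding T_def using A homogD(2) by auto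
  define S where "S k = (\<Union>a\<in>A. \<Union>j\<in>{j. homog a j \<noteq> \<zero>\<^bsub>M\<^esub>}.
    (\<lambda>e. Poly_Mapping.single e 1 \<odot>\<^bsub>M\<^esub> homog a j) ` {e :: 'n \<Rightarrow>\<^sub>0 nat. int (monom_degree e) = k - j})" for k
  have single_homog: "Poly_Mapping.single e c \<in> homogeneous_part (int (monom_degree e))"
    for e :: "'n \<Rightarrow>\<^sub>0 nat" and c :: 'k
    by (auto simp: homogeneous_part_def)
  have fin: "finite (S k)" for k
  proof -
    have "finite {e :: 'n \<Rightarrow>\<^sub>0 nat. int (monom_degree e) = k - j}" for j
      by (rule finite_subset[OF _ finite_monom_degree[of "nat (k - j)"]]) auto
    then show ?thesis unfolding S_def using A homogD(2) by (intro finite_UN_I finite_imageI) auto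
  qed
  have sub: "S k \<subseteq> component M k" for k
  proof
    fix x assume "x \<in> S k"
    then obtain a j and e :: "'n \<Rightarrow>\<^sub>0 nat" where x: "a \<in> A" "int (monom_degree e) = k - j"
        "x = Poly_Mapping.single e 1 \<odot>\<^bsub>M\<^esub> homog a j"
      unfolding S_def by auto
    have "a \<in> carrier M" using x(1) A by auto
    from smult_component[OF single_homog homogD(1)[OF this], of e 1 j]
    show "x \<in> component M k" using x by simp
  qed
  have subc: "S k \<subseteq> carrier M" for k using sub component_simps(1) by blast
  note K = kspan_simps[OF fin subc]
  have span: "component M k \<subseteq> kspan (S k)" for k
  proof
    fix x assume x: "x \<in> component M k"
    then obtain f where f: "x = (\<Oplus>\<^bsub>M\<^esub>a\<in>A. f a \<odot>\<^bsub>M\<^esub> a)" using A(3) component_simps(1) by blast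
    have mon: "homog (Poly_Mapping.single e c \<odot>\<^bsub>M\<^esub> a) k \<in> kspan (S k)" if a: "a \<in> A" for e c a
    proof -
      let ?j = "k - int (monom_degree e)"
      have ac: "a \<in> carrier M" using a A by auto
      have eq: "homog (Poly_Mapping.single e c \<odot>\<^bsub>M\<^esub> a) k = Poly_Mapping.single e c \<odot>\<^bsub>M\<^esub> homog a ?j"
        by (rule homog_smult[OF single_homog ac])
      show ?thesis
      proof (cases "homog a ?j = \<zero>\<^bsub>M\<^esub>")
        case True
        then show ?thesis unfolding eq using K(1) by simp
      next
        case False
        have "Poly_Mapping.single e c = const c * Poly_Mapping.single e 1"
          by (simp add: const_def mult_single)
        then have "Poly_Mapping.single e c \<odot>\<^bsub>M\<^esub> homog a ?j = const c \<odot>\<^bsub>M\<^esub> (Poly_Mapping.single e 1 \<odot>\<^bsub>M\<^esub> homog a ?j)"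
          using homog_closed[OF ac] by (simp add: smult_distrib(3))
        moreover have "Poly_Mapping.single e 1 \<odot>\<^bsub>M\<^esub> homog a ?j \<in> S k"
          unfolding S_def using a False by (intro UN_I[of a] UN_I[of ?j] imageI) auto
        ultimately show ?thesis unfolding eq using K(4) by simp
      qed
    qed
    have "homog (f a \<odot>\<^bsub>M\<^esub> a) k \<in> kspan (S k)" if a: "a \<in> A" for a
    proof -
      have ac: "a \<in> carrier M" using a A by auto
      have "f a \<odot>\<^bsub>M\<^esub> a = (\<Oplus>\<^bsub>M\<^esub>e\<in>Poly_Mapping.keys (f a). Poly_Mapping.single e (Poly_Mapping.lookup (f a) e) \<odot>\<^bsub>M\<^esub> a)"
        using smult_sum[OF ac, of "\<lambda>e. Poly_Mapping.single e (Poly_Mapping.lookup (f a) e)" "Poly_Mapping.keys (f a)"]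
          poly_mapping_sum_single[of "f a"] by simp
      then show ?thesis using mon[OF a] ac
        by (simp only: homog_finsum smult_simps) (intro kspan_finsum[OF fin subc])
    qed
    then have "(\<Oplus>\<^bsub>M\<^esub>a\<in>A. homog (f a \<odot>\<^bsub>M\<^esub> a) k) \<in> kspan (S k)"
      by (rule kspan_finsum[OF fin subc])
    moreover have "homog x k = (\<Oplus>\<^bsub>M\<^esub>a\<in>A. homog (f a \<odot>\<^bsub>M\<^esub> a) k)"
      unfolding f using A(2) by (intro homog_finsum) auto
    ultimately show "x \<in> kspan (S k)" using homog_component[OF x, of k] by simp
  qed
  \<comment> \<open>The inserted \<open>0\<close> keeps \<open>Min\<close> defined when all
    generators vanish and \<open>T\<close> is empty.\<close>
  have low: "S k = {}" if "k < Min (insert 0 T)" for k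
  proof (rule ccontr)
    assume "S k \<noteq> {}"
    then obtain a j and e :: "'n \<Rightarrow>\<^sub>0 nat" where "a \<in> A" "homog a j \<noteq> \<zero>\<^bsub>M\<^esub>" "int (monom_degree e) = k - j"
      unfolding S_def by blast
    then have "j \<in> T" "j \<le> k" by (auto simp: T_def)
    then show False using that fT Min_le[of "insert 0 T" j] by auto
  qed
  show ?thesis by (rule that[OF fin sub span low])
qed

lemma component_basis_obtain:
  obtains B where "component_basis M k B"
proof -
  obtain k0 S where S: "\<And>k. finite (S k)" "\<And>k. S k \<subseteq> component M k" "\<And>k. component M k \<subseteq> kspan (S k)"
    "\<And>k. k < k0 \<Longrightarrow> S k = {}" by (rule component_finite_span) blast
  show ?thesis
  proof (rule component_basis_exists[OF S(1,2)])
    show "\<exists>h. x = comb (S k) (\<lambda>b. const (h b))" if "x \<in> component M k" for x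
      using S(3)[of k] that by (auto simp: kspan_def)
  qed (rule that)
qed

lemma component_basis_empty_iff:
  "component_basis M k {} \<longleftrightarrow> component M k = {\<zero>\<^bsub>M\<^esub>}"
  using component_simps(3)[of k] by (auto simp: component_basis_iff comb_def)

lemma hilbert_function_eq_0_iff: "hilbert_function M k = 0 \<longleftrightarrow> component M k = {\<zero>\<^bsub>M\<^esub>}"
proof -
  obtain B where B: "component_basis M k B" using component_basis_obtain .
  show ?thesis
  proof
    assume "hilbert_function M k = 0"
    then have "B = {}" using hilbert_function_eq[OF B] component_basisD(1)[OF B] by simp
    then show "component M k = {\<zero>\<^bsub>M\<^esub>}" using B component_basis_empty_iff by simp
  next
    assume "component M k = {\<zero>\<^bsub>M\<^esub>}"
    then show "hilbert_function M k = 0"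
      using hilbert_function_eq component_basis_empty_iff by fastforce
  qed
qed

text \<open>The lower bound on degrees makes the argument of \<open>Abs_fls\<close> admissible, so
  equal Hilbert series mean equal Hilbert functions.\<close>

lemma hilbert_series_nth: "fls_nth (hilbert_series M) k = int (hilbert_function M k)"
proof -
  obtain k0 S where S: "\<And>k. component M k \<subseteq> kspan (S k)" "\<And>k. k < k0 \<Longrightarrow> S k = {}"
    by (rule component_finite_span) blast
  have "hilbert_function M k = 0" if "k < k0" for k
  proof -
    have "component M k \<subseteq> {\<zero>\<^bsub>M\<^esub>}" using S(1)[of k] S(2)[OF that] by (simp add: kspan_def comb_def)
    then show ?thesis using component_simps(3)[of k] hilbert_function_eq_0_iff by blast
  qed
  then show ?thesis unfolding hilbert_series_def
    by (intro nth_Abs_fls_ex_lower_bound) auto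
qed

end

section \<open>Multiples of a module by a sequence\<close>

context poly_module
begin

lemma seq_times_Nil: "seq_times [] M = {\<zero>\<^bsub>M\<^esub>}"
  by (auto simp: seq_times_def)

text \<open>This form matches one step of \<open>adjoin\<close> and permits induction from the right
  end of the sequence.\<close>

lemma seq_times_snoc:
  "seq_times (gs @ [f]) M = {s \<oplus>\<^bsub>M\<^esub> f \<odot>\<^bsub>M\<^esub> y | s y. s \<in> seq_times gs M \<and> y \<in> carrier M}"
proof -
  let ?n = "length gs"
  have split: "(\<Oplus>\<^bsub>M\<^esub>i\<in>{..<length (gs @ [f])}. ((gs @ [f]) ! i) \<odot>\<^bsub>M\<^esub> y i) =
      (\<Oplus>\<^bsub>M\<^esub>i\<in>{..<?n}. (gs ! i) \<odot>\<^bsub>M\<^esub> y i) \<oplus>\<^bsub>M\<^esub> f \<odot>\<^bsub>M\<^esub> y ?n"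
    if y: "y \<in> {..<length (gs @ [f])} \<rightarrow> carrier M" for y
  proof -
    have "(\<Oplus>\<^bsub>M\<^esub>i\<in>insert ?n {..<?n}. ((gs @ [f]) ! i) \<odot>\<^bsub>M\<^esub> y i) =
        ((gs @ [f]) ! ?n) \<odot>\<^bsub>M\<^esub> y ?n \<oplus>\<^bsub>M\<^esub> (\<Oplus>\<^bsub>M\<^esub>i\<in>{..<?n}. ((gs @ [f]) ! i) \<odot>\<^bsub>M\<^esub> y i)"
      using y by (intro M.finsum_insert) (auto simp: Pi_iff)
    also have "(\<Oplus>\<^bsub>M\<^esub>i\<in>{..<?n}. ((gs @ [f]) ! i) \<odot>\<^bsub>M\<^esub> y i) = (\<Oplus>\<^bsub>M\<^esub>i\<in>{..<?n}. (gs ! i) \<odot>\<^bsub>M\<^esub> y i)"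
      using y by (intro M.finsum_cong') (auto simp: Pi_iff nth_append)
    also have "((gs @ [f]) ! ?n) \<odot>\<^bsub>M\<^esub> y ?n \<oplus>\<^bsub>M\<^esub> (\<Oplus>\<^bsub>M\<^esub>i\<in>{..<?n}. (gs ! i) \<odot>\<^bsub>M\<^esub> y i)
        = (\<Oplus>\<^bsub>M\<^esub>i\<in>{..<?n}. (gs ! i) \<odot>\<^bsub>M\<^esub> y i) \<oplus>\<^bsub>M\<^esub> ((gs @ [f]) ! ?n) \<odot>\<^bsub>M\<^esub> y ?n"
      using y by (intro M.a_comm M.finsum_closed) (auto simp: Pi_iff)
    finally show ?thesis by (simp add: lessThan_Suc)
  qed
  show ?thesis
  proof (intro equalityI subsetI)
    fix z assume "z \<in> seq_times (gs @ [f]) M"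
    then obtain y where y: "y \<in> {..<length (gs @ [f])} \<rightarrow> carrier M"
      "z = (\<Oplus>\<^bsub>M\<^esub>i\<in>{..<length (gs @ [f])}. ((gs @ [f]) ! i) \<odot>\<^bsub>M\<^esub> y i)"
      unfolding seq_times_def by blast
    have "(\<Oplus>\<^bsub>M\<^esub>i\<in>{..<?n}. (gs ! i) \<odot>\<^bsub>M\<^esub> y i) \<in> seq_times gs M" "y ?n \<in> carrier M"
      using y(1) unfolding seq_times_def by (auto simp: Pi_iff)
    then show "z \<in> {s \<oplus>\<^bsub>M\<^esub> f \<odot>\<^bsub>M\<^esub> y | s y. s \<in> seq_times gs M \<and> y \<in> carrier M}"
      using y(2) split[OF y(1)] by blast
  next
    fix z assume "z \<in> {s \<oplus>\<^bsub>M\<^esub> f \<odot>\<^bsub>M\<^esub> y | s y. s \<in> seq_times gs M \<and> y \<in> carrier M}"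
    then obtain s v where s: "z = s \<oplus>\<^bsub>M\<^esub> f \<odot>\<^bsub>M\<^esub> v" "s \<in> seq_times gs M" "v \<in> carrier M" by blast
    then obtain y where y: "y \<in> {..<?n} \<rightarrow> carrier M" "s = (\<Oplus>\<^bsub>M\<^esub>i\<in>{..<?n}. (gs ! i) \<odot>\<^bsub>M\<^esub> y i)"
      unfolding seq_times_def by blast
    define y' where "y' = y(?n := v)"
    have y': "y' \<in> {..<length (gs @ [f])} \<rightarrow> carrier M" using y(1) s(3) by (auto simp: y'_def Pi_iff)
    have "(\<Oplus>\<^bsub>M\<^esub>i\<in>{..<?n}. (gs ! i) \<odot>\<^bsub>M\<^esub> y' i) = s"
      unfolding y(2) using y(1) by (intro M.finsum_cong') (auto simp: y'_def Pi_iff)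
    moreover have "y' ?n = v" by (simp add: y'_def)
    ultimately have "z = (\<Oplus>\<^bsub>M\<^esub>i\<in>{..<length (gs @ [f])}. ((gs @ [f]) ! i) \<odot>\<^bsub>M\<^esub> y' i)"
      unfolding split[OF y'] s(1) by (simp only:)
    then show "z \<in> seq_times (gs @ [f]) M" unfolding seq_times_def using y' by blast
  qed
qed

end

section \<open>Growth of the Hilbert function along a regular sequence\<close>

context fg_graded_module
begin

text \<open>The module is presented as the quotient of a free module, whose elements are the coefficient
  functions on a generating set \<open>A\<close>.\<close>

theorem regular_sequence_growth:
  assumes fs: "set fs \<subseteq> irrelevant_ideal" "regular_sequence fs M"
    and low: "component M (k - 1) = {\<zero>\<^bsub>M\<^esub>}"
  shows "length fs * hilbert_function M k \<le> hilbert_function M (k + 1)"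
proof -
  obtain A where A: "finite A" "A \<subseteq> carrier M"
    "\<And>x. x \<in> carrier M \<Longrightarrow> \<exists>f. x = (\<Oplus>\<^bsub>M\<^esub>a\<in>A. f a \<odot>\<^bsub>M\<^esub> a)"
    using finitely_generated by blast
  obtain B where B: "component_basis M k B" by (rule component_basis_obtain)
  obtain C where C: "component_basis M (k + 1) C" by (rule component_basis_obtain)
  note B' = component_basisD[OF B] and C' = component_basisD[OF C]
  obtain x where x: "bij_betw x {..<CARD('n)} (UNIV :: 'n set)"
    using ex_bij_betw_nat_finite[of "UNIV :: 'n set"] by (auto simp: atLeast0LessThan)
  \<comment> \<open>\<open>generic_forms\<close> acts on a whole type, while \<open>M\<close> lives
    on a carrier set. The functions \<open>'b \<Rightarrow> ('n, 'k) mpoly\<close> form such a type,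
    and \<open>comb A\<close> maps them onto \<open>M\<close>.\<close>
  define scale where "scale f v = (\<lambda>a. f * v a)" for f and v :: "'b \<Rightarrow> ('n, 'k) mpoly"
  interpret G: generic_forms scale "\<lambda>i. var (x i)" "CARD('n)"
    by unfold_locales (auto simp: scale_def fun_eq_iff algebra_simps)
  note cA = comb_closed[OF A(2)]
  have comb_plus: "comb A (v + w) = comb A v \<oplus>\<^bsub>M\<^esub> comb A w" for v w
    using comb_add[OF A(2), of v w] by (simp add: plus_fun_def)
  have comb_minus: "comb A (v - w) = comb A v \<ominus>\<^bsub>M\<^esub> comb A w" for v w
    using comb_diff[OF A(2), of v w] by (simp add: fun_diff_def)
  have comb_scale: "comb A (scale f v) = f \<odot>\<^bsub>M\<^esub> comb A v" for f v
    unfolding scale_def by (rule comb_smult[OF A(2)])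
  have comb_sum_scale: "comb A (\<Sum>i\<in>I. scale (f i) (v i)) = (\<Oplus>\<^bsub>M\<^esub>i\<in>I. f i \<odot>\<^bsub>M\<^esub> comb A (v i))"
    for I :: "'z set" and f v
  proof -
    have "(\<Sum>i\<in>I. scale (f i) (v i)) = (\<lambda>a. \<Sum>i\<in>I. f i * v i a)"
      by (rule ext) (simp add: sum_fun_apply scale_def)
    then have "comb A (\<Sum>i\<in>I. scale (f i) (v i)) = (\<Oplus>\<^bsub>M\<^esub>i\<in>I. comb A (\<lambda>a. f i * v i a))"
      by (simp only: comb_sum[OF A(2)])
    then show ?thesis by (simp only: comb_smult[OF A(2)])
  qed
  have "\<forall>y\<in>carrier M. \<exists>v. comb A v = y" using A(3) by (auto simp: comb_def)
  from bchoice[OF this] obtain lift where lift: "\<forall>y\<in>carrier M. comb A (lift y) = y" ..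
  \<comment> \<open>The preimage in the free module of the multiples of \<open>M\<close> by the
    first \<open>i\<close> elements; \<open>V 0\<close> is the module of relations.\<close>
  define V where "V i = {v. comb A v \<in> seq_times (take i fs) M}" for i
  have V0: "V 0 = {v. comb A v = \<zero>\<^bsub>M\<^esub>}" by (simp add: V_def seq_times_Nil)
  have adjoin: "adjoin UNIV (scale (fs ! i)) (V i) = V (Suc i)" if il: "i < length fs" for i
  proof (intro equalityI subsetI)
    fix v assume "v \<in> adjoin UNIV (scale (fs ! i)) (V i)"
    then obtain q w where v: "v = q + scale (fs ! i) w" "q \<in> V i" by (auto simp: adjoin_def)
    then have "comb A v = comb A q \<oplus>\<^bsub>M\<^esub> (fs ! i) \<odot>\<^bsub>M\<^esub> comb A w" by (simp only: comb_plus comb_scale)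
    then show "v \<in> V (Suc i)"
      using v(2) cA[of w] unfolding V_def take_Suc_conv_app_nth[OF il] seq_times_snoc by blast
  next
    fix v assume "v \<in> V (Suc i)"
    then obtain s y where s: "comb A v = s \<oplus>\<^bsub>M\<^esub> (fs ! i) \<odot>\<^bsub>M\<^esub> y" "s \<in> seq_times (take i fs) M" "y \<in> carrier M"
      unfolding V_def take_Suc_conv_app_nth[OF il] seq_times_snoc by blast
    have sc: "s \<in> carrier M" using s(2) unfolding seq_times_def
      by (auto intro!: M.finsum_closed simp: Pi_iff)
    have "comb A (v - scale (fs ! i) (lift y)) = s"
      using s(1,3) sc lift
      by (simp add: comb_minus comb_scale a_minus_def M.a_assoc M.r_neg)
    then have "v - scale (fs ! i) (lift y) \<in> V i" using s(2) by (simp add: V_def)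
    from adjoinI[OF this UNIV_I, where f = "scale (fs ! i)"]
    show "v \<in> adjoin UNIV (scale (fs ! i)) (V i)" using diff_add_cancel by metis
  qed
  have R: "\<forall>i<length fs. \<forall>x\<in>carrier M. (fs ! i) \<odot>\<^bsub>M\<^esub> x \<in> seq_times (take i fs) M \<longrightarrow> x \<in> seq_times (take i fs) M"
    using fs(2) unfolding regular_sequence_def by (rule conjunct1)
  have regular: "weakly_regular UNIV (map scale (drop i fs)) (V i)" if "i \<le> length fs" for i
    using that
  proof (induction rule: inc_induct)
    case (step i)
    have "v \<in> V i" if v: "scale (fs ! i) v \<in> V i" for v
    proof -
      have "(fs ! i) \<odot>\<^bsub>M\<^esub> comb A v \<in> seq_times (take i fs) M" using v by (simp only: V_def mem_Collect_eq comb_scale)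
      then show ?thesis using R[rule_format, OF \<open>i < length fs\<close> cA] by (simp only: V_def mem_Collect_eq)
    qed
    then show ?case
      using step.IH unfolding Cons_nth_drop_Suc[OF \<open>i < length fs\<close>, symmetric] list.map weakly_regular.simps
        adjoin[OF \<open>i < length fs\<close>] by (intro conjI ballI impI)
  qed simp
  have "length fs * card B \<le> card C"
  proof (rule G.dimension_growth[where const = const and v = lift and w = lift])
    show "const (0 :: 'k) = 0" "const (a + b) = const a + const b" "const (a * b) = const a * const b" for a b :: 'k
      by (rule const_simps)+
    show "0 \<in> V 0" using comb_zero[OF A(2)] by (simp add: V0 zero_fun_def)
    show "u + v \<in> V 0" if "u \<in> V 0" "v \<in> V 0" for u v using that by (simp add: V0 comb_plus)
    show "scale f u \<in> V 0" if "u \<in> V 0" for f u using that by (simp add: V0 comb_scale)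
    show "\<exists>g. f = (\<Sum>i<CARD('n). g i * var (x i))" if "f \<in> set fs" for f
      using irrelevant_ideal_combination[OF _ x] that fs(1) by blast
    show "weakly_regular UNIV (map scale fs) (V 0)" using regular[of 0] by simp
    show "finite B" "finite C" by (rule B'(1), rule C'(1))
  next
    fix c u y b
    assume eq: "(\<Sum>b\<in>B. scale (const (c b)) (lift b)) = u + (\<Sum>i<CARD('n). scale (var (x i)) (y i))"
      and u: "u \<in> V 0" and b: "b \<in> B"
    have "comb B (\<lambda>b. const (c b)) = (\<Oplus>\<^bsub>M\<^esub>b\<in>B. const (c b) \<odot>\<^bsub>M\<^esub> comb A (lift b))"
      unfolding comb_def[of B] using lift B'(2) by (intro M.finsum_cong') (auto simp: subset_iff)
    also have "\<dots> = comb A (\<Sum>b\<in>B. scale (const (c b)) (lift b))" by (rule comb_sum_scale[symmetric])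
    also have "\<dots> = (\<Oplus>\<^bsub>M\<^esub>i\<in>{..<CARD('n)}. var (x i) \<odot>\<^bsub>M\<^esub> comb A (y i))"
      unfolding eq comb_plus comb_sum_scale using u cA by (simp add: V0)
    finally have e: "comb B (\<lambda>b. const (c b)) = (\<Oplus>\<^bsub>M\<^esub>i\<in>{..<CARD('n)}. var (x i) \<odot>\<^bsub>M\<^esub> comb A (y i))" .
    have "comb B (\<lambda>b. const (c b)) \<in> component M k"
      unfolding comb_def using B by (intro finsum_component const_component) (auto simp: component_basis_def)
    then have "comb B (\<lambda>b. const (c b)) = homog (comb B (\<lambda>b. const (c b))) k"
      by (simp add: homog_component)
    also have "\<dots> = (\<Oplus>\<^bsub>M\<^esub>i\<in>{..<CARD('n)}. homog (var (x i) \<odot>\<^bsub>M\<^esub> comb A (y i)) k)"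
      unfolding e using cA by (intro homog_finsum) simp
    \<comment> \<open>The part of degree \<open>k\<close> of a variable times an element comes from
      degree \<open>k - 1\<close>, where \<open>M\<close> vanishes.\<close>
    also have "\<dots> = (\<Oplus>\<^bsub>M\<^esub>i\<in>{..<CARD('n)}. \<zero>\<^bsub>M\<^esub>)"
    proof (intro M.finsum_cong')
      fix i
      have "homog (comb A (y i)) (k - 1) = \<zero>\<^bsub>M\<^esub>" using homogD(1)[OF cA, of "y i" "k - 1"] low by simp
      then show "homog (var (x i) \<odot>\<^bsub>M\<^esub> comb A (y i)) k = \<zero>\<^bsub>M\<^esub>"
        by (simp add: homog_smult[OF var_homogeneous cA])
    qed auto
    finally show "c b = 0" using b by (intro B'(4)) auto
  next
    fix i b assume b: "b \<in> B"
    then have "b \<in> component M k" using B by (auto simp: component_basis_def)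
    then have "var (x i) \<odot>\<^bsub>M\<^esub> b \<in> component M (k + 1)"
      using smult_component[OF var_homogeneous, of b k "x i"] by (simp add: add.commute)
    then obtain c where c: "var (x i) \<odot>\<^bsub>M\<^esub> b = comb C (\<lambda>b. const (c b))" using C'(3) by blast
    have "comb A (\<Sum>j\<in>C. scale (const (c j)) (lift j)) = comb C (\<lambda>b. const (c b))"
      unfolding comb_sum_scale comb_def[of C] using lift C'(2)
      by (intro M.finsum_cong') (auto simp: subset_iff)
    then have "comb A (scale (var (x i)) (lift b) - (\<Sum>j\<in>C. scale (const (c j)) (lift j))) = \<zero>\<^bsub>M\<^esub>"
      using lift b B'(2) c comb_closed[OF C'(2)] by (simp add: comb_minus comb_scale a_minus_def M.r_neg subset_iff)
    then show "\<exists>c. scale (var (x i)) (lift b) - (\<Sum>j\<in>C. scale (const (c j)) (lift j)) \<in> V 0"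
      unfolding V0 by blast
  qed
  then show ?thesis using hilbert_function_eq[OF B] hilbert_function_eq[OF C] by simp
qed

end

context poly_module
begin

text \<open>Lets a basis be indexed by exponent vectors, or by pairs of a summand and an exponent
  vector, instead of being given as a set of module elements; independence already forces
  \<open>b\<close> to be injective.\<close>

lemma hilbert_function_index:
  assumes fin: "finite E" and comp: "\<And>i. i \<in> E \<Longrightarrow> b i \<in> component M k"
    and span: "\<And>x. x \<in> component M k \<Longrightarrow> \<exists>t. x = (\<Oplus>\<^bsub>M\<^esub>i\<in>E. const (t i) \<odot>\<^bsub>M\<^esub> b i)"
    and indep: "\<And>t u i. (\<Oplus>\<^bsub>M\<^esub>i\<in>E. const (t i) \<odot>\<^bsub>M\<^esub> b i) = (\<Oplus>\<^bsub>M\<^esub>i\<in>E. const (u i) \<odot>\<^bsub>M\<^esub> b i) \<Longrightarrow> i \<in> E \<Longrightarrow> t i = u i"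
  shows "hilbert_function M k = card E"
proof -
  have bc: "b i \<in> carrier M" if "i \<in> E" for i using comp[OF that] component_simps(1) by blast
  have delta: "(\<Oplus>\<^bsub>M\<^esub>j\<in>E. const (if j = i then 1 else 0) \<odot>\<^bsub>M\<^esub> b j) = b i" if "i \<in> E" for i
  proof -
    have "(\<Oplus>\<^bsub>M\<^esub>j\<in>E. const (if j = i then 1 else 0) \<odot>\<^bsub>M\<^esub> b j) = (\<Oplus>\<^bsub>M\<^esub>j\<in>E. if i = j then b j else \<zero>\<^bsub>M\<^esub>)"
      using bc by (intro M.finsum_cong') (auto simp: const_simps)
    also have "\<dots> = b i" using that fin bc by (intro M.add.finprod_singleton) auto
    finally show ?thesis .
  qed
  have inj: "inj_on b E"
  proof (rule inj_onI)
    fix i j assume ij: "i \<in> E" "j \<in> E" "b i = b j"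
    have "(\<Oplus>\<^bsub>M\<^esub>l\<in>E. const (if l = i then 1 else 0) \<odot>\<^bsub>M\<^esub> b l) = (\<Oplus>\<^bsub>M\<^esub>l\<in>E. const (if l = j then 1 else 0) \<odot>\<^bsub>M\<^esub> b l)"
      unfolding delta[OF ij(1)] delta[OF ij(2)] by (rule ij(3))
    from indep[OF this ij(1)] show "i = j" by (simp split: if_splits)
  qed
  have reindex: "comb (b ` E) (\<lambda>x. const (a x)) = (\<Oplus>\<^bsub>M\<^esub>i\<in>E. const (a (b i)) \<odot>\<^bsub>M\<^esub> b i)" for a
    unfolding comb_def using bc inj by (intro M.finsum_reindex) auto
  have "component_basis M k (b ` E)"
    unfolding component_basis_iff
  proof (intro conjI ballI)
    fix x assume "x \<in> component M k"
    from span[OF this] obtain t where t: "x = (\<Oplus>\<^bsub>M\<^esub>i\<in>E. const (t i) \<odot>\<^bsub>M\<^esub> b i)" ..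
    define a where "a = (\<lambda>y\<in>b ` E. t (the_inv_into E b y))"
    have a: "a (b i) = t i" if "i \<in> E" for i using that inj by (simp add: a_def the_inv_into_f_f)
    show "\<exists>!a. a \<in> b ` E \<rightarrow>\<^sub>E UNIV \<and> x = comb (b ` E) (\<lambda>b. const (a b))"
    proof (rule ex1I[of _ a])
      have "x = comb (b ` E) (\<lambda>b. const (a b))"
        unfolding reindex t using a bc by (intro M.finsum_cong') auto
      then show "a \<in> b ` E \<rightarrow>\<^sub>E UNIV \<and> x = comb (b ` E) (\<lambda>b. const (a b))"
        by (simp add: a_def)
      fix a' assume a': "a' \<in> b ` E \<rightarrow>\<^sub>E UNIV \<and> x = comb (b ` E) (\<lambda>b. const (a' b))"
      then have "(\<Oplus>\<^bsub>M\<^esub>i\<in>E. const (a' (b i)) \<odot>\<^bsub>M\<^esub> b i) = (\<Oplus>\<^bsub>M\<^esub>i\<in>E. const (t i) \<odot>\<^bsub>M\<^esub> b i)"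
        unfolding reindex using t by simp
      from indep[OF this] have on: "a' (b i) = a (b i)" if "i \<in> E" for i using that a by simp
      show "a' = a"
      proof (rule extensionalityI[where A = "b ` E"])
        show "a' \<in> extensional (b ` E)" using a' by (simp add: PiE_def)
        show "a \<in> extensional (b ` E)" by (simp add: a_def)
      qed (use on in auto)
    qed
  qed (use fin comp in auto)
  from hilbert_function_eq[OF this] show ?thesis using inj by (simp add: card_image)
qed

end

section \<open>Counting monomials\<close>

text \<open>The number of monomials of degree \<open>d\<close> with a given support of size \<open>j\<close>.\<close>

fun full_count :: "nat \<Rightarrow> nat \<Rightarrow> nat" where
  "full_count 0 d = (if d = 0 then 1 else 0)"
| "full_count (Suc j) d = (\<Sum>i<d. full_count j i)"

lemma full_count_less: "d < j \<Longrightarrow> full_count j d = 0"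
  by (induction j arbitrary: d) auto

lemma full_count_eq: "full_count j j = 1"
  by (induction j) (auto simp: full_count_less)

text \<open>Exactly one of the \<open>j\<close> exponents is 2, the others are 1.\<close>

lemma full_count_Suc: "full_count j (Suc j) = j"
  by (induction j) (auto simp: full_count_less full_count_eq)

lemma keys_add_nat: "Poly_Mapping.keys (e + e') = Poly_Mapping.keys e \<union> Poly_Mapping.keys e'"
  for e e' :: "'a \<Rightarrow>\<^sub>0 nat"
  by (auto simp: in_keys_iff lookup_add)

lemma finite_degree_subset:
  fixes Z :: "('n::finite \<Rightarrow>\<^sub>0 nat) set"
  assumes "\<And>e. e \<in> Z \<Longrightarrow> monom_degree e = d"
  shows "finite Z"
  by (rule finite_subset[OF _ finite_monom_degree[of d]]) (use assms in auto)

lemma card_full_support: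
  fixes A :: "'n::finite set"
  shows "card {e. Poly_Mapping.keys e = A \<and> monom_degree e = d} = full_count (card A) d"
proof -
  have "finite A" by simp
  then show ?thesis
  proof (induction A arbitrary: d rule: finite_induct)
    case empty
    have "{e :: 'n \<Rightarrow>\<^sub>0 nat. Poly_Mapping.keys e = {} \<and> monom_degree e = d} = (if d = 0 then {0} else {})"
      by (auto simp: monom_degree_def)
    then show ?case by simp
  next
    case (insert a A)
    let ?E = "\<lambda>i. {e. Poly_Mapping.keys e = A \<and> monom_degree e = i}"
    define S where "S = (SIGMA i:{..<d}. ?E i)"
    \<comment> \<open>Adjoins the variable \<open>a\<close> with the missing exponent
      \<open>d - i\<close>, which is positive since \<open>i < d\<close>; this matches the recursion
      of \<open>full_count\<close>.\<close>
    define f where "f = (\<lambda>(i, e). e + Poly_Mapping.single a (d - i))"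
    have "inj_on f S"
    proof (rule inj_onI; clarsimp simp: S_def f_def)
      fix e e' :: "'n \<Rightarrow>\<^sub>0 nat"
      assume H: "monom_degree e < d" "monom_degree e' < d" "A = Poly_Mapping.keys e" "Poly_Mapping.keys e' = Poly_Mapping.keys e"
        "e + Poly_Mapping.single a (d - monom_degree e) = e' + Poly_Mapping.single a (d - monom_degree e')"
      have "Poly_Mapping.lookup e a = 0" "Poly_Mapping.lookup e' a = 0"
        using insert.hyps(2) H(3,4) by (auto simp: in_keys_iff)
      moreover have "Poly_Mapping.lookup (e + Poly_Mapping.single a (d - monom_degree e)) a
          = Poly_Mapping.lookup (e' + Poly_Mapping.single a (d - monom_degree e')) a" using H(5) by simp
      ultimately have "d - monom_degree e = d - monom_degree e'" by (simp add: lookup_add)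
      then have "monom_degree e = monom_degree e'" using H(1,2) by linarith
      then show "monom_degree e = monom_degree e' \<and> e = e'" using H(5) by (simp only: add_right_cancel)
    qed
    moreover have "f ` S = {e. Poly_Mapping.keys e = insert a A \<and> monom_degree e = d}"
    proof (intro equalityI subsetI)
      fix e assume "e \<in> {e. Poly_Mapping.keys e = insert a A \<and> monom_degree e = d}"
      then have e: "Poly_Mapping.keys e = insert a A" "monom_degree e = d" by auto
      define l where "l = Poly_Mapping.lookup e a"
      define e' where "e' = e - Poly_Mapping.single a l"
      have split: "e = e' + Poly_Mapping.single a l"
        by (rule poly_mapping_eqI) (auto simp: e'_def l_def lookup_add lookup_minus lookup_single when_def)
      have "l > 0" using e(1) by (auto simp: l_def in_keys_iff)
      have k: "Poly_Mapping.keys e' = A"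
      proof (rule Set.set_eqI)
        fix i
        have "i \<in> Poly_Mapping.keys e \<longleftrightarrow> i = a \<or> i \<in> A" using e(1) by simp
        then show "i \<in> Poly_Mapping.keys e' \<longleftrightarrow> i \<in> A"
          using insert.hyps(2) by (auto simp: e'_def l_def in_keys_iff lookup_minus lookup_single when_def)
      qed
      have deg: "monom_degree e' + l = d" using e(2) split monom_degree_add[of e' "Poly_Mapping.single a l"]
        by (simp add: monom_degree_single)
      have "(monom_degree e', e') \<in> S" using k deg \<open>l > 0\<close> by (auto simp: S_def)
      moreover have l: "d - monom_degree e' = l" using deg by simp
      have "f (monom_degree e', e') = e" unfolding f_def prod.case l by (rule split[symmetric])
      ultimately show "e \<in> f ` S" by (metis imageI)
    qed (auto simp: S_def f_def keys_add_nat monom_degree_add monom_degree_single)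
    ultimately have "card {e. Poly_Mapping.keys e = insert a A \<and> monom_degree e = d} = card S"
      by (metis card_image)
    also have "\<dots> = (\<Sum>i<d. card (?E i))"
      unfolding S_def by (intro card_SigmaI) (auto intro: finite_degree_subset)
    also have "\<dots> = full_count (card (insert a A)) d" using insert by simp
    finally show ?case .
  qed
qed

lemma card_support_family:
  fixes F :: "'n::finite set set"
  shows "card {e. Poly_Mapping.keys e \<in> F \<and> monom_degree e = d} = (\<Sum>A\<in>F. full_count (card A) d)"
proof -
  have "{e. Poly_Mapping.keys e \<in> F \<and> monom_degree e = d} = (\<Union>A\<in>F. {e. Poly_Mapping.keys e = A \<and> monom_degree e = d})"
    by auto
  then have "card {e. Poly_Mapping.keys e \<in> F \<and> monom_degree e = d}
      = (\<Sum>A\<in>F. card {e. Poly_Mapping.keys e = A \<and> monom_degree e = d})"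
    by (simp only:) (intro card_UN_disjoint; auto intro: finite_degree_subset)
  then show ?thesis by (simp add: card_full_support)
qed

lemma sum_subsets_by_card:
  fixes g :: "nat \<Rightarrow> nat"
  assumes "finite Z"
  shows "(\<Sum>T\<in>Pow Z. g (card T)) = (\<Sum>j\<le>card Z. (card Z choose j) * g j)"
proof -
  have "(\<Sum>T\<in>Pow Z. g (card T)) = (\<Sum>j\<le>card Z. \<Sum>T\<in>{T \<in> Pow Z. card T = j}. g (card T))"
    using assms by (intro sum.group[symmetric]) (auto intro: card_mono)
  also have "\<dots> = (\<Sum>j\<le>card Z. (card Z choose j) * g j)"
  proof (rule sum.cong)
    fix j
    have "{T \<in> Pow Z. card T = j} = {T. T \<subseteq> Z \<and> card T = j}" by auto
    then show "(\<Sum>T\<in>{T \<in> Pow Z. card T = j}. g (card T)) = (card Z choose j) * g j"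
      using n_subsets[OF assms, of j] by simp
  qed simp
  finally show ?thesis .
qed

lemma card_large_support:
  "card {e :: 'n::finite \<Rightarrow>\<^sub>0 nat. m \<le> card (Poly_Mapping.keys e) \<and> monom_degree e = d} =
    (\<Sum>j=m..CARD('n). (CARD('n) choose j) * full_count j d)"
proof -
  have "card {e :: 'n \<Rightarrow>\<^sub>0 nat. m \<le> card (Poly_Mapping.keys e) \<and> monom_degree e = d} =
      (\<Sum>A | m \<le> card A. full_count (card (A :: 'n set)) d)"
    using card_support_family[of "{A :: 'n set. m \<le> card A}" d] by simp
  also have "\<dots> = (\<Sum>A\<in>Pow (UNIV :: 'n set). if m \<le> card A then full_count (card A) d else 0)"
    by (simp add: sum.inter_filter[symmetric])
  also have "\<dots> = (\<Sum>j\<le>CARD('n). (CARD('n) choose j) * (if m \<le> j then full_count j d else 0))"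
    by (rule sum_subsets_by_card) simp
  also have "\<dots> = (\<Sum>j=m..CARD('n). (CARD('n) choose j) * full_count j d)"
    by (rule sum.mono_neutral_cong_right) auto
  finally show ?thesis .
qed

section \<open>Squarefree monomials and shifts by them\<close>

definition indicator_monom :: "'n set \<Rightarrow> 'n::finite \<Rightarrow>\<^sub>0 nat" where
  "indicator_monom A = (\<Sum>i\<in>A. Poly_Mapping.single i 1)"

lemma lookup_indicator_monom: "Poly_Mapping.lookup (indicator_monom A) i = (if i \<in> A then 1 else 0)"
  by (auto simp: indicator_monom_def lookup_sum lookup_single when_def)

lemma keys_indicator_monom: "Poly_Mapping.keys (indicator_monom A) = A"
  by (auto simp: in_keys_iff lookup_indicator_monom split: if_splits)

lemma monom_degree_indicator: "monom_degree (indicator_monom A) = card A"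
  by (simp add: monom_degree_def lookup_indicator_monom sum.If_cases)

lemma add_minus_indicator_monom: "A \<subseteq> Poly_Mapping.keys e \<Longrightarrow> (e - indicator_monom A) + indicator_monom A = e"
  by (rule poly_mapping_eqI) (auto simp: lookup_add lookup_minus lookup_indicator_monom in_keys_iff subset_iff)

text \<open>Multiplication by the squarefree monomial with support \<open>A \<subseteq> B\<close> turns monomials with support in
  \<open>B\<close> into monomials with support between \<open>A\<close> and \<open>B\<close>.\<close>

lemma card_shifted_support:
  fixes B :: "'n::finite set"
  assumes "a \<le> card B"
  shows "card {e. Poly_Mapping.keys e \<subseteq> B \<and> monom_degree e + a = d} =
    (\<Sum>i\<le>card B - a. ((card B - a) choose i) * full_count (a + i) d)"
proof -
  obtain A where A: "A \<subseteq> B" "card A = a" using obtain_subset_with_card_n[OF assms] by metis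
  let ?F = "(\<lambda>T. A \<union> T) ` Pow (B - A)"
  have "bij_betw (\<lambda>e. e + indicator_monom A) {e. Poly_Mapping.keys e \<subseteq> B \<and> monom_degree e + a = d}
      {e. Poly_Mapping.keys e \<in> ?F \<and> monom_degree e = d}"
  proof (rule bij_betwI[where g = "\<lambda>e. e - indicator_monom A"])
    show "(\<lambda>e. e + indicator_monom A) \<in> {e. Poly_Mapping.keys e \<subseteq> B \<and> monom_degree e + a = d} \<rightarrow>
        {e. Poly_Mapping.keys e \<in> ?F \<and> monom_degree e = d}"
    proof (rule funcsetI)
      fix e assume "e \<in> {e. Poly_Mapping.keys e \<subseteq> B \<and> monom_degree e + a = d}"
      then have e: "Poly_Mapping.keys e \<subseteq> B" "monom_degree e + a = d" by auto
      have "Poly_Mapping.keys (e + indicator_monom A) = A \<union> (Poly_Mapping.keys e - A)"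
        by (auto simp: keys_add_nat keys_indicator_monom)
      then have "Poly_Mapping.keys (e + indicator_monom A) \<in> ?F" using e(1) by blast
      then show "e + indicator_monom A \<in> {e. Poly_Mapping.keys e \<in> ?F \<and> monom_degree e = d}"
        using e(2) A(2) by (simp add: monom_degree_add monom_degree_indicator)
    qed
    have restore: "(e - indicator_monom A) + indicator_monom A = e"
      if "e \<in> {e. Poly_Mapping.keys e \<in> ?F \<and> monom_degree e = d}" for e
      using that by (intro add_minus_indicator_monom) auto
    show "(e - indicator_monom A) + indicator_monom A = e"
      if "e \<in> {e. Poly_Mapping.keys e \<in> ?F \<and> monom_degree e = d}" for e by (rule restore[OF that])
    show "(\<lambda>e. e - indicator_monom A) \<in> {e. Poly_Mapping.keys e \<in> ?F \<and> monom_degree e = d} \<rightarrow>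
        {e. Poly_Mapping.keys e \<subseteq> B \<and> monom_degree e + a = d}"
    proof (rule funcsetI)
      fix e assume e: "e \<in> {e. Poly_Mapping.keys e \<in> ?F \<and> monom_degree e = d}"
      have "Poly_Mapping.keys e \<subseteq> B" using e A(1) by auto
      moreover have "Poly_Mapping.keys (e - indicator_monom A) \<subseteq> Poly_Mapping.keys e"
        by (auto simp: in_keys_iff lookup_minus)
      moreover have "monom_degree (e - indicator_monom A) + a = d"
        using arg_cong[OF restore[OF e], of monom_degree] e A(2) by (simp add: monom_degree_add monom_degree_indicator)
      ultimately show "e - indicator_monom A \<in> {e. Poly_Mapping.keys e \<subseteq> B \<and> monom_degree e + a = d}" by auto
    qed
  qed simp
  then have "card {e. Poly_Mapping.keys e \<subseteq> B \<and> monom_degree e + a = d}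
      = card {e. Poly_Mapping.keys e \<in> ?F \<and> monom_degree e = d}" by (rule bij_betw_same_card)
  also have "\<dots> = (\<Sum>A'\<in>?F. full_count (card A') d)" by (rule card_support_family)
  also have "\<dots> = (\<Sum>T\<in>Pow (B - A). full_count (card (A \<union> T)) d)"
    by (subst sum.reindex) (auto simp: inj_on_def)
  also have "\<dots> = (\<Sum>T\<in>Pow (B - A). full_count (a + card T) d)"
  proof (rule sum.cong)
    fix T assume "T \<in> Pow (B - A)"
    then have "card (A \<union> T) = a + card T" using A(2) by (subst card_Un_disjoint) auto
    then show "full_count (card (A \<union> T)) d = full_count (a + card T) d" by simp
  qed simp
  also have "\<dots> = (\<Sum>i\<le>card (B - A). (card (B - A) choose i) * full_count (a + i) d)"
    by (rule sum_subsets_by_card) simp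
  also have "card (B - A) = card B - a" using A by (simp add: card_Diff_subset)
  finally show ?thesis .
qed

section \<open>The Hilbert function of the squarefree Veronese ideal\<close>

text \<open>A monomial is divisible by a squarefree monomial of degree \<open>m\<close> exactly when
  at least \<open>m\<close> variables occur in it, and a monomial ideal contains a polynomial
  exactly when it contains all its monomials.\<close>

lemma squarefree_veronese_eq:
  "squarefree_veronese m = {f :: ('n::finite, 'k::field) mpoly. \<forall>e\<in>Poly_Mapping.keys f. m \<le> card (Poly_Mapping.keys e)}"
  (is "_ = ?I")
proof
  interpret cring "poly_ring :: ('n, 'k) mpoly ring" by (rule cring_poly_ring)
  have gen: "(\<Prod>i\<in>A. var i) = (Poly_Mapping.single (indicator_monom A) 1 :: ('n, 'k) mpoly)" for A
    unfolding indicator_monom_def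
    by (induction A rule: infinite_finite_induct) (simp_all add: var_def mult_single)
  have "ideal ?I poly_ring"
  proof (rule ideal_poly_ringI)
    fix f g :: "('n, 'k) mpoly" assume "f \<in> ?I" "g \<in> ?I"
    then show "f + g \<in> ?I" using Poly_Mapping.keys_add[of f g] by blast
  next
    fix h f :: "('n, 'k) mpoly" assume f: "f \<in> ?I"
    show "h * f \<in> ?I"
    proof (intro CollectI ballI)
      fix e assume "e \<in> Poly_Mapping.keys (h * f)"
      then obtain e1 e2 where e: "e = e1 + e2" "e2 \<in> Poly_Mapping.keys f"
        using keys_mult[of h f] by auto
      have "card (Poly_Mapping.keys e2) \<le> card (Poly_Mapping.keys e)"
        unfolding e(1) keys_add_nat by (intro card_mono) auto
      then show "m \<le> card (Poly_Mapping.keys e)" using f e(2) by force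
    qed
  qed simp
  then show "squarefree_veronese m \<subseteq> ?I"
    unfolding squarefree_veronese_def by (rule genideal_minimal) (auto simp: gen keys_indicator_monom)
  let ?J = "squarefree_veronese m :: ('n, 'k) mpoly set"
  interpret J: ideal ?J poly_ring
    unfolding squarefree_veronese_def by (rule genideal_ideal) simp
  have J: "0 \<in> ?J" "\<And>f g. f \<in> ?J \<Longrightarrow> g \<in> ?J \<Longrightarrow> f + g \<in> ?J" "\<And>h f. f \<in> ?J \<Longrightarrow> h * f \<in> ?J"
    using J.zero_closed J.a_closed J.I_l_closed by simp_all
  show "?I \<subseteq> ?J"
  proof
    fix f :: "('n, 'k) mpoly" assume f: "f \<in> ?I"
    have mono: "Poly_Mapping.single e c \<in> ?J" if "m \<le> card (Poly_Mapping.keys e)" for e :: "'n \<Rightarrow>\<^sub>0 nat" and c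
    proof -
      obtain A where A: "A \<subseteq> Poly_Mapping.keys e" "card A = m" using obtain_subset_with_card_n[OF \<open>m \<le> card (Poly_Mapping.keys e)\<close>] by metis
      have "(\<Prod>i\<in>A. var i) \<in> ?J"
        unfolding squarefree_veronese_def using A(2) genideal_self[of "{\<Prod>i\<in>A. var i | A :: 'n set. card A = m}"] by auto
      from J(3)[OF this, of "Poly_Mapping.single (e - indicator_monom A) c"]
      show ?thesis using add_minus_indicator_monom[OF A(1)] by (simp add: gen mult_single)
    qed
    have "(\<Sum>e\<in>K. Poly_Mapping.single e (Poly_Mapping.lookup f e)) \<in> ?J" if "K \<subseteq> Poly_Mapping.keys f" for K
      using that f by (induction K rule: infinite_finite_induct) (auto intro!: J(1,2) mono)
    from this[OF order_refl] show "f \<in> ?J" using poly_mapping_sum_single[of f] by simp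
  qed
qed

section \<open>Ideals as graded modules\<close>

lemma ideal_module_simps [simp]:
  "carrier (ideal_module I) = I" "\<zero>\<^bsub>ideal_module I\<^esub> = 0" "x \<oplus>\<^bsub>ideal_module I\<^esub> y = x + y"
  "f \<odot>\<^bsub>ideal_module I\<^esub> x = f * x" "component (ideal_module I) k = I \<inter> homogeneous_part k"
  by (simp_all add: ideal_module_def)

lemma homogeneous_part_add: "f \<in> homogeneous_part k \<Longrightarrow> g \<in> homogeneous_part k \<Longrightarrow> f + g \<in> homogeneous_part k"
  using Poly_Mapping.keys_add[of f g] by (auto simp: homogeneous_part_def)

lemma homogeneous_part_const_mult: "f \<in> homogeneous_part k \<Longrightarrow> const a * f \<in> homogeneous_part k"
  using keys_mult[of "const a" f] by (fastforce simp: homogeneous_part_def const_def split: if_splits)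

lemma poly_module_ideal_module:
  assumes "ideal I (poly_ring :: ('n::finite, 'k::field) mpoly ring)"
  shows "poly_module (ideal_module I)"
proof -
  interpret I: ideal I poly_ring by fact
  have I: "0 \<in> I" "\<And>f g. f \<in> I \<Longrightarrow> g \<in> I \<Longrightarrow> f + g \<in> I" "\<And>h f. f \<in> I \<Longrightarrow> h * f \<in> I"
    using additive_subgroup.zero_closed[OF I.additive_subgroup_axioms]
      additive_subgroup.a_closed[OF I.additive_subgroup_axioms] I.I_l_closed by simp_all
  have neg: "- f \<in> I" if "f \<in> I" for f using I(3)[OF that, of "- 1"] by simp
  have grp: "abelian_group (ideal_module I)"
  proof (rule abelian_groupI)
    show "\<exists>y\<in>carrier (ideal_module I). y \<oplus>\<^bsub>ideal_module I\<^esub> x = \<zero>\<^bsub>ideal_module I\<^esub>"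
      if "x \<in> carrier (ideal_module I)" for x
      using neg that by (intro bexI[of _ "- x"]) auto
  qed (auto simp: I add_ac)
  interpret A: abelian_group "ideal_module I" by (rule grp)
  have inv: "\<ominus>\<^bsub>ideal_module I\<^esub> f = - f" if "f \<in> I" for f
    using that neg by (intro A.minus_equality) auto
  have "module poly_ring (ideal_module I)"
    by (rule moduleI[OF cring_poly_ring grp]) (auto simp: I algebra_simps)
  then show ?thesis
  proof (rule poly_module.intro, intro poly_module_axioms.intro additive_subgroupI subgroup.intro)
    fix k f assume f: "f \<in> component (ideal_module I) k"
    then have "- f \<in> component (ideal_module I) k"
      using neg homogeneous_part_const_mult[of f k "- 1"]
      by (simp add: const_def single_uminus)
    then show "inv\<^bsub>add_monoid (ideal_module I)\<^esub> f \<in> component (ideal_module I) k"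
      using f inv[of f] by (simp add: a_inv_def)
  next
    fix k f g assume "f \<in> component (ideal_module I) k" "g \<in> component (ideal_module I) k"
    then show "f \<otimes>\<^bsub>add_monoid (ideal_module I)\<^esub> g \<in> component (ideal_module I) k"
      by (simp add: I homogeneous_part_add)
  next
    fix k a and f assume "f \<in> component (ideal_module I) k"
    then show "const a \<odot>\<^bsub>ideal_module I\<^esub> f \<in> component (ideal_module I) k"
      by (simp add: I homogeneous_part_const_mult)
  qed (auto simp: I homogeneous_part_def)
qed

lemma lookup_sum_single:
  "finite E \<Longrightarrow> Poly_Mapping.lookup (\<Sum>e\<in>E. Poly_Mapping.single e (t e)) i = (if i \<in> E then t i else 0)"
  by (simp add: lookup_sum lookup_single when_def)

lemma hilbert_function_squarefree_veronese:
  "hilbert_function (ideal_module (squarefree_veronese m :: ('n::finite, 'k::field) mpoly set)) k =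
    card {e :: 'n \<Rightarrow>\<^sub>0 nat. m \<le> card (Poly_Mapping.keys e) \<and> int (monom_degree e) = k}"
proof -
  interpret cring "poly_ring :: ('n, 'k) mpoly ring" by (rule cring_poly_ring)
  let ?J = "squarefree_veronese m :: ('n, 'k) mpoly set"
  let ?E = "{e :: 'n \<Rightarrow>\<^sub>0 nat. m \<le> card (Poly_Mapping.keys e) \<and> int (monom_degree e) = k}"
  have id: "ideal ?J poly_ring" unfolding squarefree_veronese_def by (rule genideal_ideal) simp
  interpret J: poly_module "ideal_module ?J" by (rule poly_module_ideal_module[OF id])
  have fin: "finite ?E" by (rule finite_degree_subset[of _ "nat k"]) auto
  have mem: "Poly_Mapping.single e c \<in> ?J" if "e \<in> ?E" for e c
    using that by (auto simp: squarefree_veronese_eq split: if_splits)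
  have finsum: "(\<Oplus>\<^bsub>ideal_module ?J\<^esub>e\<in>Z. const (t e) \<odot>\<^bsub>ideal_module ?J\<^esub> Poly_Mapping.single e 1)
      = (\<Sum>e\<in>Z. Poly_Mapping.single e (t e))" if "Z \<subseteq> ?E" for Z t
    using that
  proof (induction Z rule: infinite_finite_induct)
    case (insert e Z)
    have "(\<Oplus>\<^bsub>ideal_module ?J\<^esub>e\<in>insert e Z. const (t e) \<odot>\<^bsub>ideal_module ?J\<^esub> Poly_Mapping.single e 1) =
      const (t e) \<odot>\<^bsub>ideal_module ?J\<^esub> Poly_Mapping.single e 1 \<oplus>\<^bsub>ideal_module ?J\<^esub>
      (\<Oplus>\<^bsub>ideal_module ?J\<^esub>e\<in>Z. const (t e) \<odot>\<^bsub>ideal_module ?J\<^esub> Poly_Mapping.single e 1)"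
      using insert mem by (intro J.M.finsum_insert) (auto simp: const_def mult_single)
    then show ?case using insert by (simp add: const_def mult_single)
  qed auto
  show ?thesis
  proof (rule J.hilbert_function_index[OF fin, where b = "\<lambda>e. Poly_Mapping.single e 1"])
    show "Poly_Mapping.single e 1 \<in> component (ideal_module ?J) k" if "e \<in> ?E" for e
      using mem[OF that] that by (auto simp: homogeneous_part_def)
  next
    fix f assume "f \<in> component (ideal_module ?J) k"
    then have "Poly_Mapping.keys f \<subseteq> ?E" by (auto simp: squarefree_veronese_eq homogeneous_part_def)
    then have "f = (\<Sum>e\<in>?E. Poly_Mapping.single e (Poly_Mapping.lookup f e))"
      by (intro poly_mapping_eqI) (auto simp: lookup_sum_single[OF fin] in_keys_iff)
    then show "\<exists>t. f = (\<Oplus>\<^bsub>ideal_module ?J\<^esub>e\<in>?E. const (t e) \<odot>\<^bsub>ideal_module ?J\<^esub> Poly_Mapping.single e 1)"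
      unfolding finsum[OF order_refl] by (rule exI[of _ "Poly_Mapping.lookup f"])
  next
    fix t u :: "('n \<Rightarrow>\<^sub>0 nat) \<Rightarrow> 'k" and e
    assume eq: "(\<Oplus>\<^bsub>ideal_module ?J\<^esub>e\<in>?E. const (t e) \<odot>\<^bsub>ideal_module ?J\<^esub> Poly_Mapping.single e 1) =
      (\<Oplus>\<^bsub>ideal_module ?J\<^esub>e\<in>?E. const (u e) \<odot>\<^bsub>ideal_module ?J\<^esub> Poly_Mapping.single e 1)" and e: "e \<in> ?E"
    have "Poly_Mapping.lookup (\<Sum>e\<in>?E. Poly_Mapping.single e (t e)) e = Poly_Mapping.lookup (\<Sum>e\<in>?E. Poly_Mapping.single e (u e)) e"
      using eq unfolding finsum[OF order_refl] by simp
    then show "t e = u e" using e by (simp only: lookup_sum_single[OF fin] if_True)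
  qed
qed

section \<open>Modules with prescribed Hilbert function\<close>

text \<open>The substitution of zero for the variables outside \<open>B\<close>. It is a ring
  retraction onto \<open>polys_in B\<close>, and through it the whole ring acts on polynomials in
  fewer variables.\<close>

definition restrict_vars :: "'n set \<Rightarrow> ('n::finite, 'k::field) mpoly \<Rightarrow> ('n, 'k) mpoly" where
  "restrict_vars B f = Poly_Mapping.mapp (\<lambda>e a. if Poly_Mapping.keys e \<subseteq> B then a else 0) f"

definition polys_in :: "'n set \<Rightarrow> ('n::finite, 'k::field) mpoly set" where
  "polys_in B = {f. \<forall>e\<in>Poly_Mapping.keys f. Poly_Mapping.keys e \<subseteq> B}"

lemma lookup_mapp_eq:
  "(\<And>e. h e 0 = 0) \<Longrightarrow> Poly_Mapping.lookup (Poly_Mapping.mapp h f) e = h e (Poly_Mapping.lookup f e)"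
  by (simp add: lookup_mapp when_def in_keys_iff)

lemma lookup_restrict_vars:
  "Poly_Mapping.lookup (restrict_vars B f) e = (if Poly_Mapping.keys e \<subseteq> B then Poly_Mapping.lookup f e else 0)"
  unfolding restrict_vars_def by (subst lookup_mapp_eq) simp_all

lemma restrict_vars_id: "f \<in> polys_in B \<Longrightarrow> restrict_vars B f = f"
  by (rule poly_mapping_eqI) (auto simp: lookup_restrict_vars polys_in_def in_keys_iff)

lemma polys_in_simps:
  "0 \<in> polys_in B" "f \<in> polys_in B \<Longrightarrow> g \<in> polys_in B \<Longrightarrow> f + g \<in> polys_in B"
  "f \<in> polys_in B \<Longrightarrow> - f \<in> polys_in B" "restrict_vars B h \<in> polys_in B"
proof -
  have "Poly_Mapping.keys (- f) = Poly_Mapping.keys f" by (auto simp: in_keys_iff)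
  then show "0 \<in> polys_in B" "f \<in> polys_in B \<Longrightarrow> g \<in> polys_in B \<Longrightarrow> f + g \<in> polys_in B"
    "f \<in> polys_in B \<Longrightarrow> - f \<in> polys_in B"
    using Poly_Mapping.keys_add[of f g] by (auto simp: polys_in_def)
  show "restrict_vars B h \<in> polys_in B"
    unfolding polys_in_def
    by (intro CollectI ballI) (simp add: in_keys_iff[of _ "restrict_vars B h"] lookup_restrict_vars split: if_splits)
qed

lemma polys_in_mult:
  assumes "f \<in> polys_in B" "g \<in> polys_in B"
  shows "f * g \<in> polys_in B"
  unfolding polys_in_def
proof (intro CollectI ballI)
  fix e assume "e \<in> Poly_Mapping.keys (f * g)"
  then obtain a b where "e = a + b" "a \<in> Poly_Mapping.keys f" "b \<in> Poly_Mapping.keys g"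
    using keys_mult[of f g] by auto
  then show "Poly_Mapping.keys e \<subseteq> B" using assms by (auto simp: polys_in_def keys_add_nat)
qed

lemma restrict_vars_add: "restrict_vars B (f + g) = restrict_vars B f + restrict_vars B g"
  by (rule poly_mapping_eqI) (simp add: lookup_restrict_vars lookup_add)

text \<open>The polynomials restricting to zero are closed under multiplication by arbitrary ones,
  since a factor with a variable outside \<open>B\<close> leaves that variable in the product. Each
  polynomial differs from its restriction by one of these.\<close>

lemma restrict_vars_mult: "restrict_vars B (f * g) = restrict_vars B f * restrict_vars B g"
proof -
  have kill: "restrict_vars B (p * h) = 0" if p: "restrict_vars B p = 0" for p h
  proof (rule poly_mapping_eqI)
    fix e
    have "Poly_Mapping.lookup (p * h) e = 0" if e: "Poly_Mapping.keys e \<subseteq> B"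
    proof (rule ccontr)
      assume "Poly_Mapping.lookup (p * h) e \<noteq> 0"
      then obtain a b where ab: "e = a + b" "a \<in> Poly_Mapping.keys p"
        using keys_mult[of p h] by (auto simp: in_keys_iff)
      then have "Poly_Mapping.lookup (restrict_vars B p) a \<noteq> 0"
        using e by (auto simp: lookup_restrict_vars keys_add_nat in_keys_iff)
      then show False using p by simp
    qed
    then show "Poly_Mapping.lookup (restrict_vars B (p * h)) e = Poly_Mapping.lookup 0 e"
      by (simp add: lookup_restrict_vars)
  qed
  define f' g' where "f' = f - restrict_vars B f" and "g' = g - restrict_vars B g"
  have "restrict_vars B f' = 0" "restrict_vars B g' = 0"
    by (rule poly_mapping_eqI, simp add: f'_def g'_def lookup_restrict_vars lookup_minus)+
  moreover have "f * g = restrict_vars B f * restrict_vars B g + (g' * restrict_vars B f + f' * g)"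
    by (simp add: f'_def g'_def algebra_simps)
  ultimately have "restrict_vars B (f * g) = restrict_vars B (restrict_vars B f * restrict_vars B g)"
    by (simp only: restrict_vars_add kill add_0_right)
  then show ?thesis by (simp add: restrict_vars_id polys_in_mult polys_in_simps)
qed

lemma restrict_vars_const: "restrict_vars B (const a) = const a"
  by (rule restrict_vars_id) (auto simp: polys_in_def const_def)

lemma restrict_vars_one: "restrict_vars B 1 = 1"
  by (rule restrict_vars_id) (auto simp: polys_in_def)

lemma restrict_vars_var: "i \<in> B \<Longrightarrow> restrict_vars B (var i) = var i"
  by (rule restrict_vars_id) (auto simp: polys_in_def var_def)

lemma lookup_var_mult:
  "Poly_Mapping.lookup (var i * f) (e + Poly_Mapping.single i 1) = Poly_Mapping.lookup f e"
proof -
  have "var i * f = (\<Sum>d\<in>Poly_Mapping.keys f. Poly_Mapping.single (d + Poly_Mapping.single i 1) (Poly_Mapping.lookup f d))"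
    by (subst (1) poly_mapping_sum_single[of f]) (simp add: sum_distrib_left var_def mult_single add.commute)
  then have "Poly_Mapping.lookup (var i * f) (e + Poly_Mapping.single i 1) =
      (\<Sum>d\<in>Poly_Mapping.keys f. if d = e then Poly_Mapping.lookup f d else 0)"
    by (simp add: lookup_sum lookup_single when_def)
  then show ?thesis by (simp add: in_keys_iff)
qed

lemma keys_var_mult: "e \<in> Poly_Mapping.keys (var i * f) \<Longrightarrow> i \<in> Poly_Mapping.keys e"
  using keys_mult[of "var i" f] by (auto simp: var_def keys_add_nat split: if_splits)

lemma divide_by_var:
  assumes "f \<in> polys_in B" "\<And>e. e \<in> Poly_Mapping.keys f \<Longrightarrow> i \<in> Poly_Mapping.keys e"
  obtains g where "g \<in> polys_in B" "f = var i * g"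
proof
  let ?m = "\<lambda>e. e - Poly_Mapping.single i (1 :: nat)"
  define g where "g = (\<Sum>e\<in>Poly_Mapping.keys f. Poly_Mapping.single (?m e) (Poly_Mapping.lookup f e))"
  have "Poly_Mapping.single i 1 + ?m e = e" if "e \<in> Poly_Mapping.keys f" for e
    by (rule poly_mapping_eqI)
      (use assms(2)[OF that] in \<open>auto simp: lookup_add lookup_minus lookup_single when_def in_keys_iff\<close>)
  then have "var i * g = (\<Sum>e\<in>Poly_Mapping.keys f. Poly_Mapping.single e (Poly_Mapping.lookup f e))"
    unfolding g_def sum_distrib_left by (intro sum.cong) (auto simp: var_def mult_single)
  then show "f = var i * g" using poly_mapping_sum_single[of f] by simp
  have "\<exists>e\<in>Poly_Mapping.keys f. d = ?m e" if "d \<in> Poly_Mapping.keys g" for d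
    using that keys_sum[of "\<lambda>e. Poly_Mapping.single (?m e) (Poly_Mapping.lookup f e)" "Poly_Mapping.keys f"]
    unfolding g_def by (auto split: if_splits)
  moreover have "Poly_Mapping.keys (?m e) \<subseteq> Poly_Mapping.keys e" for e
    by (auto simp: in_keys_iff lookup_minus)
  ultimately show "g \<in> polys_in B" using assms(1) unfolding polys_in_def by blast
qed

text \<open>The direct sum over \<open>c < q\<close> of the modules \<open>K[x\<^sub>i | i \<in> B c]\<close>, on which the remaining variables
  act as zero, with generators in degree \<open>deg c\<close>. Its elements are wrapped as singletons to match
  the carrier type.\<close>

locale polynomial_sum =
  fixes q :: nat and B :: "nat \<Rightarrow> 'n::finite set" and deg :: "nat \<Rightarrow> nat" and ty :: "'k::field itself"
begin

definition vectors :: "(nat \<Rightarrow> ('n, 'k) mpoly) set" where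
  "vectors = {v. (\<forall>c<q. v c \<in> polys_in (B c)) \<and> (\<forall>c\<ge>q. v c = 0)}"

definition sum_module :: "(('n, 'k) mpoly, (nat \<Rightarrow> ('n, 'k) mpoly) set) graded_module" where
  "sum_module = \<lparr>carrier = (\<lambda>v. {v}) ` vectors, monoid.mult = (\<lambda>x y. x), one = {\<lambda>_. 0},
     zero = {\<lambda>_. 0}, add = (\<lambda>x y. {\<lambda>c. the_elem x c + the_elem y c}),
     module.smult = (\<lambda>f x. {\<lambda>c. restrict_vars (B c) f * the_elem x c}),
     component = (\<lambda>k. (\<lambda>v. {v}) ` {v \<in> vectors. \<forall>c. \<forall>e\<in>Poly_Mapping.keys (v c).
       int (monom_degree e) + int (deg c) = k})\<rparr>"

abbreviation N where "N \<equiv> sum_module"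

lemma N_simps:
  "carrier N = (\<lambda>v. {v}) ` vectors" "\<zero>\<^bsub>N\<^esub> = {\<lambda>_. 0}" "{v} \<oplus>\<^bsub>N\<^esub> {w} = {\<lambda>c. v c + w c}"
  "f \<odot>\<^bsub>N\<^esub> {v} = {\<lambda>c. restrict_vars (B c) f * v c}"
  "component N k = (\<lambda>v. {v}) ` {v \<in> vectors. \<forall>c. \<forall>e\<in>Poly_Mapping.keys (v c).
       int (monom_degree e) + int (deg c) = k}"
  by (simp_all add: sum_module_def)

lemma vectors_simps:
  "(\<lambda>_. 0) \<in> vectors" "v \<in> vectors \<Longrightarrow> w \<in> vectors \<Longrightarrow> (\<lambda>c. v c + w c) \<in> vectors"
  "v \<in> vectors \<Longrightarrow> (\<lambda>c. - v c) \<in> vectors" "v \<in> vectors \<Longrightarrow> (\<lambda>c. restrict_vars (B c) f * v c) \<in> vectors"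
  by (auto simp: vectors_def polys_in_simps polys_in_mult)

lemma vectors_polys_in: "v \<in> vectors \<Longrightarrow> v c \<in> polys_in (B c)"
  by (cases "c < q") (auto simp: vectors_def polys_in_simps)

lemma abelian_group_N: "abelian_group N"
proof (rule abelian_groupI)
  fix x assume "x \<in> carrier N"
  then obtain v where "x = {v}" "v \<in> vectors" by (auto simp: N_simps)
  then show "\<exists>y\<in>carrier N. y \<oplus>\<^bsub>N\<^esub> x = \<zero>\<^bsub>N\<^esub>"
    by (intro bexI[of _ "{\<lambda>c. - v c}"]) (auto simp: N_simps vectors_simps)
qed (auto simp: N_simps vectors_simps add_ac)

lemma module_N: "module poly_ring N"
  by (rule moduleI[OF cring_poly_ring abelian_group_N])
    (auto simp: N_simps vectors_simps restrict_vars_add restrict_vars_mult restrict_vars_one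
      distrib_left distrib_right mult.assoc)

lemma uminus_N: "v \<in> vectors \<Longrightarrow> \<ominus>\<^bsub>N\<^esub> {v} = {\<lambda>c. - v c}"
  by (rule abelian_group.minus_equality[OF abelian_group_N]) (auto simp: N_simps vectors_simps)

lemma component_subgroup_N: "additive_subgroup (component N k) N"
proof (rule additive_subgroupI, rule subgroup.intro)
  fix x y assume "x \<in> component N k" "y \<in> component N k"
  then obtain v w where v: "x = {v}" "v \<in> vectors" "\<forall>c. \<forall>e\<in>Poly_Mapping.keys (v c). int (monom_degree e) + int (deg c) = k"
    and w: "y = {w}" "w \<in> vectors" "\<forall>c. \<forall>e\<in>Poly_Mapping.keys (w c). int (monom_degree e) + int (deg c) = k"
    by (auto simp: N_simps)
  have "\<forall>c. \<forall>e\<in>Poly_Mapping.keys (v c + w c). int (monom_degree e) + int (deg c) = k"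
    using v(3) w(3) Poly_Mapping.keys_add by fast
  then show "x \<otimes>\<^bsub>add_monoid N\<^esub> y \<in> component N k"
    using v w vectors_simps(2) by (simp add: N_simps)
next
  fix x assume "x \<in> component N k"
  then obtain v where v: "x = {v}" "v \<in> vectors" "\<forall>c. \<forall>e\<in>Poly_Mapping.keys (v c). int (monom_degree e) + int (deg c) = k"
    by (auto simp: N_simps)
  have "{\<lambda>c. - v c} \<in> component N k"
    unfolding N_simps by (rule imageI) (use v vectors_simps(3) in \<open>auto simp: in_keys_iff\<close>)
  then show "inv\<^bsub>add_monoid N\<^esub> x \<in> component N k"
    using uminus_N[OF v(2)] v(1) by (simp add: a_inv_def)
qed (auto simp: N_simps vectors_simps)

lemma smult_component_N:
  assumes "f \<in> homogeneous_part i" "x \<in> component N j"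
  shows "f \<odot>\<^bsub>N\<^esub> x \<in> component N (i + j)"
proof -
  obtain v where v: "x = {v}" "v \<in> vectors" "\<And>c e. e \<in> Poly_Mapping.keys (v c) \<Longrightarrow> int (monom_degree e) + int (deg c) = j"
    using assms(2) by (auto simp: N_simps)
  have "int (monom_degree e) + int (deg c) = i + j"
    if "e \<in> Poly_Mapping.keys (restrict_vars (B c) f * v c)" for c e
  proof -
    obtain a b where ab: "e = a + b" "a \<in> Poly_Mapping.keys (restrict_vars (B c) f)" "b \<in> Poly_Mapping.keys (v c)"
      using \<open>e \<in> _\<close> keys_mult[of "restrict_vars (B c) f" "v c"] by auto
    have "a \<in> Poly_Mapping.keys f" using ab(2) by (auto simp: in_keys_iff lookup_restrict_vars split: if_splits)
    then show ?thesis using assms(1) v(3)[OF ab(3)] by (auto simp: ab(1) monom_degree_add homogeneous_part_def)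
  qed
  then show ?thesis using v(1,2) vectors_simps(4) by (auto simp: N_simps)
qed

sublocale N: poly_module N
proof (rule poly_module.intro[OF module_N], rule poly_module_axioms.intro)
  show "const a \<odot>\<^bsub>N\<^esub> x \<in> component N k" if "x \<in> component N k" for k a x
    using smult_component_N[OF const_homogeneous that] by simp
qed (rule component_subgroup_N)

lemma finsum_N:
  "(\<And>i. i \<in> I \<Longrightarrow> v i \<in> vectors) \<Longrightarrow> (\<Oplus>\<^bsub>N\<^esub>i\<in>I. {v i}) = {\<lambda>c. \<Sum>i\<in>I. v i c}"
proof (induction I rule: infinite_finite_induct)
  case (insert i I)
  then have "(\<Oplus>\<^bsub>N\<^esub>i\<in>insert i I. {v i}) = {v i} \<oplus>\<^bsub>N\<^esub> (\<Oplus>\<^bsub>N\<^esub>i\<in>I. {v i})"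
    by (intro N.M.finsum_insert) (auto simp: N_simps)
  then show ?case using insert by (simp add: N_simps)
qed (auto simp: N_simps)

definition part :: "int \<Rightarrow> (nat \<Rightarrow> ('n, 'k) mpoly) \<Rightarrow> nat \<Rightarrow> ('n, 'k) mpoly" where
  "part k v = (\<lambda>c. Poly_Mapping.mapp (\<lambda>e a. if int (monom_degree e) + int (deg c) = k then a else 0) (v c))"

lemma lookup_part:
  "Poly_Mapping.lookup (part k v c) e = (if int (monom_degree e) + int (deg c) = k then Poly_Mapping.lookup (v c) e else 0)"
  unfolding part_def by (subst lookup_mapp_eq) simp_all

lemma part_component: "v \<in> vectors \<Longrightarrow> {part k v} \<in> component N k"
  unfolding N_simps vectors_def polys_in_def
  by (intro imageI CollectI conjI allI impI ballI poly_mapping_eqI)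
    (auto simp: in_keys_iff lookup_part split: if_splits)

lemma direct_sum_N:
  assumes "x \<in> carrier N"
  shows "\<exists>!c. (\<forall>k. c k \<in> component N k) \<and> finite {k. c k \<noteq> \<zero>\<^bsub>N\<^esub>} \<and>
    x = (\<Oplus>\<^bsub>N\<^esub>k\<in>{k. c k \<noteq> \<zero>\<^bsub>N\<^esub>}. c k)"
proof -
  obtain v where v: "x = {v}" "v \<in> vectors" using assms by (auto simp: N_simps)
  let ?S = "{k. {part k v} \<noteq> \<zero>\<^bsub>N\<^esub>}"
  have pv: "part k v \<in> vectors" for k using part_component[OF v(2), of k] by (auto simp: N_simps)
  have nonzero: "int (monom_degree e) + int (deg c) \<in> ?S" if "Poly_Mapping.lookup (v c) e \<noteq> 0" for c e
  proof (rule CollectI, rule notI)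
    assume "{part (int (monom_degree e) + int (deg c)) v} = \<zero>\<^bsub>N\<^esub>"
    then have "part (int (monom_degree e) + int (deg c)) v = (\<lambda>_. 0)" by (simp add: N_simps)
    then have "Poly_Mapping.lookup (part (int (monom_degree e) + int (deg c)) v c) e = 0" by simp
    then show False using that by (simp add: lookup_part)
  qed
  have "?S \<subseteq> (\<Union>c<q. (\<lambda>e. int (monom_degree e) + int (deg c)) ` Poly_Mapping.keys (v c))"
  proof
    fix k assume "k \<in> ?S"
    then have "part k v \<noteq> (\<lambda>_. 0)" by (simp add: N_simps)
    then obtain c where "part k v c \<noteq> 0" by blast
    then obtain e where e: "Poly_Mapping.lookup (part k v c) e \<noteq> 0"
      by (metis lookup_zero poly_mapping_eqI)
    then have "Poly_Mapping.lookup (v c) e \<noteq> 0" "int (monom_degree e) + int (deg c) = k"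
      by (simp_all add: lookup_part split: if_splits)
    moreover from this have "c < q" using v(2) by (auto simp: vectors_def not_less[symmetric])
    ultimately show "k \<in> (\<Union>c<q. (\<lambda>e. int (monom_degree e) + int (deg c)) ` Poly_Mapping.keys (v c))"
      by (intro UN_I[of c]) (auto simp: in_keys_iff)
  qed
  then have fin: "finite ?S" by (rule finite_subset) auto
  show ?thesis
  proof (rule ex1I[of _ "\<lambda>k. {part k v}"])
    have "v = (\<lambda>c. \<Sum>k\<in>?S. part k v c)"
    proof (intro ext poly_mapping_eqI)
      fix c e
      have "Poly_Mapping.lookup (\<Sum>k\<in>?S. part k v c) e
          = (\<Sum>k\<in>?S. if int (monom_degree e) + int (deg c) = k then Poly_Mapping.lookup (v c) e else 0)"
        by (simp only: lookup_sum lookup_part)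
      also have "\<dots> = (if int (monom_degree e) + int (deg c) \<in> ?S then Poly_Mapping.lookup (v c) e else 0)"
        by (rule sum.delta'[OF fin])
      finally show "Poly_Mapping.lookup (v c) e = Poly_Mapping.lookup (\<Sum>k\<in>?S. part k v c) e"
        using nonzero[of c e] by (simp only: split: if_split) blast
    qed
    then have "x = (\<Oplus>\<^bsub>N\<^esub>k\<in>?S. {part k v})" unfolding v(1) finsum_N[OF pv] by (rule arg_cong)
    then show "(\<forall>k. {part k v} \<in> component N k) \<and> finite ?S \<and> x = (\<Oplus>\<^bsub>N\<^esub>k\<in>?S. {part k v})"
      using fin part_component[OF v(2)] by simp
  next
    fix c' assume c': "(\<forall>k. c' k \<in> component N k) \<and> finite {k. c' k \<noteq> \<zero>\<^bsub>N\<^esub>} \<and> x = (\<Oplus>\<^bsub>N\<^esub>k\<in>{k. c' k \<noteq> \<zero>\<^bsub>N\<^esub>}. c' k)"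
    define w where "w k = the_elem (c' k)" for k
    let ?T = "{k. c' k \<noteq> \<zero>\<^bsub>N\<^esub>}"
    have w: "c' k = {w k}" "w k \<in> vectors"
      and hw: "e \<in> Poly_Mapping.keys (w k c) \<Longrightarrow> int (monom_degree e) + int (deg c) = k" for k c e
    proof -
      have "c' k \<in> component N k" using c' by blast
      then obtain u where u: "c' k = {u}" "u \<in> vectors"
          "\<forall>c. \<forall>e\<in>Poly_Mapping.keys (u c). int (monom_degree e) + int (deg c) = k"
        by (auto simp: N_simps)
      then have "w k = u" by (simp add: w_def)
      then show "c' k = {w k}" "w k \<in> vectors"
        "e \<in> Poly_Mapping.keys (w k c) \<Longrightarrow> int (monom_degree e) + int (deg c) = k"
        using u by auto
    qed
    have "{v} = (\<Oplus>\<^bsub>N\<^esub>k\<in>?T. {w k})" using c' unfolding v(1) w(1) by blast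
    then have vw: "v = (\<lambda>c. \<Sum>k\<in>?T. w k c)" unfolding finsum_N[OF w(2)] by simp
    have "w k = part k v" for k
    proof (intro ext poly_mapping_eqI)
      fix c and e :: "'n \<Rightarrow>\<^sub>0 nat"
      let ?k = "int (monom_degree e) + int (deg c)"
      \<comment> \<open>A monomial \<open>e\<close> in slot \<open>c\<close> has a single total
        degree, so it can occur in one component only; this gives uniqueness of the
        decomposition.\<close>
      have off: "Poly_Mapping.lookup (w l c) e = 0" if "l \<noteq> ?k" for l
        using hw[of e l c] that by (auto simp: in_keys_iff)
      have "Poly_Mapping.lookup (v c) e = (\<Sum>l\<in>?T. Poly_Mapping.lookup (w l c) e)"
        by (simp only: vw lookup_sum)
      also have "\<dots> = (\<Sum>l\<in>?T. if l = ?k then Poly_Mapping.lookup (w l c) e else 0)"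
        using off by (intro sum.cong) auto
      also have "\<dots> = (if ?k \<in> ?T then Poly_Mapping.lookup (w ?k c) e else 0)"
        using c' by (intro sum.delta) blast
      also have "\<dots> = Poly_Mapping.lookup (w ?k c) e"
      proof (cases "?k \<in> ?T")
        case False
        then have "w ?k = (\<lambda>_. 0)" using w(1)[of ?k] by (simp add: N_simps)
        then show ?thesis by simp
      qed simp
      finally show "Poly_Mapping.lookup (w k c) e = Poly_Mapping.lookup (part k v c) e"
        using off[of k] by (auto simp: lookup_part)
    qed
    then show "c' = (\<lambda>k. {part k v})" using w(1) by (intro ext) simp
  qed
qed

definition generator :: "nat \<Rightarrow> nat \<Rightarrow> ('n, 'k) mpoly" where
  "generator c = (\<lambda>j. if j = c then 1 else 0)"

lemma generator_vectors: "c < q \<Longrightarrow> generator c \<in> vectors"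
  by (auto simp: generator_def vectors_def polys_in_def)

lemma finitely_generated_N:
  "\<exists>A. finite A \<and> A \<subseteq> carrier N \<and> (\<forall>x\<in>carrier N. \<exists>f. x = (\<Oplus>\<^bsub>N\<^esub>a\<in>A. f a \<odot>\<^bsub>N\<^esub> a))"
proof -
  let ?A = "(\<lambda>c. {generator c}) ` {..<q}"
  show ?thesis
  proof (rule exI[of _ ?A], intro conjI ballI)
  show "finite ?A" "?A \<subseteq> carrier N" using generator_vectors by (auto simp: N_simps)
  have inj: "inj_on (\<lambda>c. {generator c}) {..<q}"
    by (rule inj_onI) (auto simp: generator_def dest: fun_cong split: if_splits)
  fix x assume "x \<in> carrier N"
  then obtain v where v: "x = {v}" "v \<in> vectors" by (auto simp: N_simps)
  define f where "f a = v (the_inv_into {..<q} (\<lambda>c. {generator c}) a)" for a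
  have f: "f {generator c} = v c" if "c < q" for c
    using the_inv_into_f_f[OF inj, of c] that by (simp add: f_def)
  have gv: "(\<lambda>j. restrict_vars (B j) (v c) * generator c j) \<in> vectors" if "c < q" for c
    using vectors_simps(4)[OF generator_vectors[OF that]] .
  have "(\<Oplus>\<^bsub>N\<^esub>a\<in>?A. f a \<odot>\<^bsub>N\<^esub> a) = (\<Oplus>\<^bsub>N\<^esub>c\<in>{..<q}. f {generator c} \<odot>\<^bsub>N\<^esub> {generator c})"
    using inj generator_vectors vectors_simps(4)
    by (intro N.M.finsum_reindex) (auto simp: N_simps)
  also have "\<dots> = (\<Oplus>\<^bsub>N\<^esub>c\<in>{..<q}. {\<lambda>j. restrict_vars (B j) (v c) * generator c j})"
    using gv by (intro N.M.finsum_cong') (auto simp: N_simps f)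
  also have "\<dots> = {\<lambda>j. \<Sum>c<q. restrict_vars (B j) (v c) * generator c j}"
    using gv by (intro finsum_N) auto
  also have "(\<lambda>j. \<Sum>c<q. restrict_vars (B j) (v c) * generator c j) = v"
  proof
    fix j
    have "(\<Sum>c<q. restrict_vars (B j) (v c) * generator c j) = (\<Sum>c<q. if j = c then restrict_vars (B j) (v c) else 0)"
      by (intro sum.cong) (auto simp: generator_def)
    also have "\<dots> = (if j < q then restrict_vars (B j) (v j) else 0)" by (subst sum.delta') auto
    also have "\<dots> = v j" using v(2) by (auto simp: vectors_def restrict_vars_id)
    finally show "(\<Sum>c<q. restrict_vars (B j) (v c) * generator c j) = v j" .
  qed
  finally show "\<exists>f. x = (\<Oplus>\<^bsub>N\<^esub>a\<in>?A. f a \<odot>\<^bsub>N\<^esub> a)" unfolding v(1) by (intro exI[of _ f]) simp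
  qed
qed

lemma fg_graded_module_N: "fg_graded_module N"
  by (rule fg_graded_module.intro[OF module_N], rule fg_graded_module_axioms.intro)
    (rule component_subgroup_N direct_sum_N smult_component_N finitely_generated_N; assumption?)+

lemma hilbert_function_N:
  "hilbert_function N k = (\<Sum>c<q. card {e. Poly_Mapping.keys e \<subseteq> B c \<and> int (monom_degree e) + int (deg c) = k})"
proof -
  let ?F = "\<lambda>c. {e. Poly_Mapping.keys e \<subseteq> B c \<and> int (monom_degree e) + int (deg c) = k}"
  define E where "E = (SIGMA c:{..<q}. ?F c)"
  define b where "b i = (\<lambda>j. if j = fst i then Poly_Mapping.single (snd i) 1 else (0 :: ('n, 'k) mpoly))"
    for i :: "nat \<times> ('n \<Rightarrow>\<^sub>0 nat)"
  have finF: "finite (?F c)" for c by (rule finite_degree_subset[of _ "nat (k - int (deg c))"]) auto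
  then have fin: "finite E" by (simp add: E_def)
  have bv: "b i \<in> vectors" if "i \<in> E" for i
    using that by (auto simp: b_def E_def vectors_def polys_in_def)
  have "const a \<odot>\<^bsub>N\<^esub> {b i} = {\<lambda>j. if j = fst i then Poly_Mapping.single (snd i) a else 0}" for a i
    unfolding N_simps restrict_vars_const by (auto simp: b_def const_def mult_single fun_eq_iff)
  then have sum: "(\<Oplus>\<^bsub>N\<^esub>i\<in>E. const (t i) \<odot>\<^bsub>N\<^esub> {b i}) =
      {\<lambda>j. \<Sum>i\<in>E. if j = fst i then Poly_Mapping.single (snd i) (t i) else 0}" for t
    by (simp only:) (rule finsum_N, auto simp: E_def vectors_def polys_in_def split: if_splits)
  have lookup: "Poly_Mapping.lookup (\<Sum>i\<in>E. if j = fst i then Poly_Mapping.single (snd i) (t i) else 0) e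
      = (if (j, e) \<in> E then t (j, e) else 0)" for t :: "nat \<times> ('n \<Rightarrow>\<^sub>0 nat) \<Rightarrow> 'k" and j e
  proof -
    have "Poly_Mapping.lookup (\<Sum>i\<in>E. if j = fst i then Poly_Mapping.single (snd i) (t i) else 0) e
      = (\<Sum>i\<in>E. if i = (j, e) then t i else 0)"
      unfolding lookup_sum by (intro sum.cong) (auto simp: lookup_single when_def)
    also have "\<dots> = (if (j, e) \<in> E then t (j, e) else 0)" by (rule sum.delta[OF fin])
    finally show ?thesis .
  qed
  have "hilbert_function N k = card E"
  proof (rule N.hilbert_function_index[OF fin, where b = "\<lambda>i. {b i}"])
    show "{b i} \<in> component N k" if "i \<in> E" for i
      using bv[OF that] that unfolding N_simps by (intro imageI) (auto simp: b_def E_def split: if_splits)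
  next
    fix x assume "x \<in> component N k"
    then obtain v where v: "x = {v}" "v \<in> vectors"
        "\<forall>c. \<forall>e\<in>Poly_Mapping.keys (v c). int (monom_degree e) + int (deg c) = k"
      by (auto simp: N_simps)
    let ?t = "\<lambda>i. Poly_Mapping.lookup (v (fst i)) (snd i)"
    have "v = (\<lambda>j. \<Sum>i\<in>E. if j = fst i then Poly_Mapping.single (snd i) (?t i) else 0)"
    proof (intro ext poly_mapping_eqI)
      fix j e
      have "(j, e) \<in> E" if "Poly_Mapping.lookup (v j) e \<noteq> 0"
      proof -
        have e: "e \<in> Poly_Mapping.keys (v j)" using that by (simp add: in_keys_iff)
        then have "j < q" using v(2) by (cases "j < q") (auto simp: vectors_def)
        then show ?thesis using e v(3) vectors_polys_in[OF v(2), of j] by (auto simp: E_def polys_in_def)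
      qed
      then show "Poly_Mapping.lookup (v j) e =
          Poly_Mapping.lookup (\<Sum>i\<in>E. if j = fst i then Poly_Mapping.single (snd i) (?t i) else 0) e"
        unfolding lookup by auto
    qed
    then have "x = (\<Oplus>\<^bsub>N\<^esub>i\<in>E. const (?t i) \<odot>\<^bsub>N\<^esub> {b i})" unfolding v(1) sum by (rule arg_cong)
    then show "\<exists>t. x = (\<Oplus>\<^bsub>N\<^esub>i\<in>E. const (t i) \<odot>\<^bsub>N\<^esub> {b i})" by (rule exI[of _ ?t])
  next
    fix t u i assume "(\<Oplus>\<^bsub>N\<^esub>i\<in>E. const (t i) \<odot>\<^bsub>N\<^esub> {b i}) = (\<Oplus>\<^bsub>N\<^esub>i\<in>E. const (u i) \<odot>\<^bsub>N\<^esub> {b i})" and i: "i \<in> E"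
    then have "(\<lambda>j. \<Sum>i\<in>E. if j = fst i then Poly_Mapping.single (snd i) (t i) else 0)
      = (\<lambda>j. \<Sum>i\<in>E. if j = fst i then Poly_Mapping.single (snd i) (u i) else 0)" unfolding sum by simp
    from arg_cong[OF fun_cong[OF this, of "fst i"], of "\<lambda>p. Poly_Mapping.lookup p (snd i)"]
    show "t i = u i" unfolding lookup using i by simp
  qed
  then show ?thesis using finF by (simp add: E_def)
qed

text \<open>The analogue of membership in an ideal generated by variables, to be tested monomial by
  monomial. Each listed variable belongs to every summand, so it acts there by honest multiplication
  rather than by zero.\<close>

lemma seq_times_vars:
  assumes "\<And>i c. i \<in> set is \<Longrightarrow> c < q \<Longrightarrow> i \<in> B c"
  shows "seq_times (map var is) N =
    (\<lambda>v. {v}) ` {v \<in> vectors. \<forall>c. \<forall>e\<in>Poly_Mapping.keys (v c). \<exists>i\<in>set is. i \<in> Poly_Mapping.keys e}"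
  using assms
proof (induction "is" rule: rev_induct)
  case Nil
  have "{v \<in> vectors. \<forall>c. \<forall>e\<in>Poly_Mapping.keys (v c). \<exists>i\<in>set []. i \<in> Poly_Mapping.keys e} = {\<lambda>_. 0}"
    by (auto simp: vectors_simps(1) fun_eq_iff)
  then show ?case by (simp add: N.seq_times_Nil N_simps)
next
  case (snoc i "is")
  let ?D = "\<lambda>is. {v \<in> vectors. \<forall>c. \<forall>e\<in>Poly_Mapping.keys (v c). \<exists>i\<in>set is. i \<in> Poly_Mapping.keys e}"
  have IH: "seq_times (map var is) N = (\<lambda>v. {v}) ` ?D is" using snoc by simp
  have act: "var i \<odot>\<^bsub>N\<^esub> {v} = {\<lambda>c. var i * v c}" if "v \<in> vectors" for v
  proof -
    have "restrict_vars (B c) (var i) * v c = var i * v c" for c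
      using snoc.prems[of i c] that by (cases "c < q") (auto simp: restrict_vars_var vectors_def)
    then show ?thesis by (simp add: N_simps)
  qed
  show ?case
  proof (intro equalityI subsetI)
    fix x assume "x \<in> seq_times (map var (is @ [i])) N"
    then obtain s y where sy: "x = s \<oplus>\<^bsub>N\<^esub> var i \<odot>\<^bsub>N\<^esub> y" "s \<in> seq_times (map var is) N" "y \<in> carrier N"
      by (auto simp: N.seq_times_snoc)
    obtain v where v: "s = {v}" "v \<in> ?D is" using sy(2) unfolding IH by blast
    obtain w where w: "y = {w}" "w \<in> vectors" using sy(3) by (auto simp: N_simps)
    have x: "x = {\<lambda>c. v c + var i * w c}"
      unfolding sy(1) v(1) w(1) act[OF w(2)] by (simp add: N_simps)
    have "\<exists>i\<in>set (is @ [i]). i \<in> Poly_Mapping.keys e" if "e \<in> Poly_Mapping.keys (v c + var i * w c)" for c e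
    proof -
      have "e \<in> Poly_Mapping.keys (v c) \<or> e \<in> Poly_Mapping.keys (var i * w c)"
        using that Poly_Mapping.keys_add[of "v c" "var i * w c"] by blast
      then show ?thesis
      proof
        assume "e \<in> Poly_Mapping.keys (v c)"
        then have "\<exists>i\<in>set is. i \<in> Poly_Mapping.keys e" using v(2) by simp
        then show ?thesis by simp
      qed (auto dest: keys_var_mult)
    qed
    moreover have "(\<lambda>c. v c + var i * w c) \<in> vectors"
    proof -
      have "var i \<odot>\<^bsub>N\<^esub> {w} \<in> carrier N" using vectors_simps(4)[OF w(2), of "var i"] by (auto simp: N_simps)
      then have "(\<lambda>c. var i * w c) \<in> vectors" unfolding act[OF w(2)] by (auto simp: N_simps)
      then show ?thesis using v(2) vectors_simps(2) by simp
    qed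
    ultimately show "x \<in> (\<lambda>v. {v}) ` ?D (is @ [i])" unfolding x by blast
  next
    fix x assume "x \<in> (\<lambda>v. {v}) ` ?D (is @ [i])"
    then obtain v where v: "x = {v}" "v \<in> vectors"
      "\<And>c e. e \<in> Poly_Mapping.keys (v c) \<Longrightarrow> i \<in> Poly_Mapping.keys e \<or> (\<exists>i\<in>set is. i \<in> Poly_Mapping.keys e)"
      by auto
    \<comment> \<open>The monomials containing the last variable \<open>i\<close> go to
      \<open>v1\<close>, which is divisible by it; those left in \<open>v2\<close> must contain an
      earlier variable.\<close>
    define v1 where "v1 c = Poly_Mapping.mapp (\<lambda>e a. if i \<in> Poly_Mapping.keys e then a else 0) (v c)" for c
    define v2 where "v2 c = v c - v1 c" for c
    have l1: "Poly_Mapping.lookup (v1 c) e = (if i \<in> Poly_Mapping.keys e then Poly_Mapping.lookup (v c) e else 0)" for c e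
      unfolding v1_def by (subst lookup_mapp_eq) simp_all
    have k1: "e \<in> Poly_Mapping.keys (v1 c) \<longleftrightarrow> e \<in> Poly_Mapping.keys (v c) \<and> i \<in> Poly_Mapping.keys e" for e c
      by (simp add: in_keys_iff[of e] l1)
    have k2: "e \<in> Poly_Mapping.keys (v2 c) \<longleftrightarrow> e \<in> Poly_Mapping.keys (v c) \<and> i \<notin> Poly_Mapping.keys e" for e c
      by (simp add: in_keys_iff[of e] v2_def lookup_minus l1)
    have "\<forall>c. \<exists>g. g \<in> polys_in (B c) \<and> v1 c = var i * g \<and> (q \<le> c \<longrightarrow> g = 0)"
      (is "\<forall>c. ?P c")
    proof
      fix c show "?P c"
      proof (cases "c < q")
        case True
        have "v1 c \<in> polys_in (B c)" using vectors_polys_in[OF v(2), of c] k1 by (auto simp: polys_in_def)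
        from divide_by_var[OF this, of i] k1 True show ?thesis by (metis not_less)
      next
        case False
        then have "v1 c = 0" using v(2) by (intro poly_mapping_eqI) (auto simp: l1 vectors_def)
        then show ?thesis by (intro exI[of _ 0]) (simp add: polys_in_simps)
      qed
    qed
    from choice[OF this] obtain w where
      "\<forall>c. w c \<in> polys_in (B c) \<and> v1 c = var i * w c \<and> (q \<le> c \<longrightarrow> w c = 0)" ..
    then have w: "\<And>c. w c \<in> polys_in (B c)" "\<And>c. v1 c = var i * w c" "\<And>c. q \<le> c \<Longrightarrow> w c = 0"
      by simp_all
    have wv: "w \<in> vectors" using w by (simp add: vectors_def)
    have v2v: "v2 \<in> vectors"
    proof -
      have "v2 c \<in> polys_in (B c)" for c
        using vectors_polys_in[OF v(2), of c] k2 by (auto simp: polys_in_def)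
      moreover have "v2 c = 0" if "q \<le> c" for c
        using v(2) that by (intro poly_mapping_eqI) (auto simp: v2_def l1 lookup_minus vectors_def)
      ultimately show ?thesis by (simp add: vectors_def)
    qed
    have "v2 \<in> ?D is" using v2v k2 v(3) by blast
    then have s: "{v2} \<in> seq_times (map var is) N" unfolding IH by (rule imageI)
    have "{v} = {v2} \<oplus>\<^bsub>N\<^esub> var i \<odot>\<^bsub>N\<^esub> {w}"
      unfolding act[OF wv] by (simp add: N_simps w(2)[symmetric] v2_def)
    moreover have "{w} \<in> carrier N" using wv by (simp add: N_simps)
    ultimately show "x \<in> seq_times (map var (is @ [i])) N"
      unfolding v(1) using s by (auto simp: N.seq_times_snoc)
  qed
qed

text \<open>Multiplying by a variable that is not among the earlier ones does not change whether a
  monomial contains an earlier one, so variables common to all summands form a regular sequence. The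
  generator of the first summand stays outside their multiples.\<close>

lemma depth_N:
  assumes "0 < q" "distinct is" "\<And>i c. i \<in> set is \<Longrightarrow> c < q \<Longrightarrow> i \<in> B c"
  shows "enat (length is) \<le> depth N"
proof -
  have "set (map var is) \<subseteq> (irrelevant_ideal :: ('n, 'k) mpoly set)"
    unfolding irrelevant_ideal_def
    using ring.genideal_self[OF ring_from_type_algebra, of "range (var :: 'n \<Rightarrow> ('n, 'k) mpoly)"] by auto
  moreover have "regular_sequence (map var is) N"
    unfolding regular_sequence_def
  proof (intro conjI allI impI ballI)
    fix j x assume j: "j < length (map var is)" and x: "x \<in> carrier N"
      and H: "map var is ! j \<odot>\<^bsub>N\<^esub> x \<in> seq_times (take j (map var is)) N"
    let ?i = "is ! j" and ?t = "take j is"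
    have t: "seq_times (take j (map var is)) N =
      (\<lambda>v. {v}) ` {v \<in> vectors. \<forall>c. \<forall>e\<in>Poly_Mapping.keys (v c). \<exists>i\<in>set ?t. i \<in> Poly_Mapping.keys e}"
      unfolding take_map by (rule seq_times_vars) (use assms(3) in \<open>auto dest: in_set_takeD\<close>)
    obtain v where v: "x = {v}" "v \<in> vectors" using x by (auto simp: N_simps)
    have inB: "?i \<in> B c" if "c < q" for c using assms(3) that j by simp
    have notin: "?i \<notin> set ?t"
      using assms(2) j by (auto simp: in_set_conv_nth nth_eq_iff_index_eq)
    have "{\<lambda>c. restrict_vars (B c) (var ?i) * v c} \<in> seq_times (take j (map var is)) N"
      using H j by (simp add: v(1) N_simps)
    then have D: "\<exists>i\<in>set ?t. i \<in> Poly_Mapping.keys e"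
      if "e \<in> Poly_Mapping.keys (restrict_vars (B c) (var ?i) * v c)" for c e
      unfolding t using that by blast
    have "\<exists>i\<in>set ?t. i \<in> Poly_Mapping.keys e" if e: "e \<in> Poly_Mapping.keys (v c)" for c e
    proof -
      have "c < q" using e v(2) by (cases "c < q") (auto simp: vectors_def)
      then have "e + Poly_Mapping.single ?i 1 \<in> Poly_Mapping.keys (restrict_vars (B c) (var ?i) * v c)"
        using e inB by (simp add: in_keys_iff restrict_vars_var lookup_var_mult del: One_nat_def)
      from D[OF this] show ?thesis using notin by (auto simp: keys_add_nat)
    qed
    then show "x \<in> seq_times (take j (map var is)) N" unfolding t v(1) using v(2) by blast
  next
    have "{generator 0} \<in> carrier N" using generator_vectors[OF assms(1)] by (simp add: N_simps)
    moreover have "{generator 0} \<notin> seq_times (map var is) N"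
    proof
      assume "{generator 0} \<in> seq_times (map var is) N"
      then have "\<forall>e\<in>Poly_Mapping.keys (generator 0 0). \<exists>i\<in>set is. i \<in> Poly_Mapping.keys e"
        using seq_times_vars[of "is"] assms(3) by auto
      then show False by (simp add: generator_def)
    qed
    ultimately show "seq_times (map var is) N \<noteq> carrier N" by blast
  qed
  ultimately show ?thesis unfolding depth_def
    by (intro SUP_upper2[of "map var is"]) auto
qed

end

lemma hilbert_function_squarefree_veronese_nat:
  "hilbert_function (ideal_module (squarefree_veronese m :: ('n::finite, 'k::field) mpoly set)) (int d) =
    (\<Sum>j=m..CARD('n). (CARD('n) choose j) * full_count j d)"
  by (simp only: hilbert_function_squarefree_veronese of_nat_eq_iff card_large_support)

lemma hilbert_function_squarefree_veronese_negative:
  "k < 0 \<Longrightarrow> hilbert_function (ideal_module (squarefree_veronese m :: ('n::finite, 'k::field) mpoly set)) k = 0"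
  unfolding hilbert_function_squarefree_veronese by auto

lemma hilbert_series_squarefree_veronese_nth:
  "fls_nth (hilbert_series (ideal_module (squarefree_veronese m :: ('n::finite, 'k::field) mpoly set))) k =
    int (hilbert_function (ideal_module (squarefree_veronese m :: ('n, 'k) mpoly set)) k)"
  unfolding hilbert_series_def
  by (intro nth_Abs_fls_ex_lower_bound exI[of _ 0]) (simp add: hilbert_function_squarefree_veronese_negative)

section \<open>The Hilbert depth\<close>

lemma depth_le_if_hilbert_series_eq:
  fixes N :: "(('n::finite, 'k::field) mpoly, 'b) graded_module"
  assumes m: "m \<le> CARD('n)" and N: "fg_graded_module N"
    and hs: "hilbert_series N = hilbert_series (ideal_module (squarefree_veronese m :: ('n, 'k) mpoly set))"
  shows "depth N \<le> enat (m + (CARD('n) - m) div (m + 1))"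
  unfolding depth_def
proof (intro SUP_least)
  interpret N: fg_graded_module N by (rule N)
  let ?n = "CARD('n)"
  let ?J = "ideal_module (squarefree_veronese m :: ('n, 'k) mpoly set)"
  fix fs assume "fs \<in> {fs. set fs \<subseteq> irrelevant_ideal \<and> regular_sequence fs N}"
  then have fs: "set fs \<subseteq> irrelevant_ideal" "regular_sequence fs N" by auto
  have H: "hilbert_function N k = hilbert_function ?J k" for k
    using N.hilbert_series_nth[of k] hs hilbert_series_squarefree_veronese_nth[of m k, where ?'n = 'n and ?'k = 'k]
    by simp
  \<comment> \<open>A monomial with at least \<open>m\<close> variables has degree at least
    \<open>m\<close>; for \<open>m = 0\<close> the degree in question is negative.\<close>
  have "hilbert_function N (int m - 1) = 0"
  proof (cases "m = 0")
    case False
    then have eq: "int m - 1 = int (m - 1)" by simp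
    show ?thesis unfolding H eq hilbert_function_squarefree_veronese_nat
      using False by (intro sum.neutral) (auto simp: full_count_less)
  qed (simp add: H hilbert_function_squarefree_veronese_negative)
  then have "component N (int m - 1) = {\<zero>\<^bsub>N\<^esub>}" by (simp add: N.hilbert_function_eq_0_iff)
  from N.regular_sequence_growth[OF fs this]
  have growth: "length fs * hilbert_function N (int m) \<le> hilbert_function N (int (Suc m))" by (simp add: add.commute)
  have Hm: "hilbert_function N (int m) = (?n choose m)"
  proof -
    have "(\<Sum>j=m..?n. (?n choose j) * full_count j m) = (\<Sum>j\<in>{m}. (?n choose j) * full_count j m)"
      using m by (intro sum.mono_neutral_right) (auto simp: full_count_less)
    then show ?thesis by (simp add: H hilbert_function_squarefree_veronese_nat full_count_eq)
  qed
  have HSm: "hilbert_function N (int (Suc m)) = (?n choose m) * m + (?n choose Suc m)"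
  proof -
    \<comment> \<open>For \<open>m = n\<close> the index \<open>Suc m\<close> falls outside the
      range on the left, but there the binomial coefficient is zero.\<close>
    have "(\<Sum>j=m..?n. (?n choose j) * full_count j (Suc m)) = (\<Sum>j\<in>{m, Suc m}. (?n choose j) * full_count j (Suc m))"
      using m by (intro sum.mono_neutral_cong) (auto simp: full_count_less binomial_eq_0)
    then show ?thesis unfolding H hilbert_function_squarefree_veronese_nat by (simp add: full_count_eq[of "Suc m"] full_count_Suc del: full_count.simps)
  qed
  define c where "c = int (?n choose m)"
  have c: "c > 0" using m by (simp add: c_def)
  have "int (length fs) * c \<le> c * int m + int (?n choose Suc m)"
    using growth unfolding Hm HSm c_def by (simp flip: of_nat_mult of_nat_add)
  \<comment> \<open>The factor \<open>m + 1\<close> turns \<open>n choose Suc m\<close> into a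
    multiple of \<open>c\<close>, after which \<open>c\<close> cancels.\<close>
  then have "(int m + 1) * (int (length fs) * c) \<le> (int m + 1) * (c * int m + int (?n choose Suc m))"
    by (intro mult_left_mono) auto
  also have "\<dots> = c * ((int m + 1) * int m + (int ?n - int m))"
    using choose_Suc_times[of m ?n] by (simp add: c_def algebra_simps)
  finally have "c * ((int m + 1) * int (length fs)) \<le> c * ((int m + 1) * int m + (int ?n - int m))"
    by (simp add: mult_ac)
  then have "(int m + 1) * int (length fs) \<le> (int m + 1) * int m + (int ?n - int m)"
    using c mult_le_cancel_left_pos by blast
  then have "int ((m + 1) * length fs) \<le> int ((m + 1) * m + (?n - m))"
    using m by (simp add: of_nat_diff algebra_simps)
  then have "(m + 1) * length fs \<le> (m + 1) * m + (?n - m)" by (simp only: of_nat_le_iff)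
  then have "length fs \<le> ((m + 1) * m + (?n - m)) div (m + 1)"
    by (simp add: less_eq_div_iff_mult_less_eq mult.commute)
  also have "\<dots> = m + (?n - m) div (m + 1)" by (subst div_mult_self4) auto
  finally show "enat (length fs) \<le> enat (m + (?n - m) div (m + 1))" by simp
qed

lemma sum_list_concat_replicate:
  "sum_list (map F (concat (map (\<lambda>k. replicate (a k) (p k)) ks))) = sum_list (map (\<lambda>k. a k * F (p k)) ks)"
  for a :: "'a \<Rightarrow> nat"
  by (induction ks) (simp_all add: sum_list_replicate)

lemma exists_module_of_depth:
  fixes m :: nat
  assumes "1 \<le> m" "m + s * (m + 1) \<le> CARD('n)"
  shows "\<exists>N :: (('n::finite, 'k::field) mpoly, (nat \<Rightarrow> ('n, 'k) mpoly) set) graded_module.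
    fg_graded_module N \<and> enat (m + s) \<le> depth N \<and>
    hilbert_series N = hilbert_series (ideal_module (squarefree_veronese m :: ('n, 'k) mpoly set))"
proof -
  let ?n = "CARD('n)" and ?r = "m + s"
  obtain A where A: "\<And>j. j \<le> s \<Longrightarrow> ?n choose (m + j) = (\<Sum>k\<le>j. A k * ((s - k) choose (j - k)))"
    by (rule binomial_decomposition[OF assms]) blast
  have rn: "?r \<le> ?n" using assms(2) by (rule order_trans[rotated]) simp
  obtain x where x: "bij_betw x {..<?n} (UNIV :: 'n set)"
    using ex_bij_betw_nat_finite[of "UNIV :: 'n set"] by (auto simp: atLeast0LessThan)
  have inj: "inj_on x {..<b}" if "b \<le> ?n" for b
    using x that by (auto simp: bij_betw_def intro: inj_on_subset)
  \<comment> \<open>A pair \<open>(a, b)\<close> stands for a polynomial ring in \<open>b\<close>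
    variables generated in degree \<open>a\<close>. The first block realizes the truncated part by
    rings in \<open>m + s\<close> variables, the second the remaining terms one by one.\<close>
  define L where "L = concat (map (\<lambda>k. replicate (A k) (m + k, ?r)) [0..<Suc s]) @
    concat (map (\<lambda>j. replicate (?n choose j) (j, j)) [Suc ?r..<Suc ?n])"
  have L: "fst p \<le> snd p" "?r \<le> snd p" "snd p \<le> ?n" if "p \<in> set L" for p
    using that rn by (auto simp: L_def)
  define B where "B c = x ` {..<snd (L ! c)}" for c
  define deg where "deg c = fst (L ! c)" for c
  interpret P: polynomial_sum "length L" B deg "TYPE('k)" .
  have sum_L: "(\<Sum>c<length L. F (L ! c)) = (\<Sum>k\<le>s. A k * F (m + k, ?r)) + (\<Sum>j\<in>{?r<..?n}. (?n choose j) * F (j, j))"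
    for F :: "nat \<times> nat \<Rightarrow> nat"
  proof -
    have "(\<Sum>c<length L. F (L ! c)) = sum_list (map F L)"
      by (simp add: sum_list_sum_nth atLeast0LessThan)
    also have "\<dots> = sum_list (map (\<lambda>k. A k * F (m + k, ?r)) [0..<Suc s]) + sum_list (map (\<lambda>j. (?n choose j) * F (j, j)) [Suc ?r..<Suc ?n])"
      unfolding L_def map_append sum_list_append sum_list_concat_replicate by simp
    also have "\<dots> = (\<Sum>k\<le>s. A k * F (m + k, ?r)) + (\<Sum>j\<in>{?r<..?n}. (?n choose j) * F (j, j))"
      unfolding interv_sum_list_conv_sum_set_nat set_upt
      by (intro arg_cong2[where f = "(+)"] sum.cong) auto
    finally show ?thesis .
  qed
  have card_B: "card (B c) = snd (L ! c)" if "c < length L" for c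
    unfolding B_def using L(3)[of "L ! c"] that by (subst card_image) (auto intro: inj)
  have H: "hilbert_function P.N k = hilbert_function (ideal_module (squarefree_veronese m :: ('n, 'k) mpoly set)) k" for k
  proof (cases "k < 0")
    case True
    then show ?thesis by (simp add: P.hilbert_function_N hilbert_function_squarefree_veronese_negative)
  next
    case False
    then obtain d where k: "k = int d" by (metis nat_0_le not_less)
    \<comment> \<open>The contribution of the summand \<open>(a, b)\<close> in degree
      \<open>d\<close>, by \<open>card_shifted_support\<close>. In terms of
      \<open>full_count\<close>, both Hilbert functions are expanded along the same powers of
      \<open>t / (1 - t)\<close>.\<close>
    define F where "F = (\<lambda>(a, b). \<Sum>i\<le>b - a. ((b - a) choose i) * full_count (a + i) d)"
    have "hilbert_function P.N k = (\<Sum>c<length L. F (L ! c))"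
      unfolding P.hilbert_function_N
    proof (rule sum.cong)
      fix c assume "c \<in> {..<length L}"
      then have c: "c < length L" by simp
      have "deg c \<le> card (B c)" using L(1)[of "L ! c"] c card_B[OF c] by (simp add: deg_def)
      from card_shifted_support[OF this, of d]
      show "card {e. Poly_Mapping.keys e \<subseteq> B c \<and> int (monom_degree e) + int (deg c) = k} = F (L ! c)"
        by (simp add: k F_def card_B[OF c] deg_def case_prod_unfold flip: of_nat_add)
    qed simp
    also have "\<dots> = (\<Sum>k\<le>s. A k * F (m + k, ?r)) + (\<Sum>j\<in>{?r<..?n}. (?n choose j) * F (j, j))" by (rule sum_L)
    also have "(\<Sum>k\<le>s. A k * F (m + k, ?r)) = (\<Sum>j\<le>s. (?n choose (m + j)) * full_count (m + j) d)"
    proof -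
      have "(\<Sum>k\<le>s. A k * F (m + k, ?r)) = (\<Sum>k\<le>s. \<Sum>j\<in>{k..s}. A k * ((s - k) choose (j - k)) * full_count (m + j) d)"
      proof (rule sum.cong)
        fix k assume "k \<in> {..s}"
        then have "F (m + k, ?r) = (\<Sum>j\<in>{k..s}. ((s - k) choose (j - k)) * full_count (m + j) d)"
          unfolding F_def prod.case
          by (intro sum.reindex_bij_witness[of _ "\<lambda>j. j - k" "\<lambda>i. k + i"]) (auto simp: add.assoc)
        then show "A k * F (m + k, ?r) = (\<Sum>j\<in>{k..s}. A k * ((s - k) choose (j - k)) * full_count (m + j) d)"
          by (simp add: sum_distrib_left mult.assoc)
      qed simp
      also have "\<dots> = (\<Sum>j\<le>s. \<Sum>k\<le>j. A k * ((s - k) choose (j - k)) * full_count (m + j) d)"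
        unfolding sum.Sigma[OF finite_atMost ballI[OF finite_atMost]]
          sum.Sigma[OF finite_atMost ballI[OF finite_atLeastAtMost]]
        by (rule sum.reindex_bij_witness[of _ prod.swap prod.swap]) auto
      also have "\<dots> = (\<Sum>j\<le>s. (?n choose (m + j)) * full_count (m + j) d)"
        by (intro sum.cong refl) (simp add: A sum_distrib_right)
      finally show ?thesis .
    qed
    also have "\<dots> = (\<Sum>j\<in>{m..?r}. (?n choose j) * full_count j d)"
      by (rule sum.reindex_bij_witness[of _ "\<lambda>j. j - m" "\<lambda>j. m + j"]) auto
    also have "(\<Sum>j\<in>{?r<..?n}. (?n choose j) * F (j, j)) = (\<Sum>j\<in>{?r<..?n}. (?n choose j) * full_count j d)"
      by (simp add: F_def)
    also have "(\<Sum>j\<in>{m..?r}. (?n choose j) * full_count j d) + (\<Sum>j\<in>{?r<..?n}. (?n choose j) * full_count j d)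
        = (\<Sum>j\<in>{m..?r} \<union> {?r<..?n}. (?n choose j) * full_count j d)"
      by (rule sum.union_disjoint[symmetric]) auto
    also have "{m..?r} \<union> {?r<..?n} = {m..?n}" using rn by auto
    finally show ?thesis by (simp add: k hilbert_function_squarefree_veronese_nat)
  qed
  \<comment> \<open>A zero module has no regular sequences, so some summand must be present:
    \<open>A 0 = n choose m\<close> is positive.\<close>
  have "L \<noteq> []"
  proof
    assume "L = []"
    then have "A 0 = 0" by (auto simp: L_def)
    moreover have "A 0 = (?n choose m)" using A[of 0] by simp
    ultimately show False using rn by simp
  qed
  have "enat (length (map x [0..<?r])) \<le> depth P.N"
  proof (rule P.depth_N)
    show "0 < length L" using \<open>L \<noteq> []\<close> by simp
    show "distinct (map x [0..<?r])" using inj[OF rn] by (simp add: distinct_map atLeast0LessThan)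
    show "i \<in> B c" if "i \<in> set (map x [0..<?r])" "c < length L" for i c
      using that L(2)[of "L ! c"] by (auto simp: B_def)
  qed
  moreover have "hilbert_series P.N = hilbert_series (ideal_module (squarefree_veronese m :: ('n, 'k) mpoly set))"
    by (simp add: hilbert_series_def H)
  ultimately show ?thesis using P.fg_graded_module_N by (intro exI[of _ P.N]) simp
qed

theorem theorem3p10:
  fixes m :: nat
  assumes "1 \<le> m" and "m \<le> CARD('n)"
  shows "hdepth (ideal_module (squarefree_veronese m :: ('n::finite, 'k::field) mpoly set)) =
           enat (m + (CARD('n) - m) div (m + 1))"
proof (rule antisym)
  show "hdepth (ideal_module (squarefree_veronese m :: ('n, 'k) mpoly set)) \<le> enat (m + (CARD('n) - m) div (m + 1))"
    unfolding hdepth_def by (rule SUP_least) (use depth_le_if_hilbert_series_eq[OF assms(2)] in blast)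
  \<comment> \<open>The quotient is the largest \<open>s\<close> with
    \<open>m + s * (m + 1) \<le> n\<close>.\<close>
  have "(CARD('n) - m) div (m + 1) * (m + 1) \<le> CARD('n) - m" by (rule div_times_less_eq_dividend)
  then have "m + (CARD('n) - m) div (m + 1) * (m + 1) \<le> CARD('n)" using assms(2) by linarith
  from exists_module_of_depth[OF assms(1) this, where ?'k = 'k]
  obtain N :: "(('n, 'k) mpoly, (nat \<Rightarrow> ('n, 'k) mpoly) set) graded_module"
    where "fg_graded_module N" "enat (m + (CARD('n) - m) div (m + 1)) \<le> depth N"
      "hilbert_series N = hilbert_series (ideal_module (squarefree_veronese m :: ('n, 'k) mpoly set))" by blast
  then show "enat (m + (CARD('n) - m) div (m + 1)) \<le> hdepth (ideal_module (squarefree_veronese m :: ('n, 'k) mpoly set))"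
    unfolding hdepth_def by (intro SUP_upper2[of N]) auto
qed

end
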